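(* Let $-1\le\alpha\le0\le\beta\le1$, let $\sigma$ be a finite nonnegative measure with infinite support on $E=[-1,\alpha]\cup[\beta,1]$, and let $$\mathfrak F(\lambda)=\int_E\frac{t\,d\sigma(t)}{t-\lambda}\in\mathbf D^-_{-\infty},\qquad F(\lambda)=\int_E\frac{d\sigma(t)}{t-\lambda}.$$ Let $\{\mathfrak n_j\}_{j\ge1}$ be the normal indices of the coefficient sequence $\mathfrak s_j=\int_Et^{j+1}d\sigma(t)$, $j\in\mathbb Z_+$, of $\mathfrak F$, and $\mathfrak n_0=0$. Then the following statements are equivalent: (i) for $\mathfrak s_{-1}:=\int_Ed\sigma(t)$, the operator $U=U(\mathfrak s_{-1})$ in the block $UL$-factorization $\mathfrak J=UL$ (with parameter $\mathfrak s_{-1}$) of the monic generalized Jacobi matrix $\mathfrak J$ associated with $\mathfrak F$ is bounded in $\ell^2_{[0,\infty)}$; (ii) the operator $U$ in the block $LU$-factorization $J=LU$ of the monic Jacobi matrix $J$ associated with $F$ is bounded in $\ell^2_{[0,\infty)}$; (iii) the sequence $\{\mathfrak F^{[\mathfrak n_j/\mathfrak n_j]}\}_{j=0}^\infty$ of diagonal Padé approximants converges to $\mathfrak F$ locally uniformly in $\widehat{\mathbb C}\setminus([-1-\varepsilon,\alpha]\cup[\beta,1+\varepsilon])$ for some $\varepsilon\ge0$.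
   Context: $\widehat{\mathbb C}=\mathbb C\cup\{\infty\}$ with the spherical metric. $\lambda\widehat\to\infty$ means that $\lambda\to\infty$ inside a sector $\varepsilon<\arg\lambda<\pi-\varepsilon$, $\varepsilon>0$; $\mathfrak F(\lambda)\sim-\sum_j\mathfrak s_j\lambda^{-j-1}$ denotes the asymptotic expansion to all orders as $\lambda\widehat\to\infty$. $\mathbf N_{-\infty}$ is the class of functions $\int_{\mathbb R}\frac{d\mu(t)}{t-\lambda}$ with $\mu$ a finite measure with all moments finite. $\mathbf D^-_{-\infty}$: functions $\mathfrak F$ meromorphic in $\mathbb C_+$ such that for some $\mathfrak s_{-1}\in\mathbb R\setminus\{0\}$ one has $-\frac{\mathfrak s_{-1}}{\lambda}+\frac{\mathfrak F(\lambda)}{\lambda}\in\mathbf N_{-\infty}$. Padé approximants: for a formal power series $\mathfrak F=-\sum_{j\ge0}\mathfrak s_j\lambda^{-j-1}$, the $[L/M]$ approximant is a ratio $A(1/\lambda)/B(1/\lambda)$ of polynomials of formal degrees $L$ and $M$ with $B(0)\neq0$ and $\sum_{j=0}^{L+M-1}\mathfrak s_j\lambda^{-j-1}+\mathfrak F^{[L/M]}(\lambda)=O(\lambda^{-L-M-1})$, $\lambda\to\infty$. Jacobi matrix: $s_j=\int t^jd\sigma$; the monic orthogonal polynomials $P_j$ of $\sigma/s_0$ satisfy $\lambda P_j=P_{j+1}+b_jP_j+c_{j-1}P_{j-1}$, $P_{-1}=0$, $P_0=1$; the monic Jacobi matrix associated with $F$ has $J_{j,j}=b_j$, $J_{j,j+1}=1$,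 $J_{j+1,j}=c_j$. Normal indices of $\{\mathfrak s_j\}_{j\ge0}$: integers $n\ge1$ with $\det(\mathfrak s_{i+k})_{i,k=0}^{n-1}\ne0$, listed increasingly $\mathfrak n_1<\mathfrak n_2<\dots$; $\mathfrak n_0=0$, $\mathfrak k_j=\mathfrak n_{j+1}-\mathfrak n_j\in\{1,2\}$. Generalized Jacobi matrix: $\mathfrak F$ (nonrational) is normalized if its first nonzero coefficient $\mathfrak s_{\mathfrak n_1-1}$ has modulus $1$. For normalized $\mathfrak F$ put $\mathfrak F_0=\mathfrak F$ and recursively $-1/\mathfrak F_j(\lambda)=\epsilon_j\mathfrak p_j(\lambda)+\mathfrak b_j^2\mathfrak F_{j+1}(\lambda)$, where $\epsilon_j=\pm1$ is the first nonzero asymptotic coefficient of $\mathfrak F_j$, $\mathfrak p_j$ is the monic polynomial (of degree $\mathfrak k_j$) with $-1/\mathfrak F_j-\epsilon_j\mathfrak p_j=o(1)$ as $\lambda\widehat\to\infty$, and $\mathfrak b_j>0$ makes $\mathfrak F_{j+1}$ normalized. Put $\mathfrak c_j=\epsilon_j\epsilon_{j+1}\mathfrak b_j^2$; $\mathfrak p_j(\lambda)=\lambda+\mathfrak p_0^{(j)}$ if $\mathfrak k_j=1$, $\mathfrak p_j(\lambda)=\lambda^2+\mathfrak p_1^{(j)}\lambda+\mathfrak p_0^{(j)}$ if $\mathfrak k_j=2$. The monic generalized Jacobi matrix associated with $\mathfrak F$ is the block tridiagonal matrix with diagonal blocks $-\mathfrak p_0^{(j)}$ ($\mathfrak k_j=1$)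 or $\begin{pmatrix}0&1\\-\mathfrak p_0^{(j)}&-\mathfrak p_1^{(j)}\end{pmatrix}$ ($\mathfrak k_j=2$), superdiagonal $\mathfrak k_j\times\mathfrak k_{j+1}$ blocks with lower-left entry $1$ and other entries $0$, and subdiagonal $\mathfrak k_{j+1}\times\mathfrak k_j$ blocks with lower-left entry $\mathfrak c_j$ and other entries $0$. For $\mathfrak F$ not normalized one uses $\mathfrak F/|\mathfrak s_{\mathfrak n_1-1}|$. Form of $L$ and $U$ in (i) and (ii): $L$ has identity diagonal blocks $I_{\mathfrak k_j}$, subdiagonal blocks $L_{j+1}$ ($\mathfrak k_{j+1}\times\mathfrak k_j$, upper-left entry $l_{j+1}$, other entries $0$) and zeros elsewhere; $U$ has diagonal blocks $U_j=u_0^{(j)}$ if $\mathfrak k_j=1$, $U_j=\begin{pmatrix}0&1\\ u_0^{(j)}&u_1^{(j)}\end{pmatrix}$ if $\mathfrak k_j=2$, superdiagonal blocks $D_j$ ($\mathfrak k_j\times\mathfrak k_{j+1}$, lower-left entry $1$, other entries $0$) and zeros elsewhere. The $LU$-factorization $J=LU$ of this form exists and is unique. The $UL$-factorization $\mathfrak J=UL$ with parameter $\mathfrak s_{-1}$ is the (unique) one of this form with $u_0^{(0)}=\mathfrak s_{\mathfrak n_1-1}/\mathfrak s_{-1}$. A matrix is bounded in $\ell^2_{[0,\infty)}$ if it defines a bounded operator there. *)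

theory Defs
  imports
    "HOL-Complex_Analysis.Complex_Analysis"
    "HOL-Library.Landau_Symbols"
    "Jordan_Normal_Form.Determinant"
begin

section \<open>Measures and function classes\<close>

definition measure_support :: "real measure \<Rightarrow> real set" where
  "measure_support \<mu> = {t. \<forall>S. open S \<and> t \<in> S \<longrightarrow> emeasure \<mu> S \<noteq> 0}"

definition stieltjes :: "real measure \<Rightarrow> complex \<Rightarrow> complex" where
  "stieltjes \<mu> z = (LINT t|\<mu>. 1 / (complex_of_real t - z))"

text \<open>The classes $\mathbf N_{-\infty}$ and $\mathbf D^-_{-\infty}$; only the values on the open
  upper half plane matter.\<close>

definition N_minus_infty :: "(complex \<Rightarrow> complex) set" where
  "N_minus_infty = {f. \<exists>\<mu>. finite_measure \<mu> \<and> sets \<mu> = sets borel \<and>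
      (\<forall>j. integrable \<mu> (\<lambda>t. t ^ j)) \<and> (\<forall>z. Im z > 0 \<longrightarrow> f z = stieltjes \<mu> z)}"

definition D_minus_minus_infty :: "(complex \<Rightarrow> complex) set" where
  "D_minus_minus_infty = {f. f meromorphic_on {z. Im z > 0} \<and>
      (\<exists>s::real. s \<noteq> 0 \<and> (\<lambda>z. - complex_of_real s / z + f z / z) \<in> N_minus_infty)}"

section \<open>Asymptotic expansions\<close>

definition sector_infinity :: "real \<Rightarrow> complex filter" where
  "sector_infinity e = inf at_infinity (principal {z. e < Arg z \<and> Arg z < pi - e})"

definition has_asymp_coeffs :: "(complex \<Rightarrow> complex) \<Rightarrow> (nat \<Rightarrow> real) \<Rightarrow> bool" where
  "has_asymp_coeffs f s \<longleftrightarrow>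
     (\<forall>e>0. \<forall>n. (\<lambda>z. f z + (\<Sum>j<n. complex_of_real (s j) / z ^ (j + 1)))
                   \<in> O[sector_infinity e](\<lambda>z. 1 / z ^ (n + 1)))"

definition asymp_coeffs :: "(complex \<Rightarrow> complex) \<Rightarrow> nat \<Rightarrow> real" where
  "asymp_coeffs f = (THE s. has_asymp_coeffs f s)"

definition first_coeff :: "(complex \<Rightarrow> complex) \<Rightarrow> real" where
  "first_coeff f = asymp_coeffs f (LEAST j. asymp_coeffs f j \<noteq> 0)"

section \<open>Normal indices and block matrices\<close>

definition hankel_det :: "(nat \<Rightarrow> real) \<Rightarrow> nat \<Rightarrow> real" where
  "hankel_det s n = Determinant.det (Matrix.mat n n (\<lambda>(i, k). s (i + k)))"

text \<open>The increasing enumeration starts with the conventional index $0$; the normal indices proper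
  are the values at \<open>j \<ge> 1\<close>.\<close>

definition normal_index :: "(nat \<Rightarrow> real) \<Rightarrow> nat \<Rightarrow> nat" where
  "normal_index s = enumerate (insert 0 {n. n \<ge> 1 \<and> hankel_det s n \<noteq> 0})"

type_synonym inf_matrix = "nat \<Rightarrow> nat \<Rightarrow> real"

text \<open>A strictly increasing sequence \<open>ns\<close> with \<open>ns 0 = 0\<close> splits the indices into
  the blocks \<open>{ns j..<ns (j + 1)}\<close>. A block matrix is given by its entries \<open>B j m r q\<close>: row \<open>r\<close> and
  column \<open>q\<close>, counted from \<open>0\<close>, inside the block at position \<open>(j, m)\<close>.\<close>

definition block_size :: "(nat \<Rightarrow> nat) \<Rightarrow> nat \<Rightarrow> nat" where
  "block_size ns j = ns (Suc j) - ns j"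

definition block_of :: "(nat \<Rightarrow> nat) \<Rightarrow> nat \<Rightarrow> nat" where
  "block_of ns i = (GREATEST j. ns j \<le> i)"

definition block_matrix :: "(nat \<Rightarrow> nat) \<Rightarrow> (nat \<Rightarrow> nat \<Rightarrow> nat \<Rightarrow> nat \<Rightarrow> real) \<Rightarrow> inf_matrix" where
  "block_matrix ns B i k =
     B (block_of ns i) (block_of ns k) (i - ns (block_of ns i)) (k - ns (block_of ns k))"

text \<open>\<open>companion_entry\<close> gives the entries of $(u_0^{(j)})$ (size $1$) and of the matrix with rows
  $(0, 1)$ and $(u_0^{(j)}, u_1^{(j)})$ (size $2$).\<close>

definition companion_entry ::
    "(nat \<Rightarrow> nat) \<Rightarrow> (nat \<Rightarrow> real) \<Rightarrow> (nat \<Rightarrow> real) \<Rightarrow> nat \<Rightarrow> nat \<Rightarrow> nat \<Rightarrow> real" where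
  "companion_entry ns u0 u1 j r q =
     (if block_size ns j = 1 then u0 j
      else if r = 0 then (if q = 0 then 0 else 1)
      else (if q = 0 then u0 j else u1 j))"

definition lower_left :: "(nat \<Rightarrow> nat) \<Rightarrow> real \<Rightarrow> nat \<Rightarrow> nat \<Rightarrow> nat \<Rightarrow> real" where
  "lower_left ns x j r q = (if Suc r = block_size ns j \<and> q = 0 then x else 0)"

definition L_matrix :: "(nat \<Rightarrow> nat) \<Rightarrow> (nat \<Rightarrow> real) \<Rightarrow> inf_matrix" where
  "L_matrix ns l = block_matrix ns (\<lambda>j m r q.
     if m = j then (if r = q then 1 else 0)
     else if j = Suc m then (if r = 0 \<and> q = 0 then l j else 0)
     else 0)"

definition U_matrix :: "(nat \<Rightarrow> nat) \<Rightarrow> (nat \<Rightarrow> real) \<Rightarrow> (nat \<Rightarrow> real) \<Rightarrow> inf_matrix" where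
  "U_matrix ns u0 u1 = block_matrix ns (\<lambda>j m r q.
     if m = j then companion_entry ns u0 u1 j r q
     else if m = Suc j then lower_left ns 1 j r q
     else 0)"

text \<open>All products formed below have only finitely many nonzero terms in each entry.\<close>

definition inf_matrix_mult :: "inf_matrix \<Rightarrow> inf_matrix \<Rightarrow> inf_matrix" where
  "inf_matrix_mult A B i k = (\<Sum>j. A i j * B j k)"

definition block_LU :: "(nat \<Rightarrow> nat) \<Rightarrow> inf_matrix \<Rightarrow> inf_matrix \<Rightarrow> inf_matrix \<Rightarrow> bool" where
  "block_LU ns J L U \<longleftrightarrow>
     (\<exists>l u0 u1. L = L_matrix ns l \<and> U = U_matrix ns u0 u1) \<and> J = inf_matrix_mult L U"

text \<open>The last argument \<open>u\<close> prescribes the free entry $u_0^{(0)}$.\<close>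

definition block_UL ::
    "(nat \<Rightarrow> nat) \<Rightarrow> inf_matrix \<Rightarrow> inf_matrix \<Rightarrow> inf_matrix \<Rightarrow> real \<Rightarrow> bool" where
  "block_UL ns J U L u \<longleftrightarrow>
     (\<exists>l u0 u1. L = L_matrix ns l \<and> U = U_matrix ns u0 u1 \<and> u0 0 = u) \<and> J = inf_matrix_mult U L"

definition in_ell2 :: "(nat \<Rightarrow> complex) \<Rightarrow> bool" where
  "in_ell2 x \<longleftrightarrow> summable (\<lambda>i. (cmod (x i))\<^sup>2)"

definition ell2_norm :: "(nat \<Rightarrow> complex) \<Rightarrow> real" where
  "ell2_norm x = sqrt (\<Sum>i. (cmod (x i))\<^sup>2)"

definition inf_matrix_apply :: "inf_matrix \<Rightarrow> (nat \<Rightarrow> complex) \<Rightarrow> nat \<Rightarrow> complex" where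
  "inf_matrix_apply A x i = (\<Sum>k. complex_of_real (A i k) * x k)"

definition bounded_in_ell2 :: "inf_matrix \<Rightarrow> bool" where
  "bounded_in_ell2 A \<longleftrightarrow> (\<exists>C. \<forall>x. in_ell2 x \<longrightarrow>
     (\<forall>i. summable (\<lambda>k. complex_of_real (A i k) * x k)) \<and>
     in_ell2 (inf_matrix_apply A x) \<and> ell2_norm (inf_matrix_apply A x) \<le> C * ell2_norm x)"

section \<open>The monic Jacobi matrix\<close>

text \<open>Orthogonality with respect to \<open>\<sigma>\<close> and to its normalization to a probability measure are
  the same condition.\<close>

definition monic_orth_poly :: "real measure \<Rightarrow> nat \<Rightarrow> real poly" where
  "monic_orth_poly \<sigma> n = (THE p. degree p = n \<and> lead_coeff p = 1 \<and>
     (\<forall>q. degree q < n \<longrightarrow> (LINT t|\<sigma>. poly p t * poly q t) = 0))"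

text \<open>The pair \<open>(b, c)\<close> of sequences in $\lambda P_j = P_{j+1} + b_j P_j + c_{j-1} P_{j-1}$.\<close>

definition recurrence_coeffs :: "real measure \<Rightarrow> (nat \<Rightarrow> real) \<times> (nat \<Rightarrow> real)" where
  "recurrence_coeffs \<sigma> = (THE (b, c). \<forall>j.
     [:0, 1:] * monic_orth_poly \<sigma> j =
       monic_orth_poly \<sigma> (Suc j) + Polynomial.smult (b j) (monic_orth_poly \<sigma> j) +
       (if j = 0 then 0 else Polynomial.smult (c (j - 1)) (monic_orth_poly \<sigma> (j - 1))))"

text \<open>The monic Jacobi matrix associated with \<open>stieltjes \<sigma>\<close>.\<close>

definition monic_jacobi :: "real measure \<Rightarrow> inf_matrix" where
  "monic_jacobi \<sigma> i k =
     (if k = i then fst (recurrence_coeffs \<sigma>) i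
      else if k = Suc i then 1
      else if i = Suc k then snd (recurrence_coeffs \<sigma>) k
      else 0)"

section \<open>The monic generalized Jacobi matrix\<close>

text \<open>One step $-1/f = \epsilon\,\mathfrak p + \mathfrak b^2 g$ for a normalized \<open>f\<close>, where
  $\epsilon$ is \<open>first_coeff f\<close>. Values at zeros of \<open>f\<close> are irrelevant, since \<open>f\<close> has no zeros
  of large modulus in a sector and only the behaviour at infinity in sectors is used.\<close>

definition step_poly :: "(complex \<Rightarrow> complex) \<Rightarrow> real poly" where
  "step_poly f = (THE p. lead_coeff p = 1 \<and>
     (\<forall>e>0. ((\<lambda>z. - 1 / f z - complex_of_real (first_coeff f) * poly (map_poly complex_of_real p) z)
               \<longlongrightarrow> 0) (sector_infinity e)))"

definition step_rest :: "(complex \<Rightarrow> complex) \<Rightarrow> complex \<Rightarrow> complex" where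
  "step_rest f z =
     - 1 / f z - complex_of_real (first_coeff f) * poly (map_poly complex_of_real (step_poly f)) z"

definition step_b :: "(complex \<Rightarrow> complex) \<Rightarrow> real" where
  "step_b f = (THE b. b > 0 \<and> \<bar>first_coeff (\<lambda>z. step_rest f z / complex_of_real (b\<^sup>2))\<bar> = 1)"

primrec schur_iterate :: "(complex \<Rightarrow> complex) \<Rightarrow> nat \<Rightarrow> complex \<Rightarrow> complex" where
  "schur_iterate f 0 = (\<lambda>z. f z / complex_of_real \<bar>first_coeff f\<bar>)"
| "schur_iterate f (Suc j) =
     (\<lambda>z. step_rest (schur_iterate f j) z / complex_of_real ((step_b (schur_iterate f j))\<^sup>2))"

definition gjac_eps :: "(complex \<Rightarrow> complex) \<Rightarrow> nat \<Rightarrow> real" where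
  "gjac_eps f j = first_coeff (schur_iterate f j)"

definition gjac_p :: "(complex \<Rightarrow> complex) \<Rightarrow> nat \<Rightarrow> real poly" where
  "gjac_p f j = step_poly (schur_iterate f j)"

definition gjac_c :: "(complex \<Rightarrow> complex) \<Rightarrow> nat \<Rightarrow> real" where
  "gjac_c f j = gjac_eps f j * gjac_eps f (Suc j) * (step_b (schur_iterate f j))\<^sup>2"

definition monic_gen_jacobi :: "(complex \<Rightarrow> complex) \<Rightarrow> inf_matrix" where
  "monic_gen_jacobi f = (let ns = normal_index (asymp_coeffs f) in block_matrix ns (\<lambda>j m r q.
     if m = j then
       companion_entry ns (\<lambda>j. - coeff (gjac_p f j) 0) (\<lambda>j. - coeff (gjac_p f j) 1) j r q
     else if m = Suc j then lower_left ns 1 j r q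
     else if j = Suc m then lower_left ns (gjac_c f m) j r q
     else 0))"

section \<open>Pade approximants on the Riemann sphere\<close>

text \<open>The Riemann sphere is modelled by \<^typ>\<open>complex option\<close>, where \<^term>\<open>None\<close> is the point at
  infinity. The spherical (chordal) metric is the distance of the images under the inverse
  stereographic projection onto the unit sphere in $\mathbb C\times\mathbb R$.\<close>

definition stereo :: "complex option \<Rightarrow> complex \<times> real" where
  "stereo z = (case z of
      None \<Rightarrow> (0, 1)
    | Some w \<Rightarrow> (2 * w / complex_of_real (1 + (cmod w)\<^sup>2), ((cmod w)\<^sup>2 - 1) / ((cmod w)\<^sup>2 + 1)))"

definition locally_uniform_limit ::
    "complex option set \<Rightarrow> (nat \<Rightarrow> complex option \<Rightarrow> complex option) \<Rightarrow>
     (complex option \<Rightarrow> complex option) \<Rightarrow> bool" where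
  "locally_uniform_limit S R g \<longleftrightarrow> (\<forall>z\<in>S. \<exists>r>0.
     uniform_limit {w \<in> S. dist (stereo w) (stereo z) < r}
       (\<lambda>n w. stereo (R n w)) (\<lambda>w. stereo (g w)) sequentially)"

text \<open>The rational function $A(1/\lambda)/B(1/\lambda)$ for coprime \<open>A\<close>, \<open>B\<close>, as a map of the
  sphere. For finite $\lambda$ the ratio is expanded by $\lambda^N$, which also gives the right
  value at $\lambda = 0$.\<close>

definition sphere_ratio :: "complex poly \<Rightarrow> complex poly \<Rightarrow> complex option \<Rightarrow> complex option" where
  "sphere_ratio A B z =
     (let N = max (degree A) (degree B);
          hom = (\<lambda>C. case z of None \<Rightarrow> coeff C 0 | Some w \<Rightarrow> (\<Sum>i\<le>N. coeff C i * w ^ (N - i)))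
      in if hom B = 0 then None else Some (hom A / hom B))"

text \<open>\<open>R\<close> is the $[L/M]$ approximant of $-\sum_j s_j\lambda^{-j-1}$. Requiring lowest terms is no
  restriction on the rational function: cancelling a common factor of \<open>A\<close> and \<open>B\<close> preserves the
  other conditions.\<close>

definition pade_approximant ::
    "(nat \<Rightarrow> real) \<Rightarrow> nat \<Rightarrow> nat \<Rightarrow> (complex option \<Rightarrow> complex option) \<Rightarrow> bool" where
  "pade_approximant s L M R \<longleftrightarrow> (\<exists>A B :: complex poly.
     degree A \<le> L \<and> degree B \<le> M \<and> poly B 0 \<noteq> 0 \<and> coprime A B \<and>
     (\<lambda>z. (\<Sum>j<L + M. complex_of_real (s j) / z ^ (j + 1)) + poly A (1 / z) / poly B (1 / z))
        \<in> O[at_infinity](\<lambda>z. 1 / z ^ (L + M + 1)) \<and>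
     R = sphere_ratio A B)"

end

theory Submission
  imports Defs "HOL-Computational_Algebra.Fundamental_Theorem_Algebra"
    "HOL-Computational_Algebra.Polynomial_Factorial" "HOL-Computational_Algebra.Field_as_Ring"
begin

text \<open>
  All three conditions say that the quotients \<open>P (n + 1) 0 / P n 0\<close> stay bounded along the normal
  indices \<open>n\<close>, where the \<open>P n\<close> are the monic orthogonal polynomials of \<open>\<sigma>\<close>.

  A vector in the kernel of the Hankel matrix of the shifted moments is a polynomial \<open>q\<close> with
  \<open>t q(t)\<close> proportional to \<open>P n\<close>, so \<open>n\<close> is normal exactly if \<open>P n 0 \<noteq> 0\<close>
  (\<open>hankel_det_shifted_moments\<close>). As \<open>P n\<close> and \<open>P (n + 1)\<close> have no common root, the blocks have
  size 1 or 2. In the factorization \<open>J = LU\<close> the corner of a block of \<open>U\<close> of size 1 is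
  \<open>- P (n + 1) 0 / P n 0\<close>, and all other entries of \<open>U\<close> are constants or recurrence coefficients, of
  modulus at most 1 (\<open>monic_jacobi_LU\<close>). The factorization is unique, and a band matrix is bounded
  exactly if its entries are; this settles the second condition.

  The matrix \<open>U\<close> maps the column of the \<open>P n\<close> to \<open>\<lambda>\<close> times the column of the polynomials orthogonal
  for \<open>t d\<sigma>(t)\<close>, each followed by its product with \<open>\<lambda>\<close> in a block of size 2, and \<open>L\<close> maps the latter back to the \<open>P n\<close>. So \<open>UL\<close> describes the recurrence of the
  polynomials for \<open>t d\<sigma>(t)\<close> (\<open>T_recurrence\<close>). The functions of the second kind satisfy the same
  recurrence, and their successive quotients are, up to constant factors, the functions in the
  continued fraction of \<open>\<FF>\<close> (locale \<open>continued_fraction\<close>). Hence \<open>UL\<close> is the generalized Jacobi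
  matrix (\<open>monic_gen_jacobi_UL\<close>), and the first condition concerns the very same \<open>U\<close>.

  For a normal index \<open>n\<close> the polynomial \<open>P (n + 1) - \<theta> P n\<close> with \<open>\<theta> = P (n + 1) 0 / P n 0\<close> has
  \<open>n + 1\<close> simple real roots, one of them \<open>0\<close>. They are the nodes of a quadrature rule with positive
  weights \<open>w(x)\<close> that is exact up to degree \<open>2 n\<close>, and \<open>\<Sum> w(x) x / (x - \<lambda>)\<close>, summed over the nodes
  \<open>x\<close>, is the diagonal Pade approximant: it is \<open>\<FF>\<close> with the measure replaced by the quadrature rule. The node
  \<open>0\<close> produces no pole, and no other node lies in the gap between \<open>\<alpha>\<close> and \<open>\<beta>\<close>. For \<open>\<bar>x\<bar> \<ge> 3\<close> the quotient
  \<open>P (n + 1) x / P n x\<close> differs from \<open>x\<close> by at most 2, so the nodes are bounded exactly if the \<open>\<theta>\<close> are.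
  If they are, the rules converge weakly and the approximants converge off the segments
  (\<open>convergence_of_rho_bounded\<close>). Conversely, convergence near infinity keeps the poles away from
  infinity (\<open>rho_bounded_of_convergence\<close>).
\<close>

section \<open>Orthogonal polynomials on the unit interval\<close>

locale measure_on_unit_interval = finite_measure \<sigma> for \<sigma> :: "real measure" +
  assumes sets_borel: "sets \<sigma> = sets borel"
    and null_outside: "emeasure \<sigma> (- {-1..1}) = 0"
    and infinite_support: "infinite (measure_support \<sigma>)"
begin

lemma measurable_iff_borel: "f \<in> borel_measurable \<sigma> \<longleftrightarrow> f \<in> borel_measurable borel"
  using sets_borel by (simp cong: measurable_cong_sets)

lemma AE_unit_interval: "AE t in \<sigma>. t \<in> {-1..1}"
proof (rule AE_I)
  show "{t \<in> space \<sigma>. t \<notin> {-1..1}} \<subseteq> - {-1..1}" by auto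
  show "emeasure \<sigma> (- {-1..1}) = 0" by (rule null_outside)
  show "- {-1..1} \<in> sets \<sigma>" by (simp add: sets_borel)
qed

lemma integrable_bounded:
  fixes f :: "real \<Rightarrow> 'a :: {banach, second_countable_topology}"
  assumes "f \<in> borel_measurable borel" "\<And>t. t \<in> {-1..1} \<Longrightarrow> norm (f t) \<le> B"
  shows "integrable \<sigma> f"
proof (rule integrable_const_bound)
  show "AE t in \<sigma>. norm (f t) \<le> B"
    using AE_unit_interval by eventually_elim (use assms in auto)
  show "f \<in> borel_measurable \<sigma>" using assms(1) by (simp add: measurable_iff_borel)
qed

lemma integrable_continuous:
  fixes f :: "real \<Rightarrow> 'a :: {banach, second_countable_topology}"
  assumes "continuous_on UNIV f"
  shows "integrable \<sigma> f"
proof -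
  have "bounded (f ` {-1..1})"
    by (intro compact_imp_bounded compact_continuous_image continuous_on_subset[OF assms]) auto
  then obtain B where "\<forall>t\<in>{-1..1}. norm (f t) \<le> B" by (auto simp: bounded_iff)
  with borel_measurable_continuous_onI[OF assms] show ?thesis by (intro integrable_bounded) auto
qed

lemma integrable_poly [simp, intro]: "integrable \<sigma> (poly p)"
  by (rule integrable_continuous) (intro continuous_intros)

definition M :: "real poly \<Rightarrow> real" where
  "M p = (LINT t|\<sigma>. poly p t)"

lemma M_cong: "(\<And>t. poly p t = poly q t) \<Longrightarrow> M p = M q"
  unfolding M_def by (metis poly_ext)

lemma M_add: "M (p + q) = M p + M q"
proof -
  have "poly (p + q) = (\<lambda>t. poly p t + poly q t)" by auto
  thus ?thesis unfolding M_def by (simp add: Bochner_Integration.integral_add)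
qed

lemma M_smult: "M (Polynomial.smult a p) = a * M p"
proof -
  have "poly (Polynomial.smult a p) = (\<lambda>t. a * poly p t)" by auto
  thus ?thesis unfolding M_def by simp
qed

lemma M_diff: "M (p - q) = M p - M q"
  using M_add[of p "- q"] M_smult[of "-1" q] by simp

lemma M_0 [simp]: "M 0 = 0"
  using M_smult[of 0 0] by simp

lemma M_sum: "M (\<Sum>i\<in>I. f i) = (\<Sum>i\<in>I. M (f i))"
  by (induction I rule: infinite_finite_induct) (auto simp: M_add)

lemma M_mono:
  assumes "\<And>t. t \<in> {-1..1} \<Longrightarrow> poly p t \<le> poly q t"
  shows "M p \<le> M q"
  unfolding M_def
proof (rule integral_mono_AE)
  show "AE t in \<sigma>. poly p t \<le> poly q t"
    using AE_unit_interval by eventually_elim (use assms in auto)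
qed auto

text \<open>A nonzero polynomial has only finitely many roots, so it cannot vanish almost everywhere for
  a measure of infinite support.\<close>

lemma poly_AE_nonneg_integral_zero:
  assumes "AE t in \<sigma>. 0 \<le> poly p t" "M p = 0"
  shows "p = 0"
proof (rule ccontr)
  assume "p \<noteq> 0"
  have ae: "AE t in \<sigma>. poly p t = 0"
    using assms integral_nonneg_eq_0_iff_AE[OF integrable_poly[of p]] by (simp add: M_def)
  have "measure_support \<sigma> \<subseteq> {t. poly p t = 0}"
  proof
    fix t assume t: "t \<in> measure_support \<sigma>"
    have op: "open {t. poly p t \<noteq> 0}"
      by (intro open_Collect_neq continuous_intros)
    have "emeasure \<sigma> {t. poly p t \<noteq> 0} = 0"
    proof -
      have "{t. poly p t \<noteq> 0} \<in> sets \<sigma>" using op sets_borel by auto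
      moreover have "space \<sigma> = UNIV" using sets_eq_imp_space_eq[OF sets_borel] by simp
      ultimately show ?thesis using ae AE_iff_measurable[of "{t. poly p t \<noteq> 0}" \<sigma> "\<lambda>t. poly p t = 0"]
        by auto
    qed
    with t op show "t \<in> {t. poly p t = 0}" by (auto simp: measure_support_def)
  qed
  with poly_roots_finite[OF \<open>p \<noteq> 0\<close>] infinite_support show False
    using finite_subset by blast
qed

lemma M_square_pos: "p \<noteq> 0 \<Longrightarrow> M (p * p) > 0"
proof -
  assume "p \<noteq> 0"
  have "M (p * p) \<ge> 0" using M_mono[of 0 "p * p"] by simp
  moreover have "M (p * p) \<noteq> 0"
    using poly_AE_nonneg_integral_zero[of "p * p"] \<open>p \<noteq> 0\<close> by auto
  ultimately show ?thesis by simp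
qed

text \<open>The recursion takes the three-term recurrence as the definition, which yields existence of the
  orthogonal polynomials and their recurrence at once.\<close>

fun P :: "nat \<Rightarrow> real poly" where
  "P 0 = 1"
| "P (Suc 0) = [:- (M [:0, 1:] / M 1), 1:]"
| "P (Suc (Suc n)) =
     [:- (M ([:0, 1:] * (P (Suc n) * P (Suc n))) / M (P (Suc n) * P (Suc n))), 1:] * P (Suc n)
     - Polynomial.smult (M (P (Suc n) * P (Suc n)) / M (P n * P n)) (P n)"

definition sqn :: "nat \<Rightarrow> real" where "sqn n = M (P n * P n)"
definition rb :: "nat \<Rightarrow> real" where "rb n = M ([:0, 1:] * (P n * P n)) / sqn n"
definition rc :: "nat \<Rightarrow> real" where "rc n = sqn (Suc n) / sqn n"

text \<open>The bound \<open>degree q < n\<close> fails for \<open>q = 0\<close> and \<open>n = 0\<close>, where orthogonality statements need it;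
  this version counts the zero polynomial as of degree \<open>-\<infinity>\<close>.\<close>

definition deg_less :: "nat \<Rightarrow> real poly \<Rightarrow> bool" where
  "deg_less n q \<longleftrightarrow> (\<forall>i\<ge>n. coeff q i = 0)"

lemma deg_less_iff: "deg_less n q \<longleftrightarrow> q = 0 \<or> degree q < n"
  unfolding deg_less_def
  by (metis coeff_0 coeff_eq_0 leading_coeff_0_iff linorder_not_le order_less_le_trans)

lemma deg_less_mono: "deg_less n q \<Longrightarrow> n \<le> m \<Longrightarrow> deg_less m q"
  by (auto simp: deg_less_def)

lemma deg_less_X_mult: "deg_less n p \<Longrightarrow> deg_less (Suc n) ([:0, 1:] * p)"
  by (auto simp: deg_less_def coeff_pCons split: nat.split)

lemma rec_P0: "[:0, 1:] * P 0 = P 1 + Polynomial.smult (rb 0) (P 0)"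
  by (simp add: rb_def sqn_def)

lemma rec_P:
  "[:0, 1:] * P (Suc n) =
     P (Suc (Suc n)) + Polynomial.smult (rb (Suc n)) (P (Suc n)) + Polynomial.smult (rc n) (P n)"
  by (simp add: rb_def sqn_def rc_def algebra_simps)

lemma P_Suc_Suc: "P (Suc (Suc n)) =
    [:0, 1:] * P (Suc n) - Polynomial.smult (rb (Suc n)) (P (Suc n)) - Polynomial.smult (rc n) (P n)"
  by (subst rec_P) simp

declare P.simps(3) [simp del]

lemma degree_lead_P: "degree (P n) = n \<and> lead_coeff (P n) = 1"
proof (induction n rule: P.induct)
  case (3 n)
  let ?A = "[:0, 1:] * P (Suc n)"
  let ?B = "Polynomial.smult (rb (Suc n)) (P (Suc n)) + Polynomial.smult (rc n) (P n)"
  have eq: "P (Suc (Suc n)) = ?A + - ?B" by (subst P_Suc_Suc) simp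
  have nz: "P (Suc n) \<noteq> 0" using 3 by auto
  have dA: "degree ?A = Suc (Suc n)" using 3 nz by (subst degree_mult_eq) auto
  have lA: "lead_coeff ?A = 1" using 3 by (subst lead_coeff_mult) auto
  have "degree ?B \<le> Suc n"
    using 3 by (intro degree_add_le order.trans[OF degree_smult_le]) auto
  hence dB: "degree (- ?B) < degree ?A" unfolding degree_minus dA by simp
  have "degree (P (Suc (Suc n))) = degree ?A" unfolding eq by (rule degree_add_eq_left[OF dB])
  moreover have "lead_coeff (P (Suc (Suc n))) = lead_coeff ?A"
    unfolding eq by (metis add.commute dB lead_coeff_add_le)
  ultimately show ?case using dA lA by simp
qed auto

lemma degree_P [simp]: "degree (P n) = n" and coeff_P [simp]: "coeff (P n) n = 1"
  using degree_lead_P[of n] by auto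

lemma P_nonzero [simp]: "P n \<noteq> 0"
  using coeff_P[of n] by (metis coeff_0 zero_neq_one)

lemma sqn_pos [simp]: "sqn n > 0"
  unfolding sqn_def by (rule M_square_pos) simp

lemma sqn_nz [simp]: "sqn n \<noteq> 0" using sqn_pos[of n] by linarith

text \<open>Subtracting the multiple of \<open>P n\<close> with the same top coefficient is the step by which polynomials
  are expanded in the \<open>P n\<close>.\<close>

lemma deg_less_reduce: "deg_less (Suc n) q \<Longrightarrow> deg_less n (q - Polynomial.smult (coeff q n) (P n))"
  unfolding deg_less_def
proof safe
  fix i assume "\<forall>i\<ge>Suc n. coeff q i = 0" "n \<le> i"
  then show "coeff (q - Polynomial.smult (coeff q n) (P n)) i = 0"
    by (cases "i = n") (auto simp: coeff_eq_0)
qed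

lemma P_orth: "deg_less n q \<Longrightarrow> M (P n * q) = 0"
proof (induction n arbitrary: q rule: P.induct)
  case 1
  then show ?case by (auto simp: deg_less_iff)
next
  case 2
  then obtain a where q: "q = [:a:]" by (auto simp: deg_less_iff dest: degree_0_id[symmetric] intro: that)
  have "M 1 > 0" using M_square_pos[of 1] by simp
  moreover have "M (P (Suc 0) * q) = a * (M [:0, 1:] - M [:0, 1:] / M 1 * M 1)"
    unfolding q M_smult[symmetric] M_diff[symmetric] by (rule arg_cong[where f = M]) (simp add: algebra_simps)
  ultimately show ?case by simp
next
  case (3 n)
  \<comment> \<open>Only the components of \<open>q\<close> along the two previous polynomials need the recurrence
      coefficients; the rest is handled by moving the variable onto it.\<close>
  have IH: "deg_less (Suc n) r \<Longrightarrow> M (P (Suc n) * r) = 0"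
    and IH': "deg_less n r \<Longrightarrow> M (P n * r) = 0" for r
    using "3.IH" by blast+
  define q1 where "q1 = q - Polynomial.smult (coeff q (Suc n)) (P (Suc n))"
  have q1: "deg_less (Suc n) q1" unfolding q1_def using "3.prems" by (rule deg_less_reduce)
  define q2 where "q2 = q1 - Polynomial.smult (coeff q1 n) (P n)"
  have q2: "deg_less n q2" unfolding q2_def using q1 by (rule deg_less_reduce)
  have q: "q = Polynomial.smult (coeff q (Suc n)) (P (Suc n)) + Polynomial.smult (coeff q1 n) (P n) + q2"
    by (simp add: q1_def q2_def)
  have dl: "deg_less (Suc n) (P n)" by (simp add: deg_less_iff)
  have exp: "M (P (Suc (Suc n)) * r) = M (P (Suc n) * ([:0, 1:] * r)) - rb (Suc n) * M (P (Suc n) * r)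
        - rc n * M (P n * r)" for r
    unfolding P_Suc_Suc M_smult[symmetric] M_diff[symmetric]
    by (rule arg_cong[where f = M]) (simp add: algebra_simps)
  have "M (P (Suc (Suc n)) * P (Suc n)) = 0"
  proof -
    have "M (P n * P (Suc n)) = 0" using IH[OF dl] by (simp add: mult.commute)
    moreover have "M (P (Suc n) * ([:0, 1:] * P (Suc n))) = rb (Suc n) * M (P (Suc n) * P (Suc n))"
      using sqn_nz[of "Suc n"] by (simp add: rb_def sqn_def mult_ac)
    ultimately show ?thesis by (simp add: exp)
  qed
  moreover have "M (P (Suc (Suc n)) * P n) = 0"
  proof -
    have "deg_less (Suc n) ([:0, 1:] * P n - P (Suc n))"
      unfolding deg_less_def
    proof safe
      fix i assume "Suc n \<le> i"
      then show "coeff ([:0, 1:] * P n - P (Suc n)) i = 0"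
        by (cases i; cases "i = Suc n") (auto simp: coeff_pCons coeff_eq_0)
    qed
    from IH[OF this] have "M (P (Suc n) * ([:0, 1:] * P n)) = sqn (Suc n)"
      by (simp add: sqn_def right_diff_distrib M_diff)
    then show ?thesis using IH[OF dl] sqn_nz[of n] by (simp add: exp rc_def flip: sqn_def)
  qed
  moreover have "M (P (Suc (Suc n)) * q2) = 0"
    using IH[OF deg_less_X_mult[OF q2]] IH[OF deg_less_mono[OF q2]] IH'[OF q2] by (simp add: exp)
  ultimately show ?case
    by (subst q) (simp add: distrib_left M_add M_smult)
qed

lemma P_inner_self: "M (P n * q) = coeff q n * sqn n" if "deg_less (Suc n) q"
  using P_orth[OF deg_less_reduce[OF that]] by (simp add: right_diff_distrib M_diff M_smult sqn_def)

text \<open>The difference of two candidates has lower degree, hence is orthogonal to both and to itself.\<close>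

lemma P_unique:
  assumes "degree p = n" "lead_coeff p = 1" "\<And>q. degree q < n \<Longrightarrow> M (p * q) = 0"
  shows "p = P n"
proof -
  have d: "deg_less n (p - P n)"
    unfolding deg_less_def using assms by (auto simp: coeff_eq_0 le_less)
  have "p - P n = 0"
  proof (rule ccontr)
    assume "p - P n \<noteq> 0"
    hence "M (p * (p - P n)) = 0" using d assms(3) by (auto simp: deg_less_iff)
    moreover have "M (P n * (p - P n)) = 0" using P_orth[OF d] .
    ultimately have "M ((p - P n) * (p - P n)) = 0" by (simp add: left_diff_distrib M_diff)
    with M_square_pos[OF \<open>p - P n \<noteq> 0\<close>] show False by simp
  qed
  thus ?thesis by simp
qed

lemma monic_orth_poly_eq: "monic_orth_poly \<sigma> n = P n"
  unfolding monic_orth_poly_def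
proof (rule the_equality)
  show "degree (P n) = n \<and> lead_coeff (P n) = 1 \<and>
    (\<forall>q. degree q < n \<longrightarrow> (LINT t|\<sigma>. poly (P n) t * poly q t) = 0)"
    using P_orth[of n] by (auto simp: M_def deg_less_iff)
next
  fix p assume "degree p = n \<and> lead_coeff p = 1 \<and>
    (\<forall>q. degree q < n \<longrightarrow> (LINT t|\<sigma>. poly p t * poly q t) = 0)"
  then show "p = P n" by (intro P_unique) (auto simp: M_def)
qed

lemma recurrence_coeffs_eq: "recurrence_coeffs \<sigma> = (rb, rc)"
  unfolding recurrence_coeffs_def monic_orth_poly_eq
proof (rule the_equality)
  show "case (rb, rc) of (b, c) \<Rightarrow> \<forall>j. [:0, 1:] * P j = P (Suc j) + Polynomial.smult (b j) (P j) +
      (if j = 0 then 0 else Polynomial.smult (c (j - 1)) (P (j - 1)))"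
  proof (clarsimp simp del: mult_pCons_left, safe, goal_cases)
    case 1 then show ?case using rec_P0 by simp
  next
    case (2 j) then show ?case using rec_P[of "j - 1"] by (simp del: mult_pCons_left)
  qed
next
  fix x :: "(nat \<Rightarrow> real) \<times> (nat \<Rightarrow> real)"
  assume x: "case x of (b, c) \<Rightarrow> \<forall>j. [:0, 1:] * P j = P (Suc j) + Polynomial.smult (b j) (P j) +
      (if j = 0 then 0 else Polynomial.smult (c (j - 1)) (P (j - 1)))"
  obtain b c where bc: "x = (b, c)" by (cases x)
  have r: "[:0, 1:] * P j = P (Suc j) + Polynomial.smult (b j) (P j) +
      (if j = 0 then 0 else Polynomial.smult (c (j - 1)) (P (j - 1)))" for j
    using x by (simp add: bc del: mult_pCons_left)
  have 0: "b 0 = rb 0" using r[of 0] rec_P0 by (simp del: mult_pCons_left)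
  have S: "b (Suc j) = rb (Suc j) \<and> c j = rc j" for j
  proof -
    have e: "P (Suc (Suc j)) + Polynomial.smult (b (Suc j)) (P (Suc j)) + Polynomial.smult (c j) (P j) =
        P (Suc (Suc j)) + Polynomial.smult (rb (Suc j)) (P (Suc j)) + Polynomial.smult (rc j) (P j)"
      using r[of "Suc j"] rec_P[of j] by (simp del: mult_pCons_left)
    from arg_cong[OF this, of "\<lambda>p. coeff p (Suc j)"] have 1: "b (Suc j) = rb (Suc j)"
      by (simp add: coeff_eq_0[of "P j"])
    from arg_cong[OF e, of "\<lambda>p. coeff p j"] 1 have "c j = rc j" by simp
    with 1 show ?thesis by simp
  qed
  have "b = rb" using 0 S by (intro ext) (metis nat.exhaust)
  moreover have "c = rc" using S by (intro ext) auto
  ultimately show "x = (rb, rc)" by (simp add: bc)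
qed

lemma rc_pos [simp]: "rc n > 0"
  by (simp add: rc_def)

lemma rc_nonzero [simp]: "rc n \<noteq> 0"
  using rc_pos[of n] by linarith

text \<open>The coefficient is the mean of \<open>t\<close> for the probability measure proportional to \<open>(P n)\<^sup>2 d\<sigma>\<close>.\<close>

lemma rb_bound: "\<bar>rb n\<bar> \<le> 1"
proof -
  have 1: "M ([:0, 1:] * (P n * P n)) \<le> sqn n"
    unfolding sqn_def
  proof (rule M_mono)
    fix t :: real assume "t \<in> {-1..1}"
    then have "t * (poly (P n) t * poly (P n) t) \<le> 1 * (poly (P n) t * poly (P n) t)"
      by (intro mult_right_mono) auto
    then show "poly ([:0, 1:] * (P n * P n)) t \<le> poly (P n * P n) t" by simp
  qed
  have "M (Polynomial.smult (-1) (P n * P n)) \<le> M ([:0, 1:] * (P n * P n))"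
  proof (rule M_mono)
    fix t :: real assume "t \<in> {-1..1}"
    then have "(-1) * (poly (P n) t * poly (P n) t) \<le> t * (poly (P n) t * poly (P n) t)"
      by (intro mult_right_mono) auto
    then show "poly (Polynomial.smult (-1) (P n * P n)) t \<le> poly ([:0, 1:] * (P n * P n)) t" by simp
  qed
  hence 2: "- sqn n \<le> M ([:0, 1:] * (P n * P n))" unfolding M_smult sqn_def[symmetric] by simp
  show ?thesis using 1 2 sqn_pos[of n] by (auto simp: rb_def field_simps abs_le_iff)
qed

text \<open>The polynomial \<open>P (n + 1)\<close> is the projection of \<open>t P n\<close> onto the complement of the lower
  degrees, so its norm is at most that of \<open>t P n\<close>.\<close>

lemma rc_le_1: "rc n \<le> 1"
proof -
  let ?r = "[:0, 1:] * P n - P (Suc n)"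
  have d: "deg_less (Suc n) ?r"
    unfolding deg_less_def
  proof safe
    fix i assume "Suc n \<le> i"
    then show "coeff ([:0, 1:] * P n - P (Suc n)) i = 0"
      by (cases i; cases "i = Suc n") (auto simp: coeff_pCons coeff_eq_0)
  qed
  have "M (([:0, 1:] * P n) * ([:0, 1:] * P n)) = M (P (Suc n) * P (Suc n) + Polynomial.smult 2 (P (Suc n) * ?r) + ?r * ?r)"
    by (rule M_cong) (simp add: algebra_simps)
  also have "\<dots> = sqn (Suc n) + M (?r * ?r)"
    by (simp only: M_add M_smult P_orth[OF d] sqn_def)
  also have "\<dots> \<ge> sqn (Suc n)" using M_mono[of 0 "?r * ?r"] by simp
  finally have "sqn (Suc n) \<le> M (([:0, 1:] * P n) * ([:0, 1:] * P n))" .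
  also have "\<dots> \<le> sqn n" unfolding sqn_def
  proof (rule M_mono)
    fix t :: real assume "t \<in> {-1..1}"
    hence "t\<^sup>2 \<le> 1" by (simp add: abs_le_iff abs_square_le_1)
    then have "t\<^sup>2 * (poly (P n) t * poly (P n) t) \<le> 1 * (poly (P n) t * poly (P n) t)"
      by (intro mult_right_mono) auto
    then show "poly (([:0, 1:] * P n) * ([:0, 1:] * P n)) t \<le> poly (P n * P n) t"
      by (simp add: power2_eq_square mult_ac)
  qed
  finally show ?thesis by (simp add: rc_def field_simps)
qed

end

section \<open>Quasi-orthogonal polynomials\<close>

abbreviation cpoly :: "real poly \<Rightarrow> complex poly" where
  "cpoly \<equiv> map_poly complex_of_real"

lemma cpoly_add: "cpoly (p + q) = cpoly p + cpoly q"
  by (rule poly_eqI) (simp add: coeff_map_poly)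

lemma cpoly_smult: "cpoly (Polynomial.smult a p) = Polynomial.smult (of_real a) (cpoly p)"
  by (rule poly_eqI) (simp add: coeff_map_poly)

lemma cpoly_mult: "cpoly (p * q) = cpoly p * cpoly q"
  by (induction p) (simp_all add: cpoly_add cpoly_smult map_poly_pCons)

lemma cpoly_pderiv: "cpoly (pderiv p) = pderiv (cpoly p)"
  by (rule poly_eqI) (simp add: coeff_map_poly coeff_pderiv)

lemma poly_cpoly_of_real: "poly (cpoly p) (of_real x) = of_real (poly p x)"
  by (induction p) (simp_all add: map_poly_pCons)

context measure_on_unit_interval
begin

text \<open>The combinations \<open>P (n + 1) - \<theta> P n\<close> are orthogonal to all degrees below \<open>n\<close>. The value of \<open>\<theta>\<close>
  that matters later is the one for which \<open>0\<close> is a root, but everything up to the bounds on the roots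
  holds for each \<open>\<theta>\<close>.\<close>

definition quasi :: "real \<Rightarrow> nat \<Rightarrow> real poly" where
  "quasi \<theta> n = P (Suc n) - Polynomial.smult \<theta> (P n)"

lemma quasi_coeffs:
  fixes \<theta> :: real
  shows "coeff (quasi \<theta> n) (Suc n) = 1" "deg_less (Suc (Suc n)) (quasi \<theta> n)"
  by (auto simp: quasi_def deg_less_def coeff_eq_0)

lemma degree_quasi [simp]: "degree (quasi \<theta> n) = Suc n"
  using quasi_coeffs[where \<theta> = \<theta> and n = n]
  by (intro antisym le_degree degree_le) (auto simp: deg_less_def Suc_le_eq)

lemma quasi_nonzero [simp]: "quasi \<theta> n \<noteq> 0"
  using degree_quasi[of \<theta> n] by (metis degree_0 nat.distinct(1))

lemma quasi_orth: "deg_less n q \<Longrightarrow> M (quasi \<theta> n * q) = 0"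
  using P_orth[of n q] P_orth[of "Suc n" q] deg_less_mono[of n q "Suc n"]
  by (simp add: quasi_def left_diff_distrib M_diff M_smult)

text \<open>If \<open>d q\<close> is orthogonal to \<open>q\<close>, then \<open>d q\<^sup>2\<close> integrates to \<open>0\<close>, which is impossible for \<open>d \<ge> 0\<close>. This
  one argument excludes double roots, nonreal roots and a second root in a gap of the support.\<close>

lemma quasi_no_nonneg_quadratic_factor:
  assumes "quasi \<theta> n = d * q" "degree d = 2" "AE t in \<sigma>. 0 \<le> poly d t"
  shows False
proof -
  have nz: "d \<noteq> 0" "q \<noteq> 0" using assms(1) quasi_nonzero[of \<theta> n] by auto
  have "Suc n = 2 + degree q"
    using arg_cong[OF assms(1), of degree] nz assms(2) by (simp add: degree_mult_eq)
  hence "deg_less n q" by (auto simp: deg_less_iff)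
  from quasi_orth[OF this, of \<theta>] have "M (d * q * q) = 0" by (simp add: assms(1))
  moreover have "AE t in \<sigma>. 0 \<le> poly (d * q * q) t"
    using assms(3) by eventually_elim (simp add: mult.assoc)
  ultimately have "d * q * q = 0" by (intro poly_AE_nonneg_integral_zero)
  with nz show False by auto
qed

lemma quasi_no_double_root:
  assumes "poly (quasi \<theta> n) x = 0" "poly (pderiv (quasi \<theta> n)) x = 0"
  shows False
proof -
  obtain q where q: "quasi \<theta> n = [:-x, 1:] * q" using assms(1) by (auto simp: poly_eq_0_iff_dvd)
  have "poly q x = 0" using assms(2) unfolding q pderiv_mult by (simp add: pderiv_pCons)
  then obtain r where r: "q = [:-x, 1:] * r" by (auto simp: poly_eq_0_iff_dvd)
  have "quasi \<theta> n = ([:-x, 1:] * [:-x, 1:]) * r" unfolding q r by (simp only: mult.assoc)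
  moreover have "degree ([:-x, 1:] * [:-x, 1:]) = 2" by (subst degree_mult_eq) auto
  moreover have "AE t in \<sigma>. 0 \<le> poly ([:-x, 1:] * [:-x, 1:]) t"
    unfolding poly_mult by (rule AE_I2) (rule zero_le_square)
  ultimately show False by (rule quasi_no_nonneg_quadratic_factor)
qed

lemma quasi_roots_real:
  assumes "poly (cpoly (quasi \<theta> n)) z = 0"
  shows "Im z = 0"
proof (rule ccontr)
  assume im: "Im z \<noteq> 0"
  define d where "d = [:(cmod z)\<^sup>2, - 2 * Re z, 1:]"
  define q where "q = quasi \<theta> n div d"
  define r where "r = quasi \<theta> n mod d"
  have qr: "quasi \<theta> n = d * q + r" by (simp add: q_def r_def)
  have dd: "degree d = 2" by (simp add: d_def)
  have "d \<noteq> 0" using dd by auto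
  hence "r = 0 \<or> degree r < 2" using degree_mod_less[of d "quasi \<theta> n"] dd by (simp add: r_def)
  hence "degree r \<le> 1" by auto
  then obtain a b where ab: "r = [:a, b:]"
    by (metis degree_eq_zeroE degree_pCons_eq_if le_0_eq not_one_le_zero One_nat_def Suc_le_mono pCons_0_0 pCons_cases)
  have zz: "poly (cpoly d) z = 0"
    by (simp add: d_def map_poly_pCons complex_eq_iff cmod_def power2_eq_square algebra_simps)
       (simp add: cmod_power2 power2_eq_square)?
  have hom: "poly (cpoly (d * q + r)) z =
      poly (cpoly d) z * poly (cpoly q) z
      + poly (cpoly r) z"
    by (simp add: cpoly_add cpoly_mult)
  have "poly (cpoly r) z = 0"
    using assms hom zz by (simp flip: qr)
  hence "complex_of_real a + z * complex_of_real b = 0" by (simp add: ab map_poly_pCons)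
  hence "b * Im z = 0" "a + b * Re z = 0" by (auto simp: complex_eq_iff mult.commute)
  with im have "b = 0" "a = 0" by auto
  hence "quasi \<theta> n = d * q" by (simp add: qr ab)
  moreover have "AE t in \<sigma>. 0 \<le> poly d t"
  proof (rule AE_I2)
    fix t
    have "poly d t = (t - Re z)\<^sup>2 + (Im z)\<^sup>2"
      unfolding d_def by (simp add: cmod_power2) (simp add: algebra_simps power2_eq_square)
    thus "0 \<le> poly d t" by simp
  qed
  ultimately show False using quasi_no_nonneg_quadratic_factor dd by blast
qed

definition nodes :: "real \<Rightarrow> nat \<Rightarrow> real set" where
  "nodes \<theta> n = {x. poly (quasi \<theta> n) x = 0}"

lemma finite_nodes [simp]: "finite (nodes \<theta> n)"
  unfolding nodes_def by (rule poly_roots_finite) simp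

text \<open>A polynomial without multiple roots splits into distinct linear factors over the complex
  numbers; here all roots are real.\<close>

lemma
  shows poly_quasi_complex: "poly (cpoly (quasi \<theta> n)) w = (\<Prod>x\<in>nodes \<theta> n. w - complex_of_real x)"
    and card_nodes: "card (nodes \<theta> n) = Suc n"
proof -
  define p where "p = cpoly (quasi \<theta> n)"
  have deg: "degree p = Suc n" unfolding p_def by (subst degree_map_poly) auto
  have lead: "lead_coeff p = 1" unfolding deg by (simp add: p_def coeff_map_poly quasi_coeffs)
  have poly_real: "poly p (complex_of_real x) = complex_of_real (poly (quasi \<theta> n) x)" for x
    by (simp add: p_def poly_cpoly_of_real)
  have roots: "{z. poly p z = 0} = complex_of_real ` nodes \<theta> n"
  proof safe
    fix z assume z: "poly p z = 0"
    hence "Im z = 0" unfolding p_def by (rule quasi_roots_real)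
    hence "z = complex_of_real (Re z)" by (simp add: complex_eq_iff)
    with z poly_real[of "Re z"] show "z \<in> complex_of_real ` nodes \<theta> n"
      by (auto simp: nodes_def intro!: image_eqI[of _ _ "Re z"])
  qed (simp add: poly_real nodes_def)
  have "rsquarefree p"
    unfolding rsquarefree_roots
  proof safe
    fix z assume z: "poly p z = 0" "poly (pderiv p) z = 0"
    then obtain x where x: "z = complex_of_real x" "x \<in> nodes \<theta> n" using roots by auto
    have "poly (pderiv (quasi \<theta> n)) x = 0"
      using z(2) by (simp add: x p_def poly_cpoly_of_real flip: cpoly_pderiv)
    with x(2) show False using quasi_no_double_root by (auto simp: nodes_def)
  qed
  hence "Polynomial.smult (lead_coeff p) (\<Prod>z|poly p z = 0. [:-z, 1:]) = p"
    by (rule complex_poly_decompose_rsquarefree)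
  hence p: "p = (\<Prod>x\<in>nodes \<theta> n. [:- complex_of_real x, 1:])"
    unfolding roots lead by (simp add: prod.reindex inj_on_def)
  show "poly (cpoly (quasi \<theta> n)) w = (\<Prod>x\<in>nodes \<theta> n. w - complex_of_real x)"
    unfolding p_def[symmetric] by (subst p) (simp add: poly_prod)
  have "degree p = (\<Sum>x\<in>nodes \<theta> n. 1)" by (subst p, subst degree_prod_eq_sum_degree) auto
  thus "card (nodes \<theta> n) = Suc n" using deg by simp
qed

text \<open>Gauss quadrature at the roots of a quasi-orthogonal polynomial: division by \<open>quasi \<theta> n\<close>
  reduces the exactness to Lagrange interpolation, and the weights are the integrals of the squared
  Lagrange polynomials.\<close>

lemma quasi_quadrature:
  obtains w where "\<And>x. x \<in> nodes \<theta> n \<Longrightarrow> w x > 0"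
    "\<And>f. deg_less (Suc (2 * n)) f \<Longrightarrow> M f = (\<Sum>x\<in>nodes \<theta> n. w x * poly f x)"
proof -
  let ?X = "nodes \<theta> n"
  define lag where "lag x = Polynomial.smult (1 / (\<Prod>y\<in>?X-{x}. x - y)) (\<Prod>y\<in>?X-{x}. [:-y, 1:])" for x
  have lag_poly: "poly (lag x) t = (\<Prod>y\<in>?X-{x}. t - y) / (\<Prod>y\<in>?X-{x}. x - y)" for x t
    by (simp add: lag_def poly_prod)
  have lag1: "poly (lag x) x = 1" if "x \<in> ?X" for x
    by (simp add: lag_poly)
  have lag0: "poly (lag x) y = 0" if "y \<in> ?X" "y \<noteq> x" for x y
    using that by (simp add: lag_poly)
  have lagdeg: "degree (lag x) \<le> n" if "x \<in> ?X" for x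
  proof -
    have "degree (lag x) \<le> degree (\<Prod>y\<in>?X-{x}. [:-y, 1:])" unfolding lag_def by (rule degree_smult_le)
    also have "\<dots> = (\<Sum>y\<in>?X-{x}. 1)" by (subst degree_prod_eq_sum_degree) auto
    finally show ?thesis using that by (simp add: card_nodes)
  qed
  define w where "w x = M (lag x)" for x
  have exact: "M f = (\<Sum>x\<in>?X. w x * poly f x)" if f: "deg_less (Suc (2 * n)) f" for f
  proof -
    define q where "q = f div quasi \<theta> n"
    define r where "r = f mod quasi \<theta> n"
    have fqr: "f = quasi \<theta> n * q + r" by (simp add: q_def r_def)
    have rdeg: "degree r \<le> n"
      using degree_mod_less[of "quasi \<theta> n" f] by (auto simp: r_def)
    have "deg_less n q"
    proof (cases "q = 0")
      case False
      have dq: "degree (quasi \<theta> n * q) = Suc n + degree q" using False by (simp add: degree_mult_eq)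
      hence "degree f = Suc n + degree q"
        using degree_add_eq_left[of r "quasi \<theta> n * q"] rdeg by (simp add: fqr)
      with f show ?thesis by (auto simp: deg_less_iff)
    qed (simp add: deg_less_iff)
    hence "M f = M r" by (subst fqr) (simp add: M_add quasi_orth)
    also have "r = (\<Sum>x\<in>?X. Polynomial.smult (poly r x) (lag x))" (is "_ = ?s")
    proof (rule poly_eqI_degree[of ?X])
      show "poly r x = poly ?s x" if "x \<in> ?X" for x
      proof -
        have "poly ?s x = (\<Sum>y\<in>?X. if y = x then poly r x else 0)"
          unfolding poly_sum by (intro sum.cong) (use that lag1 lag0 in auto)
        thus ?thesis using that by simp
      qed
      show "card ?X > degree r" using rdeg by (simp add: card_nodes)
      have "degree ?s \<le> n"
        by (intro degree_sum_le) (use lagdeg in \<open>auto intro: order.trans[OF degree_smult_le]\<close>)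
      thus "card ?X > degree ?s" by (simp add: card_nodes)
    qed
    also have "M ?s = (\<Sum>x\<in>?X. w x * poly r x)"
      by (simp add: M_sum M_smult w_def mult.commute)
    also have "\<dots> = (\<Sum>x\<in>?X. w x * poly f x)"
      by (intro sum.cong) (auto simp: fqr nodes_def)
    finally show ?thesis .
  qed
  have pos: "w x > 0" if x: "x \<in> ?X" for x
  proof -
    have nz: "lag x \<noteq> 0" using lag1[OF x] by auto
    have "degree (lag x * lag x) \<le> 2 * n"
      using degree_mult_le[of "lag x" "lag x"] lagdeg[OF x] by linarith
    hence "M (lag x * lag x) = (\<Sum>y\<in>?X. w y * poly (lag x * lag x) y)"
      by (intro exact) (auto simp: deg_less_iff)
    also have "\<dots> = (\<Sum>y\<in>?X. if y = x then w x else 0)"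
      by (intro sum.cong) (use x lag1 lag0 in auto)
    also have "\<dots> = w x" using x by simp
    finally show ?thesis using M_square_pos[OF nz] by simp
  qed
  show ?thesis using that[of w] pos exact by blast
qed

text \<open>By \<open>\<bar>b\<bar> \<le> 1\<close> and \<open>0 < c \<le> 1\<close>, the continued fraction \<open>r = x - b - c / r'\<close> of the quotients
  stays within 2 of \<open>x\<close> as soon as \<open>\<bar>x\<bar> \<ge> 3\<close>, since then \<open>\<bar>r\<bar> \<ge> 1\<close> is inherited.\<close>

lemma P_ratio_bound:
  assumes "\<bar>x\<bar> \<ge> 3"
  shows "poly (P n) x \<noteq> 0 \<and> \<bar>poly (P (Suc n)) x / poly (P n) x - x\<bar> \<le> 2"
proof (induction n)
  case 0
  have "poly (P (Suc 0)) x - x = - rb 0" using arg_cong[OF rec_P0, of "\<lambda>p. poly p x"] by simp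
  then show ?case using rb_bound[of 0] by simp
next
  case (Suc n)
  let ?r = "poly (P (Suc n)) x / poly (P n) x"
  have r1: "\<bar>?r\<bar> \<ge> 1" using Suc assms by linarith
  hence nz: "poly (P (Suc n)) x \<noteq> 0" by auto
  have "poly (P (Suc (Suc n))) x / poly (P (Suc n)) x - x = - rb (Suc n) - rc n / ?r"
    using arg_cong[OF P_Suc_Suc[of n], of "\<lambda>p. poly p x"] nz Suc by (simp add: field_simps)
  moreover have "\<bar>rc n / ?r\<bar> \<le> 1"
    using r1 rc_le_1[of n] rc_pos[of n] unfolding abs_divide
    by (subst divide_le_eq_1) linarith
  ultimately show ?case using nz rb_bound[of "Suc n"] by linarith
qed

text \<open>A root \<open>x\<close> satisfies \<open>P (n + 1) x / P n x = \<theta>\<close>, and this quotient is close to \<open>x\<close> for large \<open>x\<close>.\<close>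

lemma nodes_bounded_by_parameter:
  assumes "x \<in> nodes \<theta> n" shows "\<bar>x\<bar> \<le> max 3 (\<bar>\<theta>\<bar> + 2)"
proof (rule ccontr)
  assume "\<not> ?thesis"
  hence x: "\<bar>x\<bar> \<ge> 3" "\<bar>x\<bar> > \<bar>\<theta>\<bar> + 2" by auto
  from P_ratio_bound[OF x(1), of n] assms have "poly (P (Suc n)) x / poly (P n) x = \<theta>"
    by (auto simp: nodes_def quasi_def field_simps)
  with P_ratio_bound[OF x(1), of n] x(2) show False by linarith
qed

text \<open>If \<open>\<theta>\<close> is large, the quotient \<open>P (n + 1) x / P n x\<close>, which follows \<open>x\<close> up to an error of 2, takes the
  value \<open>\<theta>\<close> at some large \<open>x\<close> by the intermediate value theorem, and that \<open>x\<close> is a node.\<close>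

lemma parameter_bounded_by_nodes:
  assumes "R \<ge> 3" "\<And>x. x \<in> nodes \<theta> n \<Longrightarrow> \<bar>x\<bar> < R"
  shows "\<bar>\<theta>\<bar> \<le> R + 2"
proof (rule ccontr)
  assume neg: "\<not> ?thesis"
  define r where "r x = poly (P (Suc n)) x / poly (P n) x" for x
  have cont: "continuous_on {x. \<bar>x\<bar> \<ge> 3} r"
    unfolding r_def using P_ratio_bound by (intro continuous_intros) auto
  have r: "\<bar>r x - x\<bar> \<le> 2" if "\<bar>x\<bar> \<ge> 3" for x using P_ratio_bound[OF that] by (simp add: r_def)
  have no: "r x \<noteq> \<theta>" if "\<bar>x\<bar> \<ge> R" for x
  proof
    assume "r x = \<theta>"
    hence "x \<in> nodes \<theta> n" using P_ratio_bound[of x n] that assms(1)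
      by (auto simp: r_def nodes_def quasi_def field_simps)
    with assms(2) that show False by fastforce
  qed
  show False
  proof (cases "\<theta> > 0")
    case True
    hence t: "\<theta> > R + 2" using neg by auto
    have "\<exists>x\<ge>R. x \<le> \<theta> + 2 \<and> r x = \<theta>"
      using t assms(1) r[of R] r[of "\<theta> + 2"]
      by (intro IVT') (auto intro!: continuous_on_subset[OF cont])
    with no assms(1) show False by force
  next
    case False
    hence t: "\<theta> < - R - 2" using neg by auto
    have "\<exists>x\<ge>\<theta> - 2. x \<le> - R \<and> r x = \<theta>"
      using t assms(1) r[of "- R"] r[of "\<theta> - 2"]
      by (intro IVT') (auto intro!: continuous_on_subset[OF cont])
    with no assms(1) show False by force
  qed
qed

lemma deg_less_expand:
  assumes "deg_less n q" shows "q = (\<Sum>k<n. Polynomial.smult (coeff q k) ([:0, 1:] ^ k))"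
proof (rule poly_eqI)
  fix i
  have "coeff (\<Sum>k<n. Polynomial.smult (coeff q k) ([:0, 1:] ^ k)) i = (\<Sum>k<n. if k = i then coeff q i else 0)"
    unfolding coeff_sum
    by (intro sum.cong) (auto simp: monom_altdef[symmetric, of 1, simplified])
  thus "coeff q i = coeff (\<Sum>k<n. Polynomial.smult (coeff q k) ([:0, 1:] ^ k)) i"
    using assms by (simp add: deg_less_def)
qed

text \<open>Read a vector as the coefficients of a polynomial \<open>q\<close> of degree below \<open>n\<close>. It is in the kernel
  exactly if \<open>t q(t)\<close> is orthogonal to all degrees below \<open>n\<close>, that is, a multiple of \<open>P n\<close>; a nonzero
  such \<open>q\<close> exists exactly if \<open>0\<close> is a root of \<open>P n\<close>.\<close>

lemma hankel_det_shifted_moments: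
  "hankel_det (\<lambda>j. M ([:0, 1:] ^ (j + 1))) n \<noteq> 0 \<longleftrightarrow> poly (P n) 0 \<noteq> 0"
proof -
  define H where "H = Matrix.mat n n (\<lambda>(i, k). M ([:0, 1:] ^ (i + k + 1)))"
  have H: "H \<in> carrier_mat n n" by (simp add: H_def)
  define pol where "pol v = (\<Sum>k<n. Polynomial.smult (Matrix.vec_index v k) ([:0, 1:] ^ k))" for v :: "real Matrix.vec"
  have Hv: "Matrix.vec_index (H *\<^sub>v v) i = M (([:0, 1:] * pol v) * [:0, 1:] ^ i)"
    if "v \<in> carrier_vec n" "i < n" for v i
  proof -
    have "Matrix.vec_index (H *\<^sub>v v) i = (\<Sum>k<n. M ([:0, 1:] ^ (i + k + 1)) * Matrix.vec_index v k)"
      using that by (simp add: H_def scalar_prod_def lessThan_atLeast0)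
    also have "\<dots> = M (\<Sum>k<n. Polynomial.smult (Matrix.vec_index v k) ([:0, 1:] ^ (i + k + 1)))"
      by (simp only: M_sum M_smult mult.commute)
    also have "\<dots> = M (([:0, 1:] * pol v) * [:0, 1:] ^ i)"
      by (rule M_cong) (simp add: pol_def poly_sum sum_distrib_left sum_distrib_right power_add mult_ac)
    finally show ?thesis .
  qed
  have "Determinant.det H = 0 \<longleftrightarrow> poly (P n) 0 = 0"
    unfolding det_0_iff_vec_prod_zero[OF H]
  proof
    assume "poly (P n) 0 = 0"
    then obtain q where q: "P n = [:0, 1:] * q" by (auto simp: poly_eq_0_iff_dvd)
    hence qnz: "q \<noteq> 0" using P_nonzero[of n] by (metis mult_zero_right)
    have "degree (P n) = Suc (degree q)" using q qnz by simp
    hence dq: "deg_less n q" by (simp add: deg_less_iff)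
    define v where "v = Matrix.vec n (coeff q)"
    have v: "v \<in> carrier_vec n" by (simp add: v_def)
    have "pol v = q" using deg_less_expand[OF dq, symmetric] by (simp add: pol_def v_def)
    hence "H *\<^sub>v v = 0\<^sub>v n"
    proof (intro eq_vecI)
      fix i assume "i < dim_vec (0\<^sub>v n :: real Matrix.vec)"
      hence i: "i < n" by simp
      have "deg_less n ([:0, 1:] ^ i)" using i by (auto simp: deg_less_iff degree_power_eq)
      from P_orth[OF this] show "Matrix.vec_index (H *\<^sub>v v) i = Matrix.vec_index (0\<^sub>v n) i"
        unfolding Hv[OF v i] \<open>pol v = q\<close> by (simp only: q[symmetric] index_zero_vec(1)[OF i])
    qed (simp add: H_def)
    moreover have "v \<noteq> 0\<^sub>v n"
    proof
      assume "v = 0\<^sub>v n"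
      hence "coeff q k = 0" if "k < n" for k
        using that by (metis v_def index_vec index_zero_vec(1))
      with dq have "q = 0" by (intro poly_eqI) (metis deg_less_def coeff_0 not_less)
      with qnz show False by simp
    qed
    ultimately show "\<exists>v. v \<in> carrier_vec n \<and> v \<noteq> 0\<^sub>v n \<and> H *\<^sub>v v = 0\<^sub>v n" using v by blast
  next
    assume "\<exists>v. v \<in> carrier_vec n \<and> v \<noteq> 0\<^sub>v n \<and> H *\<^sub>v v = 0\<^sub>v n"
    then obtain v where v: "v \<in> carrier_vec n" "v \<noteq> 0\<^sub>v n" "H *\<^sub>v v = 0\<^sub>v n" by blast
    let ?q = "[:0, 1:] * pol v"
    have orth: "M (?q * g) = 0" if "deg_less n g" for g
    proof -
      have "M (?q * g) = M (\<Sum>i<n. Polynomial.smult (coeff g i) (?q * [:0, 1:] ^ i))"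
        by (subst deg_less_expand[OF that]) (simp add: sum_distrib_left mult_ac)
      also have "\<dots> = (\<Sum>i<n. coeff g i * M (?q * [:0, 1:] ^ i))" by (simp only: M_sum M_smult)
      also have "\<dots> = (\<Sum>i<n. coeff g i * Matrix.vec_index (H *\<^sub>v v) i)"
        by (intro sum.cong refl) (simp only: Hv[OF v(1)] lessThan_iff)
      finally show ?thesis by (simp add: v(3))
    qed
    have cq: "coeff (pol v) k = (if k < n then Matrix.vec_index v k else 0)" for k
    proof -
      have "coeff (pol v) k = (\<Sum>i<n. if i = k then Matrix.vec_index v i else 0)"
        unfolding pol_def coeff_sum
        by (intro sum.cong) (auto simp: monom_altdef[symmetric, of 1, simplified])
      thus ?thesis by simp
    qed
    have "deg_less (Suc n) ?q" by (rule deg_less_X_mult) (simp add: deg_less_def cq)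
    hence d: "deg_less n (?q - Polynomial.smult (coeff ?q n) (P n))" (is "deg_less n ?g")
      by (rule deg_less_reduce)
    have "M (?g * ?g) = M (?q * ?g) - coeff ?q n * M (P n * ?g)"
      by (simp only: left_diff_distrib M_diff mult_smult_left M_smult)
    hence "M (?g * ?g) = 0" using orth[OF d] P_orth[OF d] by simp
    hence g0: "?g = 0" using M_square_pos[of ?g] by fastforce
    have "pol v \<noteq> 0"
    proof
      assume "pol v = 0"
      hence "v = 0\<^sub>v n" using cq v(1) by (intro eq_vecI) (auto, metis coeff_0)
      with v(2) show False by simp
    qed
    hence "?q \<noteq> 0" by simp
    hence "coeff ?q n \<noteq> 0" using g0 by auto
    moreover have "poly ?g 0 = 0" using g0 by (metis poly_0)
    ultimately show "poly (P n) 0 = 0" by simp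
  qed
  thus ?thesis by (simp add: hankel_det_def H_def)
qed

end

section \<open>Block matrices\<close>

text \<open>With three diagonals each entry of the image is a sum of three terms, so the Cauchy-Schwarz
  inequality costs a factor 3, and each entry of \<open>x\<close> is used three times.\<close>

lemma bounded_in_ell2_band:
  assumes band: "\<And>i k. k > Suc i \<or> i > Suc k \<Longrightarrow> A i k = 0" and bd: "\<And>i k. \<bar>A i k\<bar> \<le> C"
  shows "bounded_in_ell2 A"
  unfolding bounded_in_ell2_def
proof (intro exI[of _ "3 * C"] allI impI conjI)
  fix x assume x: "in_ell2 x"
  have C0: "C \<ge> 0" using bd[of 0 0] by linarith
  \<comment> \<open>the shifted sequence, so that the neighbours of an index are \<open>p i\<close>, \<open>x i\<close> and \<open>x (Suc i)\<close> also at \<open>0\<close>\<close>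
  define p where "p i = (if i = 0 then 0 else x (i - 1))" for i
  have fin: "complex_of_real (A i k) * x k = 0" if "k \<notin> {i - 1..i + 1}" for i k
    using that band[of i k] by (cases "k > Suc i") auto
  show "summable (\<lambda>k. complex_of_real (A i k) * x k)" for i
    by (rule summable_finite[of "{i - 1..i + 1}"]) (use fin in auto)
  have app: "inf_matrix_apply A x i = (\<Sum>k\<in>{i - 1..i + 1}. complex_of_real (A i k) * x k)" for i
    unfolding inf_matrix_apply_def by (rule suminf_finite) (use fin in auto)
  have bound: "cmod (inf_matrix_apply A x i) \<le> C * (cmod (p i) + cmod (x i) + cmod (x (Suc i)))" for i
  proof -
    have "cmod (inf_matrix_apply A x i) \<le> (\<Sum>k\<in>{i - 1..i + 1}. cmod (complex_of_real (A i k) * x k))"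
      unfolding app by (rule norm_sum)
    also have "\<dots> \<le> (\<Sum>k\<in>{i - 1..i + 1}. C * cmod (x k))"
      by (intro sum_mono) (auto simp: norm_mult intro!: mult_right_mono bd)
    also have "\<dots> = C * (cmod (p i) + cmod (x i) + cmod (x (Suc i)))"
    proof (cases i)
      case 0
      have "{i - 1..i + 1} = {0, 1}" using 0 by auto
      then show ?thesis using 0 by (simp add: p_def algebra_simps)
    next
      case (Suc m)
      have "{i - 1..i + 1} = {m, Suc m, Suc (Suc m)}" using Suc by auto
      then show ?thesis using Suc by (simp add: p_def algebra_simps)
    qed
    finally show ?thesis .
  qed
  have sq: "(cmod (inf_matrix_apply A x i))\<^sup>2 \<le>
      3 * C\<^sup>2 * ((cmod (p i))\<^sup>2 + (cmod (x i))\<^sup>2 + (cmod (x (Suc i)))\<^sup>2)" for i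
  proof -
    have "(cmod (inf_matrix_apply A x i))\<^sup>2 \<le> (C * (cmod (p i) + cmod (x i) + cmod (x (Suc i))))\<^sup>2"
      using bound[of i] by (intro power_mono) auto
    also have "\<dots> = C\<^sup>2 * (cmod (p i) + cmod (x i) + cmod (x (Suc i)))\<^sup>2" by (simp add: power_mult_distrib)
    also have "\<dots> \<le> C\<^sup>2 * (3 * ((cmod (p i))\<^sup>2 + (cmod (x i))\<^sup>2 + (cmod (x (Suc i)))\<^sup>2))"
    proof (rule mult_left_mono)
      show "(a + b + c)\<^sup>2 \<le> 3 * (a\<^sup>2 + b\<^sup>2 + c\<^sup>2)" for a b c :: real
        using sum_squares_ge_zero[of "a - b" "b - c"] zero_le_square[of "a - c"]
        by (simp add: power2_eq_square algebra_simps)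
    qed simp
    finally show ?thesis by (simp only: mult_ac)
  qed
  have s0: "summable (\<lambda>i. (cmod (x i))\<^sup>2)" using x by (simp add: in_ell2_def)
  have s1: "summable (\<lambda>i. (cmod (x (Suc i)))\<^sup>2)" using s0 by (subst summable_Suc_iff)
  have s2: "summable (\<lambda>i. (cmod (p i))\<^sup>2)"
    by (subst summable_Suc_iff[symmetric]) (use s0 in \<open>simp add: p_def\<close>)
  have t1: "(\<Sum>i. (cmod (x (Suc i)))\<^sup>2) \<le> (\<Sum>i. (cmod (x i))\<^sup>2)"
    using suminf_split_head[OF s0] by simp
  have t2: "(\<Sum>i. (cmod (p i))\<^sup>2) = (\<Sum>i. (cmod (x i))\<^sup>2)"
    using suminf_split_head[OF s2] by (simp add: p_def)
  have s3: "summable (\<lambda>i. 3 * C\<^sup>2 * ((cmod (p i))\<^sup>2 + (cmod (x i))\<^sup>2 + (cmod (x (Suc i)))\<^sup>2))"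
    by (intro summable_mult summable_add s0 s1 s2)
  show ell: "in_ell2 (inf_matrix_apply A x)"
    unfolding in_ell2_def by (rule summable_comparison_test'[OF s3, of 0]) (use sq in auto)
  have "(\<Sum>i. (cmod (inf_matrix_apply A x i))\<^sup>2) \<le>
      (\<Sum>i. 3 * C\<^sup>2 * ((cmod (p i))\<^sup>2 + (cmod (x i))\<^sup>2 + (cmod (x (Suc i)))\<^sup>2))"
    by (intro suminf_le sq s3) (use ell in \<open>simp add: in_ell2_def\<close>)
  also have "\<dots> = 3 * C\<^sup>2 * ((\<Sum>i. (cmod (p i))\<^sup>2) + (\<Sum>i. (cmod (x i))\<^sup>2) + (\<Sum>i. (cmod (x (Suc i)))\<^sup>2))"
    using s0 s1 s2 by (simp add: suminf_mult suminf_add summable_add)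
  also have "\<dots> \<le> 3 * C\<^sup>2 * (3 * (\<Sum>i. (cmod (x i))\<^sup>2))"
    by (rule mult_left_mono) (use t1 t2 in auto)
  also have "\<dots> = (3 * C)\<^sup>2 * (\<Sum>i. (cmod (x i))\<^sup>2)" by (simp add: power2_eq_square)
  finally show "ell2_norm (inf_matrix_apply A x) \<le> 3 * C * ell2_norm x"
    unfolding ell2_norm_def using C0
    by (metis real_sqrt_le_iff real_sqrt_mult real_sqrt_pow2_iff real_sqrt_power real_sqrt_unique
        mult_nonneg_nonneg zero_le_numeral)
qed

text \<open>Apply the operator to the unit vectors.\<close>

lemma bounded_in_ell2_entry_bound:
  assumes "bounded_in_ell2 A" obtains C where "\<And>i k. \<bar>A i k\<bar> \<le> C"
proof -
  from assms obtain C where C: "\<And>x. in_ell2 x \<Longrightarrow>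
      in_ell2 (inf_matrix_apply A x) \<and> ell2_norm (inf_matrix_apply A x) \<le> C * ell2_norm x"
    by (auto simp: bounded_in_ell2_def)
  have "\<bar>A i k\<bar> \<le> C" for i k
  proof -
    define e where "e n = (if n = k then 1 else 0 :: complex)" for n
    have s: "(\<lambda>n. (cmod (e n))\<^sup>2) sums 1"
      using sums_single[of k "\<lambda>_. 1 :: real"]
      by (rule back_subst[of "\<lambda>f. f sums 1"]) (auto simp: e_def)
    have e: "in_ell2 e" "ell2_norm e = 1"
      using s by (auto simp: in_ell2_def ell2_norm_def sums_iff)
    have app: "inf_matrix_apply A e n = complex_of_real (A n k)" for n
      unfolding inf_matrix_apply_def by (subst suminf_finite[of "{k}"]) (auto simp: e_def)
    have sm: "summable (\<lambda>n. (A n k)\<^sup>2)" "sqrt (\<Sum>n. (A n k)\<^sup>2) \<le> C"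
      using C[OF e(1)] by (auto simp: in_ell2_def ell2_norm_def app e(2)[unfolded ell2_norm_def])
    have "(A i k)\<^sup>2 \<le> (\<Sum>n. (A n k)\<^sup>2)" using sum_le_suminf[OF sm(1), of "{i}"] by simp
    hence "sqrt ((A i k)\<^sup>2) \<le> sqrt (\<Sum>n. (A n k)\<^sup>2)" by (rule real_sqrt_le_mono)
    with sm(2) show ?thesis by simp
  qed
  with that show ?thesis by blast
qed

locale blocks_1_2 =
  fixes ns :: "nat \<Rightarrow> nat"
  assumes ns_0 [simp]: "ns 0 = 0"
    and ns_Suc: "ns (Suc j) = Suc (ns j) \<or> ns (Suc j) = Suc (Suc (ns j))"
begin

abbreviation sz :: "nat \<Rightarrow> nat" where "sz \<equiv> block_size ns"

lemma ns_Suc_eq: "ns (Suc j) = ns j + sz j"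
  using ns_Suc[of j] by (auto simp: block_size_def)

lemma sz_cases: "sz j = 1 \<or> sz j = 2"
  using ns_Suc[of j] by (auto simp: block_size_def)

lemma sz_pos: "0 < sz j"
  using sz_cases[of j] by auto

lemma ns_strict_mono: "strict_mono ns"
  unfolding strict_mono_Suc_iff using ns_Suc by (metis lessI less_SucI)

lemma block_of_eq: "r < sz j \<Longrightarrow> block_of ns (ns j + r) = j"
  unfolding block_of_def
proof (rule Greatest_equality)
  fix y assume r: "r < sz j" and y: "ns y \<le> ns j + r"
  show "y \<le> j"
  proof (rule ccontr)
    assume "\<not> y \<le> j"
    hence "ns (Suc j) \<le> ns y" using ns_strict_mono by (simp add: strict_mono_less_eq Suc_le_eq)
    with y r show False by (simp add: ns_Suc_eq)
  qed
qed simp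

lemma index_cases:
  obtains j r where "i = ns j + r" "r < sz j"
proof -
  have "\<exists>j r. i = ns j + r \<and> r < sz j"
  proof (induction i)
    case 0
    show ?case using sz_pos[of 0] by (intro exI[of _ 0]) auto
  next
    case (Suc i)
    then obtain j r where jr: "i = ns j + r" "r < sz j" by blast
    show ?case
    proof (cases "Suc r < sz j")
      case True
      thus ?thesis using jr by (intro exI[of _ j] exI[of _ "Suc r"]) auto
    next
      case False
      thus ?thesis using jr sz_pos[of "Suc j"] by (intro exI[of _ "Suc j"] exI[of _ 0]) (auto simp: ns_Suc_eq)
    qed
  qed
  thus ?thesis using that by blast
qed

lemma block_matrix_at:
  "r < sz j \<Longrightarrow> q < sz m \<Longrightarrow> block_matrix ns B (ns j + r) (ns m + q) = B j m r q"
  by (simp add: block_matrix_def block_of_eq)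

lemma block_matrix_at0:
  "r < sz j \<Longrightarrow> block_matrix ns B (ns j + r) (ns m) = B j m r 0"
  "q < sz m \<Longrightarrow> block_matrix ns B (ns j) (ns m + q) = B j m 0 q"
  "block_matrix ns B (ns j) (ns m) = B j m 0 0"
  using block_matrix_at[of r j 0 m B] block_matrix_at[of 0 j q m B] block_matrix_at[of 0 j 0 m B]
    sz_pos[of m] sz_pos[of j] by auto

lemma ns_eq_iff [simp]: "ns i = ns j \<longleftrightarrow> i = j"
  using ns_strict_mono by (rule strict_mono_eq)

text \<open>A row of \<open>L\<close> has a second nonzero entry only if it is the first row of its block; likewise a
  column, below, only if it is the first column.\<close>

lemma L_mult_entry:
  assumes r: "r < sz j"
  shows "inf_matrix_mult (L_matrix ns l) B (ns j + r) k =
    B (ns j + r) k + (if r = 0 \<and> 0 < j then l j * B (ns (j - 1)) k else 0)"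
proof -
  let ?S = "insert (ns j + r) (if r = 0 \<and> 0 < j then {ns (j - 1)} else {})"
  have L: "L_matrix ns l (ns j + r) (ns m + q) = (if m = j then if r = q then 1 else 0
      else if j = Suc m then if r = 0 \<and> q = 0 then l j else 0 else 0)" if "q < sz m" for m q
    unfolding L_matrix_def using r that by (simp add: block_matrix_at)
  have "inf_matrix_mult (L_matrix ns l) B (ns j + r) k = (\<Sum>x\<in>?S. L_matrix ns l (ns j + r) x * B x k)"
    unfolding inf_matrix_mult_def
  proof (rule suminf_finite)
    fix x assume x: "x \<notin> ?S"
    obtain m q where mq: "x = ns m + q" "q < sz m" by (rule index_cases)
    have "L_matrix ns l (ns j + r) x = 0" unfolding mq(1) L[OF mq(2)] using x mq by auto
    thus "L_matrix ns l (ns j + r) x * B x k = 0" by simp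
  qed simp
  also have "\<dots> = B (ns j + r) k + (if r = 0 \<and> 0 < j then l j * B (ns (j - 1)) k else 0)"
  proof (cases "r = 0 \<and> 0 < j")
    case True
    then obtain i where i: "j = Suc i" "r = 0" by (cases j) auto
    show ?thesis using L[of 0 i] L[of r j] r sz_pos[of i] i by simp
  next
    case False
    show ?thesis using L[of r j] r False by (auto split: if_splits)
  qed
  finally show ?thesis .
qed

lemma mult_L_entry:
  assumes q: "q < sz m"
  shows "inf_matrix_mult B (L_matrix ns l) i (ns m + q) =
    B i (ns m + q) + (if q = 0 then B i (ns (Suc m)) * l (Suc m) else 0)"
proof -
  let ?S = "insert (ns m + q) (if q = 0 then {ns (Suc m)} else {})"
  have L: "L_matrix ns l (ns j + r) (ns m + q) = (if m = j then if r = q then 1 else 0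
      else if j = Suc m then if r = 0 \<and> q = 0 then l j else 0 else 0)" if "r < sz j" for j r
    unfolding L_matrix_def using q that by (simp add: block_matrix_at)
  have "inf_matrix_mult B (L_matrix ns l) i (ns m + q) = (\<Sum>x\<in>?S. B i x * L_matrix ns l x (ns m + q))"
    unfolding inf_matrix_mult_def
  proof (rule suminf_finite)
    fix x assume x: "x \<notin> ?S"
    obtain j r where jr: "x = ns j + r" "r < sz j" by (rule index_cases)
    have "L_matrix ns l x (ns m + q) = 0" unfolding jr(1) L[OF jr(2)] using x jr by auto
    thus "B i x * L_matrix ns l x (ns m + q) = 0" by simp
  qed simp
  also have "\<dots> = B i (ns m + q) + (if q = 0 then B i (ns (Suc m)) * l (Suc m) else 0)"
    using L[of 0 "Suc m"] L[of q m] q sz_pos[of "Suc m"] by (auto split: if_splits)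
  finally show ?thesis .
qed

definition U_entry :: "(nat \<Rightarrow> real) \<Rightarrow> (nat \<Rightarrow> real) \<Rightarrow> nat \<Rightarrow> nat \<Rightarrow> nat \<Rightarrow> nat \<Rightarrow> real" where
  "U_entry u0 u1 j m r q =
     (if m = j then companion_entry ns u0 u1 j r q
      else if m = Suc j then lower_left ns 1 j r q
      else 0)"

lemma U_matrix_at:
  "r < sz j \<Longrightarrow> q < sz m \<Longrightarrow> U_matrix ns u0 u1 (ns j + r) (ns m + q) = U_entry u0 u1 j m r q"
  "r < sz j \<Longrightarrow> U_matrix ns u0 u1 (ns j + r) (ns m) = U_entry u0 u1 j m r 0"
  "q < sz m \<Longrightarrow> U_matrix ns u0 u1 (ns j) (ns m + q) = U_entry u0 u1 j m 0 q"
  "U_matrix ns u0 u1 (ns j) (ns m) = U_entry u0 u1 j m 0 0"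
  by (auto simp: U_matrix_def U_entry_def block_matrix_at block_matrix_at0)

lemma LU_entry:
  assumes "r < sz j" "q < sz m"
  shows "inf_matrix_mult (L_matrix ns l) (U_matrix ns u0 u1) (ns j + r) (ns m + q) =
    U_entry u0 u1 j m r q + (if r = 0 \<and> 0 < j then l j * U_entry u0 u1 (j - 1) m 0 q else 0)"
  using assms by (simp add: L_mult_entry U_matrix_at)

lemma UL_entry:
  assumes "r < sz j" "q < sz m"
  shows "inf_matrix_mult (U_matrix ns u0 u1) (L_matrix ns l) (ns j + r) (ns m + q) =
    U_entry u0 u1 j m r q + (if q = 0 then U_entry u0 u1 j (Suc m) r 0 * l (Suc m) else 0)"
  using assms by (simp add: mult_L_entry U_matrix_at)

lemmas entry_simps = U_entry_def companion_entry_def lower_left_def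

lemma U_matrix_cong:
  assumes "\<And>j. u0 j = u0' j" "\<And>j. sz j = 2 \<Longrightarrow> u1 j = u1' j"
  shows "U_matrix ns u0 u1 = U_matrix ns u0' u1'"
proof (intro ext)
  fix i k
  obtain j r where jr: "i = ns j + r" "r < sz j" by (rule index_cases)
  obtain m q where mq: "k = ns m + q" "q < sz m" by (rule index_cases)
  show "U_matrix ns u0 u1 i k = U_matrix ns u0' u1' i k"
    using jr mq assms sz_cases[of j] by (auto simp: U_matrix_at entry_simps)
qed

text \<open>The first row of block \<open>j + 1\<close> determines \<open>l (j + 1)\<close> from \<open>u0 j\<close>, and the last row then determines
  \<open>u0 (j + 1)\<close>; here \<open>u0 j\<close> is divided by.\<close>

lemma LU_unique:
  assumes eq: "inf_matrix_mult (L_matrix ns l) (U_matrix ns u0 u1) =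
      inf_matrix_mult (L_matrix ns l') (U_matrix ns u0' u1')"
    and nz: "\<And>j. u0' j \<noteq> 0"
  shows "U_matrix ns u0 u1 = U_matrix ns u0' u1'"
proof -
  have e: "U_entry u0 u1 j m r q + (if r = 0 \<and> 0 < j then l j * U_entry u0 u1 (j - 1) m 0 q else 0) =
      U_entry u0' u1' j m r q + (if r = 0 \<and> 0 < j then l' j * U_entry u0' u1' (j - 1) m 0 q else 0)"
    if "r < sz j" "q < sz m" for j m r q
    using fun_cong[OF fun_cong[OF eq], of "ns j + r" "ns m + q"] by (simp add: LU_entry that)
  have u0: "u0 j = u0' j" for j
  proof (induction j)
    case 0
    show ?case using e[of "sz 0 - 1" 0 0 0] sz_cases[of 0] by (auto simp: entry_simps)
  next
    case (Suc j)
    have "l (Suc j) = l' (Suc j)"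
      using e[of 0 "Suc j" "sz j - 1" j] Suc nz[of j] sz_cases[of j] sz_pos[of "Suc j"]
      by (auto simp: entry_simps)
    thus ?case using e[of "sz (Suc j) - 1" "Suc j" 0 "Suc j"] sz_cases[of "Suc j"] sz_cases[of j]
      by (auto simp: entry_simps)
  qed
  have "u1 j = u1' j" if "sz j = 2" for j
    using e[of 1 j 1 j] that by (simp add: entry_simps)
  with u0 show ?thesis by (rule U_matrix_cong)
qed

text \<open>Now \<open>u0 j\<close> determines \<open>l (j + 1)\<close> by the sum \<open>u0 j + l (j + 1)\<close> in block \<open>j\<close>, and \<open>l (j + 1)\<close>
  determines \<open>u0 (j + 1)\<close> by the product below it. The recursion needs \<open>u0 0\<close> to start.\<close>

lemma UL_unique:
  assumes eq: "inf_matrix_mult (U_matrix ns u0 u1) (L_matrix ns l) =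
      inf_matrix_mult (U_matrix ns u0' u1') (L_matrix ns l')"
    and start: "u0 0 = u0' 0" and nz: "\<And>j. l' (Suc j) \<noteq> 0"
  shows "U_matrix ns u0 u1 = U_matrix ns u0' u1'"
proof -
  have e: "U_entry u0 u1 j m r q + (if q = 0 then U_entry u0 u1 j (Suc m) r 0 * l (Suc m) else 0) =
      U_entry u0' u1' j m r q + (if q = 0 then U_entry u0' u1' j (Suc m) r 0 * l' (Suc m) else 0)"
    if "r < sz j" "q < sz m" for j m r q
    using fun_cong[OF fun_cong[OF eq], of "ns j + r" "ns m + q"] by (simp add: UL_entry that)
  have u0: "u0 j = u0' j" for j
  proof (induction j)
    case (Suc j)
    have "l (Suc j) = l' (Suc j)"
      using e[of "sz j - 1" j 0 j] Suc sz_cases[of j] by (auto simp: entry_simps)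
    thus ?case using e[of "sz (Suc j) - 1" "Suc j" 0 j] nz[of j] sz_cases[of "Suc j"] sz_pos[of j]
      by (auto simp: entry_simps)
  qed (rule start)
  have "u1 j = u1' j" if "sz j = 2" for j
    using e[of 1 j 1 j] that by (simp add: entry_simps)
  with u0 show ?thesis by (rule U_matrix_cong)
qed

text \<open>Apart from constants and the \<open>u0 j\<close>, the only entries are the \<open>u1 j\<close> of the blocks of size 2.\<close>

lemma U_matrix_bounded_iff:
  assumes "\<And>j. sz j = 2 \<Longrightarrow> \<bar>u1 j\<bar> \<le> B"
  shows "bounded_in_ell2 (U_matrix ns u0 u1) \<longleftrightarrow> (\<exists>C. \<forall>j. \<bar>u0 j\<bar> \<le> C)"
proof
  assume "bounded_in_ell2 (U_matrix ns u0 u1)"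
  then obtain C where C: "\<And>i k. \<bar>U_matrix ns u0 u1 i k\<bar> \<le> C" by (rule bounded_in_ell2_entry_bound) blast
  have "\<bar>u0 j\<bar> \<le> C" for j
  proof -
    have "U_matrix ns u0 u1 (ns j + (sz j - 1)) (ns j) = u0 j"
      using sz_cases[of j] sz_pos[of j] by (subst U_matrix_at(2)) (auto simp: entry_simps)
    with C show ?thesis by metis
  qed
  thus "\<exists>C. \<forall>j. \<bar>u0 j\<bar> \<le> C" by blast
next
  assume "\<exists>C. \<forall>j. \<bar>u0 j\<bar> \<le> C"
  then obtain C where C: "\<And>j. \<bar>u0 j\<bar> \<le> C" by blast
  show "bounded_in_ell2 (U_matrix ns u0 u1)"
  proof (rule bounded_in_ell2_band)
    fix i k
    obtain j r where jr: "i = ns j + r" "r < sz j" by (rule index_cases)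
    obtain m q where mq: "k = ns m + q" "q < sz m" by (rule index_cases)
    show "\<bar>U_matrix ns u0 u1 i k\<bar> \<le> max 1 (max B C)"
      using jr mq assms[of j] C[of j] sz_cases[of j] by (auto simp: U_matrix_at entry_simps)
    show "U_matrix ns u0 u1 i k = 0" if "k > Suc i \<or> i > Suc k"
      using jr mq that sz_cases[of j] by (auto simp: U_matrix_at entry_simps ns_Suc_eq)
  qed
qed

definition tridiagonal :: "(nat \<Rightarrow> real) \<Rightarrow> (nat \<Rightarrow> real) \<Rightarrow> inf_matrix" where
  "tridiagonal b c i k = (if k = i then b i else if k = Suc i then 1 else if i = Suc k then c k else 0)"

text \<open>The contribution of \<open>L\<close> to the diagonal entry at the start of block \<open>j\<close>: it meets the entry
  \<open>1\<close> of \<open>U\<close> above it exactly if the preceding block has size 1.\<close>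

definition carry :: "(nat \<Rightarrow> real) \<Rightarrow> nat \<Rightarrow> real" where
  "carry l j = (if 0 < j \<and> sz (j - 1) = 1 then l j else 0)"

lemma tridiagonal_LU:
  assumes d1: "\<And>j. sz j = 1 \<Longrightarrow> u0 j + carry l j = b (ns j)"
    and d2: "\<And>j. sz j = 2 \<Longrightarrow> carry l j = b (ns j) \<and> u0 j = c (ns j) \<and> u1 j = b (Suc (ns j))"
    and sub: "\<And>j. l (Suc j) * (if sz j = 1 then u0 j else 1) = c (ns (Suc j) - 1)"
  shows "tridiagonal b c = inf_matrix_mult (L_matrix ns l) (U_matrix ns u0 u1)"
proof (intro ext)
  fix i k
  obtain j r where jr: "i = ns j + r" "r < sz j" by (rule index_cases)
  obtain m q where mq: "k = ns m + q" "q < sz m" by (rule index_cases)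
  have rs: "sz j = 1 \<and> r = 0 \<or> sz j = 2 \<and> r = 0 \<or> sz j = 2 \<and> r = 1"
    using jr(2) sz_cases[of j] by auto
  have qs: "sz m = 1 \<and> q = 0 \<or> sz m = 2 \<and> q = 0 \<or> sz m = 2 \<and> q = 1"
    using mq(2) sz_cases[of m] by auto
  let ?P = "tridiagonal b c (ns j + r) (ns m + q) = U_entry u0 u1 j m r q +
      (if r = 0 \<and> 0 < j then l j * U_entry u0 u1 (j - 1) m 0 q else 0)"
  have far: "ns (Suc (Suc i)) \<le> ns k" if "Suc i < k" for i k
    using that ns_strict_mono by (simp add: strict_mono_less_eq)
  consider "m = j" | "m = Suc j" | "j = Suc m" | "Suc j < m" | "Suc m < j" by linarith
  hence ?P
  proof cases
    case 1
    have car: "(if r = 0 \<and> 0 < j then l j * U_entry u0 u1 (j - 1) m 0 q else 0) =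
        (if r = 0 \<and> q = 0 then carry l j else 0)"
      using sz_cases[of "j - 1"] 1 by (auto simp: entry_simps carry_def)
    have tri: "tridiagonal b c (ns j + r) (ns m + q) = (if q = r then b (ns j + r)
        else if q = Suc r then 1 else if r = Suc q then c (ns j + q) else 0)"
      by (simp add: tridiagonal_def 1)
    have U: "U_entry u0 u1 j m r q = companion_entry ns u0 u1 j r q" by (simp add: entry_simps 1)
    consider "sz j = 1" "r = 0" "q = 0" | "sz j = 2" "r = 0" "q = 0" | "sz j = 2" "r = 0" "q = 1"
      | "sz j = 2" "r = 1" "q = 0" | "sz j = 2" "r = 1" "q = 1"
      using rs qs 1 by auto
    thus ?thesis unfolding car tri U
    proof cases
      case 1 thus "(if q = r then b (ns j + r)
        else if q = Suc r then 1 else if r = Suc q then c (ns j + q) else 0) =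
        companion_entry ns u0 u1 j r q + (if r = 0 \<and> q = 0 then carry l j else 0)"
        using d1 by (simp add: companion_entry_def)
    qed (use d2 in \<open>simp_all add: companion_entry_def\<close>)
  next
    case 2
    have "(if r = 0 \<and> 0 < j then l j * U_entry u0 u1 (j - 1) m 0 q else 0) = 0"
      using 2 by (auto simp: entry_simps)
    moreover have "tridiagonal b c (ns j + r) (ns m + q) = (if Suc r = sz j \<and> q = 0 then 1 else 0)"
      using 2 jr(2) by (auto simp: tridiagonal_def ns_Suc_eq)
    moreover have "U_entry u0 u1 j m r q = (if Suc r = sz j \<and> q = 0 then 1 else 0)"
      using 2 by (simp add: entry_simps)
    ultimately show ?thesis by simp
  next
    case 3
    have "U_entry u0 u1 j m r q = 0" using 3 by (simp add: entry_simps)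
    moreover have "tridiagonal b c (ns j + r) (ns m + q) = (if r = 0 \<and> Suc q = sz m then c (ns m + q) else 0)"
      using 3 mq(2) by (auto simp: tridiagonal_def ns_Suc_eq)
    moreover have "(if r = 0 \<and> 0 < j then l j * U_entry u0 u1 (j - 1) m 0 q else 0) =
        (if r = 0 then l (Suc m) * companion_entry ns u0 u1 m 0 q else 0)"
      using 3 by (simp add: U_entry_def)
    moreover have "(if Suc q = sz m then c (ns m + q) else 0) = l (Suc m) * companion_entry ns u0 u1 m 0 q"
    proof -
      consider "sz m = 1" "q = 0" | "sz m = 2" "q = 0" | "sz m = 2" "q = 1" using qs by auto
      thus ?thesis using sub[of m] by cases (simp_all add: companion_entry_def ns_Suc_eq)
    qed
    ultimately show ?thesis by simp
  next
    case 4
    have "U_entry u0 u1 j m r q = 0" "U_entry u0 u1 (j - 1) m 0 q = 0" using 4 by (auto simp: entry_simps)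
    thus ?thesis using jr(2) far[OF 4] sz_pos[of "Suc j"] by (simp add: tridiagonal_def ns_Suc_eq)
  next
    case 5
    have "U_entry u0 u1 j m r q = 0" "U_entry u0 u1 (j - 1) m 0 q = 0" using 5 by (auto simp: entry_simps)
    thus ?thesis using mq(2) far[OF 5] sz_pos[of "Suc m"] by (simp add: tridiagonal_def ns_Suc_eq)
  qed
  thus "tridiagonal b c i k = inf_matrix_mult (L_matrix ns l) (U_matrix ns u0 u1) i k"
    unfolding jr mq LU_entry[OF jr(2) mq(2)] .
qed

text \<open>Exchanging the factors puts \<open>l (j + 1)\<close> into the lower left corner of block \<open>j\<close> and \<open>u0 (j + 1) l (j + 1)\<close>
  into the lower left corner below it, which is the shape of a generalized Jacobi matrix.\<close>

lemma block_tridiagonal_UL: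
  assumes "\<And>j. d0 j = u0 j + l (Suc j)" "\<And>j. sz j = 2 \<Longrightarrow> d1 j = u1 j"
    "\<And>j. c j = u0 (Suc j) * l (Suc j)"
  shows "block_matrix ns (\<lambda>j m r q.
     if m = j then companion_entry ns d0 d1 j r q
     else if m = Suc j then lower_left ns 1 j r q
     else if j = Suc m then lower_left ns (c m) j r q
     else 0) = inf_matrix_mult (U_matrix ns u0 u1) (L_matrix ns l)"
proof (intro ext)
  fix i k
  obtain j r where jr: "i = ns j + r" "r < sz j" by (rule index_cases)
  obtain m q where mq: "k = ns m + q" "q < sz m" by (rule index_cases)
  show "block_matrix ns (\<lambda>j m r q.
     if m = j then companion_entry ns d0 d1 j r q
     else if m = Suc j then lower_left ns 1 j r q
     else if j = Suc m then lower_left ns (c m) j r q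
     else 0) i k = inf_matrix_mult (U_matrix ns u0 u1) (L_matrix ns l) i k"
    unfolding jr mq UL_entry[OF jr(2) mq(2)] block_matrix_at[OF jr(2) mq(2)]
  proof -
    have rs: "sz j = 1 \<and> r = 0 \<or> sz j = 2 \<and> r = 0 \<or> sz j = 2 \<and> r = 1"
      using jr(2) sz_cases[of j] by auto
    have qs: "sz m = 1 \<and> q = 0 \<or> sz m = 2 \<and> q = 0 \<or> sz m = 2 \<and> q = 1"
      using mq(2) sz_cases[of m] by auto
    consider "m = j" | "m = Suc j" | "j = Suc m" | "m \<noteq> j" "m \<noteq> Suc j" "j \<noteq> Suc m" by blast
    thus "(if m = j then companion_entry ns d0 d1 j r q
        else if m = Suc j then lower_left ns 1 j r q
        else if j = Suc m then lower_left ns (c m) j r q else 0) =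
        U_entry u0 u1 j m r q + (if q = 0 then U_entry u0 u1 j (Suc m) r 0 * l (Suc m) else 0)"
      using rs qs assms(1)[of j] assms(2)[of j] assms(3)[of m]
      by cases (elim disjE conjE; simp add: U_entry_def companion_entry_def lower_left_def)+
  qed
qed

end

section \<open>Expansions at infinity and continued fractions\<close>

text \<open>A Laurent expansion in \<open>1 / z\<close> with real coefficients. Reality is required of the values on the
  real axis, since quotients inherit it in this form at once.\<close>

definition real_laurent :: "(complex \<Rightarrow> complex) \<Rightarrow> complex fls \<Rightarrow> bool" where
  "real_laurent f F \<longleftrightarrow> (\<lambda>y. f (1 / y)) has_laurent_expansion F \<and>
     (\<forall>\<^sub>F x in at_top. f (complex_of_real x) \<in> \<real>)"

lemma filterlim_one_over_at_0: "filterlim (\<lambda>y::complex. 1 / y) at_infinity (at 0)"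
  using filterlim_inverse_at_infinity[where 'a = complex] by (simp add: divide_inverse)

lemma filterlim_one_over_at_infinity: "filterlim (\<lambda>z::complex. 1 / z) (at 0) at_infinity"
  using filterlim_inverse_at_iff[of "\<lambda>z::complex. z" at_infinity] filterlim_ident
  by (simp add: divide_inverse)

lemma real_laurent_cong:
  assumes "\<forall>\<^sub>F z in at_infinity. f z = g z"
  shows "real_laurent f F \<longleftrightarrow> real_laurent g F"
proof -
  have 1: "\<forall>\<^sub>F y in at 0. f (1 / y) = g (1 / y)"
    using assms filterlim_one_over_at_0 by (rule eventually_compose_filterlim)
  have 2: "\<forall>\<^sub>F x in at_top. f (complex_of_real x) = g (complex_of_real x)"
    using assms filterlim_of_real_at_infinity by (rule eventually_compose_filterlim)
  have "(\<forall>\<^sub>F x in at_top. f (complex_of_real x) \<in> \<real>) \<longleftrightarrow> (\<forall>\<^sub>F x in at_top. g (complex_of_real x) \<in> \<real>)"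
    by (rule eventually_cong[OF 2]) simp
  with has_laurent_expansion_cong[OF 1 refl] show ?thesis by (simp add: real_laurent_def)
qed

lemma real_laurent_divide:
  assumes "real_laurent f F" "real_laurent g G"
  shows "real_laurent (\<lambda>z. f z / g z) (F / G)"
  using assms unfolding real_laurent_def
  by (auto intro!: laurent_expansion_intros elim: eventually_elim2)

lemma real_laurent_cmult:
  assumes "real_laurent f F"
  shows "real_laurent (\<lambda>z. complex_of_real c * f z) (fls_const (complex_of_real c) * F)"
  using assms unfolding real_laurent_def
  by (auto intro!: laurent_expansion_intros elim: eventually_mono)

text \<open>The constant coefficient is the limit at \<open>0\<close>, which may be taken along the positive real axis.\<close>

lemma laurent_const_coeff_real:
  assumes "h has_laurent_expansion H" "0 \<le> fls_subdegree H"
    "\<forall>\<^sub>F t in at_right 0. h (complex_of_real t) \<in> \<real>"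
  shows "fls_nth H 0 \<in> \<real>"
proof -
  have "filterlim complex_of_real (at 0) (at_right 0)"
    by (rule filterlim_atI) (auto intro!: tendsto_eq_intros simp: eventually_at_right_less eventually_at_filter)
  hence "((\<lambda>t. h (complex_of_real t)) \<longlongrightarrow> fls_nth H 0) (at_right 0)"
    using filterlim_compose[OF has_laurent_expansion_imp_tendsto_0[OF assms(1,2)]] by blast
  thus ?thesis using closed_complex_Reals assms(3) by (intro Lim_in_closed_set) auto
qed

text \<open>Subtracting the constant coefficient and dividing by the variable preserves the assumptions and
  shifts the coefficients.\<close>

lemma laurent_coeffs_real:
  assumes "h has_laurent_expansion H" "0 \<le> fls_subdegree H"
    "\<forall>\<^sub>F t in at_right 0. h (complex_of_real t) \<in> \<real>"
  shows "fls_nth H (int n) \<in> \<real>"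
  using assms
proof (induction n arbitrary: h H)
  case 0
  thus ?case using laurent_const_coeff_real by simp
next
  case (Suc n)
  have H0: "fls_nth H 0 \<in> \<real>" by (rule laurent_const_coeff_real) fact+
  define h1 where "h1 y = (h y - fls_nth H 0) * y powi (-1)" for y
  define H1 where "H1 = fls_shift 1 (H - fls_const (fls_nth H 0))"
  have "h1 has_laurent_expansion H1"
    unfolding h1_def H1_def by (intro laurent_expansion_intros Suc(2))
  moreover have "0 \<le> fls_subdegree H1"
  proof (cases "H1 = 0")
    case False
    show ?thesis
    proof (rule fls_subdegree_geI[OF False])
      fix k :: int assume "k < 0"
      hence "k + 1 < fls_subdegree H \<or> k + 1 = 0" using Suc(3) by linarith
      thus "fls_nth H1 k = 0" by (auto simp: H1_def fls_const_nth)
    qed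
  qed simp
  moreover have "\<forall>\<^sub>F t in at_right 0. h1 (complex_of_real t) \<in> \<real>"
    using Suc(4) by eventually_elim (use H0 in \<open>auto simp: h1_def power_int_minus\<close>)
  ultimately have "fls_nth H1 (int n) \<in> \<real>" by (rule Suc.IH)
  thus ?case by (simp add: H1_def fls_const_nth add.commute)
qed

lemma real_laurent_coeffs_real:
  assumes "real_laurent f F" shows "fls_nth F k \<in> \<real>"
proof -
  define h where "h y = f (1 / y) * y powi (- fls_subdegree F)" for y
  define H where "H = fls_shift (fls_subdegree F) F"
  have h: "h has_laurent_expansion H"
    unfolding h_def H_def using assms by (intro laurent_expansion_intros) (simp add: real_laurent_def)
  have "fls_subdegree H \<ge> 0" by (cases "F = 0") (auto simp: H_def)
  moreover have "\<forall>\<^sub>F t in at_right 0. h (complex_of_real t) \<in> \<real>"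
  proof -
    have "\<forall>\<^sub>F x in at_top. f (complex_of_real x) \<in> \<real>" using assms by (simp add: real_laurent_def)
    hence "\<forall>\<^sub>F t in at_right 0. f (complex_of_real (inverse t)) \<in> \<real>"
      using filterlim_inverse_at_top_right by (rule eventually_compose_filterlim)
    thus ?thesis
      by eventually_elim (auto simp: h_def divide_inverse power_int_def)
  qed
  ultimately have n: "fls_nth H (int n) \<in> \<real>" for n using laurent_coeffs_real[OF h] by blast
  show ?thesis
  proof (cases "k < fls_subdegree F")
    case False
    hence "k = int (nat (k - fls_subdegree F)) + fls_subdegree F" by simp
    thus ?thesis using n[of "nat (k - fls_subdegree F)"] by (metis H_def fls_shift_nth)
  qed simp
qed

lemma laurent_bigo:
  assumes g: "g has_laurent_expansion G" and low: "\<And>k. k < int n \<Longrightarrow> fls_nth G k = 0"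
  shows "g \<in> O[at 0](\<lambda>y. y ^ n)"
proof (rule bigoI_tendsto)
  have "(\<lambda>y. g y * y powi (- int n)) has_laurent_expansion fls_shift (int n) G"
    by (intro laurent_expansion_intros g)
  moreover have "0 \<le> fls_subdegree (fls_shift (int n) G)"
  proof (cases "fls_shift (int n) G = 0")
    case False
    thus ?thesis by (rule fls_subdegree_geI) (simp add: low)
  qed simp
  ultimately have "(\<lambda>y. g y * y powi (- int n)) \<midarrow>0\<rightarrow> fls_nth (fls_shift (int n) G) 0"
    by (rule has_laurent_expansion_imp_tendsto_0)
  thus "((\<lambda>y. g y / y ^ n) \<longlongrightarrow> fls_nth (fls_shift (int n) G) 0) (at 0)"
    by (simp add: power_int_minus divide_inverse)
  show "\<forall>\<^sub>F y in at 0. y ^ n \<noteq> (0::complex)"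
    by (rule eventually_mono[OF eventually_neq_at_within[of 0]]) simp
qed

lemma real_laurent_has_asymp_coeffs:
  assumes F: "real_laurent f F" and low: "\<And>k. k \<le> 0 \<Longrightarrow> fls_nth F k = 0"
  shows "has_asymp_coeffs f (\<lambda>j. - Re (fls_nth F (int j + 1)))"
  unfolding has_asymp_coeffs_def
proof (intro allI impI)
  fix e :: real and n :: nat
  let ?s = "\<lambda>j. - Re (fls_nth F (int j + 1))"
  define G where "G = F + (\<Sum>j<n. fls_const (complex_of_real (?s j)) * fls_X_intpow (int (j + 1)))"
  have "(\<lambda>y. f (1 / y) + (\<Sum>j<n. complex_of_real (?s j) * y ^ (j + 1))) has_laurent_expansion G"
    unfolding G_def by (intro laurent_expansion_intros) (use F in \<open>simp add: real_laurent_def\<close>)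
  moreover have "fls_nth G k = 0" if "k < int (n + 1)" for k
  proof -
    have "fls_nth G k = fls_nth F k + (\<Sum>j<n. if k = int (j + 1) then complex_of_real (?s j) else 0)"
      unfolding G_def fls_plus_nth fls_nth_sum
      by (intro arg_cong2[of _ _ _ _ "(+)"] refl sum.cong) auto
    also have "\<dots> = 0"
    proof (cases "k \<le> 0")
      case True
      thus ?thesis using low[OF True] by (simp add: sum.neutral)
    next
      case False
      define i where "i = nat (k - 1)"
      have i: "k = int i + 1" "i < n" using False that by (auto simp: i_def)
      have "(\<Sum>j<n. if k = int (j + 1) then complex_of_real (?s j) else 0) =
          (\<Sum>j<n. if j = i then complex_of_real (?s i) else 0)"
        by (intro sum.cong) (auto simp: i)
      also have "\<dots> = complex_of_real (?s i)" using i(2) by simp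
      finally show ?thesis
        using real_laurent_coeffs_real[OF F, of k] by (simp add: i(1) of_real_Re)
    qed
    finally show ?thesis .
  qed
  ultimately have "(\<lambda>y. f (1 / y) + (\<Sum>j<n. complex_of_real (?s j) * y ^ (j + 1))) \<in> O[at 0](\<lambda>y. y ^ (n + 1))"
    by (rule laurent_bigo)
  from landau_o.big.compose[OF this filterlim_one_over_at_infinity]
  have "(\<lambda>z. f z + (\<Sum>j<n. complex_of_real (?s j) / z ^ (j + 1))) \<in> O[at_infinity](\<lambda>z. 1 / z ^ (n + 1))"
    by (simp add: power_one_over power_divide)
  thus "(\<lambda>z. f z + (\<Sum>j<n. complex_of_real (?s j) / z ^ (j + 1))) \<in> O[sector_infinity e](\<lambda>z. 1 / z ^ (n + 1))"
    by (rule landau_o.big.filter_mono[rotated]) (simp add: sector_infinity_def)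
qed

lemma filterlim_imaginary_axis: "filterlim (\<lambda>t. \<i> * complex_of_real t) (sector_infinity 1) at_top"
  unfolding sector_infinity_def filterlim_inf filterlim_principal
proof
  show "filterlim (\<lambda>t. \<i> * complex_of_real t) at_infinity at_top"
    using filterlim_of_real_at_infinity
    by (subst filterlim_at_infinity_conv_norm_at_top) (simp add: norm_mult filterlim_abs_real)
  show "\<forall>\<^sub>F t in at_top. \<i> * complex_of_real t \<in> {z. 1 < Arg z \<and> Arg z < pi - 1}"
    using eventually_gt_at_top[of 0]
  proof eventually_elim
    case (elim t)
    have "Arg (\<i> * complex_of_real t) = pi / 2"
      using elim Arg_times_of_real[of t \<i>] by (simp add: mult.commute)
    thus ?case using pi_gt3 by simp
  qed
qed

text \<open>Two expansions that first differ at index \<open>j\<close> differ by a multiple of \<open>1 / z ^ (j + 1)\<close>, which is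
  not of the order of \<open>1 / z ^ (j + 2)\<close>. The imaginary axis, which runs inside the sector, suffices to
  see this.\<close>

lemma has_asymp_coeffs_unique:
  assumes "has_asymp_coeffs f s" "has_asymp_coeffs f s'" shows "s = s'"
proof
  fix j show "s j = s' j"
  proof (induction j rule: less_induct)
    case (less j)
    define d where "d = s j - s' j"
    have O: "(\<lambda>z. f z + (\<Sum>i<Suc j. complex_of_real (s i) / z ^ (i + 1))) \<in> O[sector_infinity 1](\<lambda>z. 1 / z ^ (Suc j + 1))"
      "(\<lambda>z. f z + (\<Sum>i<Suc j. complex_of_real (s' i) / z ^ (i + 1))) \<in> O[sector_infinity 1](\<lambda>z. 1 / z ^ (Suc j + 1))"
      using assms by (auto simp only: has_asymp_coeffs_def zero_less_one)
    have eq: "(f z + (\<Sum>i<Suc j. complex_of_real (s i) / z ^ (i + 1))) - (f z + (\<Sum>i<Suc j. complex_of_real (s' i) / z ^ (i + 1)))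
        = complex_of_real d / z ^ (j + 1)" for z
    proof -
      have "(\<Sum>i<j. complex_of_real (s i) / z ^ (i + 1)) = (\<Sum>i<j. complex_of_real (s' i) / z ^ (i + 1))"
        by (intro sum.cong) (use less in auto)
      thus ?thesis by (simp add: d_def diff_divide_distrib)
    qed
    have "(\<lambda>z. complex_of_real d / z ^ (j + 1)) \<in> O[sector_infinity 1](\<lambda>z. 1 / z ^ (Suc j + 1))"
      using sum_in_bigo(2)[OF O] unfolding eq .
    from landau_o.big.compose[OF this filterlim_imaginary_axis]
    obtain c where c: "c > 0" "\<forall>\<^sub>F t in at_top. cmod (complex_of_real d / (\<i> * complex_of_real t) ^ (j + 1)) \<le>
        c * cmod (1 / (\<i> * complex_of_real t) ^ (Suc j + 1))"
      by (elim landau_o.bigE) auto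
    have "\<forall>\<^sub>F t in at_top. \<bar>d\<bar> \<le> c / t"
      using c(2) eventually_gt_at_top[of 0]
    proof eventually_elim
      case (elim t)
      hence "\<bar>d\<bar> / t ^ (j + 1) \<le> c * (1 / t ^ (Suc j + 1))" by (simp add: norm_divide norm_power norm_mult)
      hence "\<bar>d\<bar> / t ^ (j + 1) * t ^ (j + 1) \<le> c * (1 / t ^ (Suc j + 1)) * t ^ (j + 1)"
        using elim by (intro mult_right_mono) auto
      thus ?case using elim by (simp add: field_simps)
    qed
    moreover have "((\<lambda>t. c / t) \<longlongrightarrow> 0) at_top" by (intro tendsto_divide_0[OF tendsto_const] filterlim_at_top_imp_at_infinity filterlim_ident)
    ultimately have "\<bar>d\<bar> \<le> 0" by (intro tendsto_lowerbound[of _ 0 at_top "\<bar>d\<bar>"]) auto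
    thus ?case by (simp add: d_def)
  qed
qed

lemma asymp_coeffs_real_laurent:
  assumes "real_laurent f F" "\<And>k. k \<le> 0 \<Longrightarrow> fls_nth F k = 0"
  shows "asymp_coeffs f = (\<lambda>j. - Re (fls_nth F (int j + 1)))"
  unfolding asymp_coeffs_def
  using real_laurent_has_asymp_coeffs[OF assms] has_asymp_coeffs_unique by (intro the_equality) auto

lemma first_coeff_real_laurent:
  assumes F: "real_laurent f F" and nz: "F \<noteq> 0" and pos: "fls_subdegree F > 0"
  shows "first_coeff f = - Re (fls_nth F (fls_subdegree F))"
proof -
  have s: "asymp_coeffs f = (\<lambda>j. - Re (fls_nth F (int j + 1)))"
    by (rule asymp_coeffs_real_laurent[OF F]) (use pos in auto)
  define m where "m = nat (fls_subdegree F - 1)"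
  have m: "int m + 1 = fls_subdegree F" using pos by (simp add: m_def)
  have "(LEAST j. asymp_coeffs f j \<noteq> 0) = m"
  proof (rule Least_equality)
    have "fls_nth F (fls_subdegree F) \<noteq> 0" using nz by simp
    thus "asymp_coeffs f m \<noteq> 0"
      using real_laurent_coeffs_real[OF F, of "fls_subdegree F"] by (simp add: s m complex_is_Real_iff complex_eq_iff)
  next
    fix j assume "asymp_coeffs f j \<noteq> 0"
    hence "fls_nth F (int j + 1) \<noteq> 0" by (auto simp: s)
    hence "int j + 1 \<ge> fls_subdegree F" by (rule fls_subdegree_leI)
    thus "m \<le> j" using m by linarith
  qed
  thus ?thesis by (simp add: first_coeff_def s m)
qed

text \<open>A decaying solution \<open>R\<close> of a three-term recurrence, where \<open>R j\<close> has order \<open>ns j\<close> and leading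
  coefficient \<open>- g j\<close> at infinity. The last recurrence coefficient is forced to be \<open>g (j + 1) / g j\<close>,
  since its term has to cancel the leading part of \<open>p j R (j + 1)\<close>. The index is shifted so that \<open>R 1\<close>
  is the function to be expanded: with \<open>R 0 = - 1\<close> the first step is an instance of the general one.\<close>

locale continued_fraction =
  fixes R :: "nat \<Rightarrow> complex \<Rightarrow> complex" and G :: "nat \<Rightarrow> complex fls" and g :: "nat \<Rightarrow> real"
    and ns :: "nat \<Rightarrow> nat" and p :: "nat \<Rightarrow> real poly"
  assumes expansion: "real_laurent (R j) (G j)"
    and below: "k < int (ns j) \<Longrightarrow> fls_nth (G j) k = 0"
    and leading: "fls_nth (G j) (int (ns j)) = - complex_of_real (g j)"
    and g_nonzero [simp]: "g j \<noteq> 0"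
    and R_0: "R 0 = (\<lambda>_. - 1)" and g_0: "g 0 = 1"
    and ns_less: "ns j < ns (Suc j)"
    and monic: "lead_coeff (p j) = 1"
    and recurrence: "\<forall>\<^sub>F z in at_infinity. R (Suc (Suc j)) z =
      poly (map_poly complex_of_real (p j)) z * R (Suc j) z - complex_of_real (g (Suc j) / g j) * R j z"
begin

lemma subdegree_G: "fls_subdegree (G j) = int (ns j)"
  by (rule fls_subdegree_eqI) (use below leading in auto)

lemma G_nonzero [simp]: "G j \<noteq> 0"
  using leading[of j] by auto

lemma ratio_expansion:
  "real_laurent (\<lambda>z. complex_of_real k * (R (Suc j) z / R j z)) (fls_const (complex_of_real k) * (G (Suc j) / G j))"
  by (intro real_laurent_cmult real_laurent_divide expansion)

lemma ratio_nonzero: "G (Suc j) / G j \<noteq> 0"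
  by simp

lemma ratio_subdegree: "fls_subdegree (G (Suc j) / G j) = int (ns (Suc j)) - int (ns j)"
  by (simp add: fls_divide_subdegree subdegree_G)

lemma first_coeff_ratio:
  assumes "\<forall>\<^sub>F z in at_infinity. f z = complex_of_real k * (R (Suc j) z / R j z)" "k \<noteq> 0"
  shows "first_coeff f = - k * g (Suc j) / g j"
proof -
  let ?F = "fls_const (complex_of_real k) * (G (Suc j) / G j)"
  have "real_laurent f ?F"
    using ratio_expansion[of k j] real_laurent_cong[OF assms(1)] by blast
  moreover have nz: "?F \<noteq> 0" using assms(2) by simp
  moreover have sub: "fls_subdegree ?F = int (ns (Suc j)) - int (ns j)"
    using assms(2) ratio_subdegree[of j] ratio_nonzero[of j] by (subst fls_subdegree_mult) auto
  moreover have "fls_nth (G (Suc j) / G j) (int (ns (Suc j)) - int (ns j)) = complex_of_real (g (Suc j) / g j)"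
    using fls_divide_nth_base[of "G (Suc j)" "G j"] by (simp add: subdegree_G leading)
  hence "fls_nth ?F (int (ns (Suc j)) - int (ns j)) = complex_of_real (k * g (Suc j) / g j)"
    by (subst fls_mult_const_nth) simp
  ultimately show ?thesis
    using first_coeff_real_laurent[of f ?F] ns_less[of j] by (simp del: fls_divide_times)
qed

lemma ratio_tendsto_0: "((\<lambda>z. R (Suc j) z / R j z) \<longlongrightarrow> 0) at_infinity"
proof -
  have "(\<lambda>y. R (Suc j) (1 / y) / R j (1 / y)) has_laurent_expansion (G (Suc j) / G j)"
    using expansion by (intro laurent_expansion_intros) (auto simp: real_laurent_def)
  moreover have "fls_subdegree (G (Suc j) / G j) > 0" using ratio_subdegree ns_less[of j] by simp
  ultimately have "(\<lambda>y. R (Suc j) (1 / y) / R j (1 / y)) \<midarrow>0\<rightarrow> 0"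
    using has_laurent_expansion_imp_tendsto_0[of _ "G (Suc j) / G j"] by fastforce
  from filterlim_compose[OF this filterlim_one_over_at_infinity] show ?thesis by simp
qed

lemma eventually_R_nonzero: "\<forall>\<^sub>F z in at_infinity. R j z \<noteq> 0"
proof -
  have "\<forall>\<^sub>F y in at 0. R j (1 / y) \<noteq> 0"
    using expansion[of j] by (intro has_laurent_expansion_nonzero_imp_eventually_nonzero[of _ "G j"])
      (auto simp: real_laurent_def)
  from eventually_compose_filterlim[OF this filterlim_one_over_at_infinity] show ?thesis by simp
qed

text \<open>Dividing the recurrence by \<open>R (j + 1)\<close> is one step of the continued fraction. The factor in front of
  the quotient is the one for which its first coefficient is the sign \<open>eps\<close>.\<close>

lemma inverse_ratio:
  assumes f: "\<forall>\<^sub>F z in at_infinity. f z = complex_of_real (- eps * g j / g (Suc j)) * (R (Suc j) z / R j z)"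
    and eps: "\<bar>eps\<bar> = 1"
  shows "\<forall>\<^sub>F z in at_infinity. - 1 / f z = complex_of_real eps *
      (poly (map_poly complex_of_real (p j)) z - R (Suc (Suc j)) z / R (Suc j) z)"
  using f recurrence[of j] eventually_R_nonzero[of j] eventually_R_nonzero[of "Suc j"]
proof eventually_elim
  case (elim z)
  have ee: "complex_of_real eps * complex_of_real eps = 1" "eps \<noteq> 0"
    using eps by (auto simp: abs_if split: if_splits)
  have 1: "- 1 / f z = complex_of_real eps * (complex_of_real (g (Suc j) / g j) * R j z / R (Suc j) z)"
  proof -
    have "eps = 1 \<or> eps = - 1" using eps by (auto simp: abs_if split: if_splits)
    thus ?thesis unfolding elim(1) using elim(3,4) by auto
  qed
  have 2: "complex_of_real (g (Suc j) / g j) * R j z =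
      poly (map_poly complex_of_real (p j)) z * R (Suc j) z - R (Suc (Suc j)) z"
    using elim(2) by simp
  show ?case unfolding 1 2 using elim(4) by (simp add: diff_divide_distrib)
qed

text \<open>In \<open>p j - R (j + 2) / R (j + 1)\<close> the quotient tends to \<open>0\<close>, so \<open>p j\<close> is the polynomial part.\<close>

lemma step_poly_ratio:
  assumes f: "\<forall>\<^sub>F z in at_infinity. f z = complex_of_real (- eps * g j / g (Suc j)) * (R (Suc j) z / R j z)"
    and eps: "\<bar>eps\<bar> = 1"
  shows "first_coeff f = eps" "step_poly f = p j"
    "\<forall>\<^sub>F z in at_infinity. step_rest f z = complex_of_real (- eps) * (R (Suc (Suc j)) z / R (Suc j) z)"
proof -
  have e0: "eps \<noteq> 0" using eps by auto
  show fc: "first_coeff f = eps"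
    using first_coeff_ratio[OF f] e0 by simp
  let ?q = "\<lambda>q z. - 1 / f z - complex_of_real eps * poly (map_poly complex_of_real q) z"
  have lim0: "(?q (p j) \<longlongrightarrow> 0) at_infinity"
  proof -
    have "((\<lambda>z. - complex_of_real eps * (R (Suc (Suc j)) z / R (Suc j) z)) \<longlongrightarrow> - complex_of_real eps * 0) at_infinity"
      by (intro tendsto_mult tendsto_const ratio_tendsto_0)
    moreover have "\<forall>\<^sub>F z in at_infinity. - complex_of_real eps * (R (Suc (Suc j)) z / R (Suc j) z) = ?q (p j) z"
      using inverse_ratio[OF f eps] by eventually_elim (simp add: algebra_simps)
    ultimately show ?thesis using tendsto_cong by force
  qed
  show sp: "step_poly f = p j"
    unfolding step_poly_def fc
  proof (rule the_equality)
    show "lead_coeff (p j) = 1 \<and> (\<forall>e>0. (?q (p j) \<longlongrightarrow> 0) (sector_infinity e))"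
      using monic lim0 by (auto simp: sector_infinity_def intro: tendsto_mono[OF inf_le1])
  next
    fix q assume q: "lead_coeff q = 1 \<and> (\<forall>e>0. (?q q \<longlongrightarrow> 0) (sector_infinity e))"
    define d where "d = map_poly complex_of_real (q - p j)"
    have deval: "poly d z = poly (map_poly complex_of_real q) z - poly (map_poly complex_of_real (p j)) z" for z
    proof -
      have "d = map_poly complex_of_real q - map_poly complex_of_real (p j)"
        by (rule poly_eqI) (simp add: d_def coeff_map_poly)
      thus ?thesis by simp
    qed
    have "((\<lambda>z. ?q (p j) z - ?q q z) \<longlongrightarrow> 0 - 0) (sector_infinity 1)"
      using lim0 q by (intro tendsto_diff) (auto simp: sector_infinity_def intro: tendsto_mono[OF inf_le1])
    hence "((\<lambda>z. complex_of_real eps * poly d z) \<longlongrightarrow> 0) (sector_infinity 1)"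
      by (simp add: deval algebra_simps)
    from tendsto_mult[OF tendsto_const[of "complex_of_real (1 / eps)"] this]
    have lim: "(poly d \<longlongrightarrow> 0) (sector_infinity 1)" using e0 by simp
    have nontriv: "sector_infinity 1 \<noteq> bot"
      using filterlim_imaginary_axis by (metis filterlim_def filtermap_bot_iff bot.extremum_unique trivial_limit_at_top_linorder)
    have "d = 0"
    proof (cases "degree d = 0")
      case True
      then obtain c where c: "d = [:c:]" by (rule degree_eq_zeroE)
      have "poly d = (\<lambda>_. c)" by (simp add: c fun_eq_iff)
      hence "((\<lambda>_. c) \<longlongrightarrow> 0) (sector_infinity 1)" using lim by simp
      hence "c = 0" using nontriv by (simp add: tendsto_const_iff)
      thus ?thesis by (simp add: c)
    next
      case False
      hence "filterlim (poly d) at_infinity at_infinity"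
        by (intro filterlim_poly_at_infinity) auto
      hence "filterlim (poly d) at_infinity (sector_infinity 1)"
        by (rule filterlim_mono) (auto simp: sector_infinity_def)
      with lim nontriv show ?thesis using not_tendsto_and_filterlim_at_infinity by blast
    qed
    hence "q - p j = 0" by (simp add: d_def map_poly_eq_0_iff)
    thus "q = p j" by simp
  qed
  show "\<forall>\<^sub>F z in at_infinity. step_rest f z = complex_of_real (- eps) * (R (Suc (Suc j)) z / R (Suc j) z)"
    using inverse_ratio[OF f eps]
    by eventually_elim (simp add: step_rest_def fc sp algebra_simps)
qed

lemma step_b_ratio:
  assumes f: "\<forall>\<^sub>F z in at_infinity. f z = complex_of_real (- eps * g j / g (Suc j)) * (R (Suc j) z / R j z)"
    and eps: "\<bar>eps\<bar> = 1"
  shows "step_b f = sqrt \<bar>g (Suc (Suc j)) / g (Suc j)\<bar>"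
proof -
  let ?c = "g (Suc (Suc j)) / g (Suc j)"
  have fc: "first_coeff (\<lambda>z. step_rest f z / complex_of_real (b\<^sup>2)) = eps / b\<^sup>2 * ?c" if "b > 0" for b
  proof -
    have "\<forall>\<^sub>F z in at_infinity. step_rest f z / complex_of_real (b\<^sup>2) =
        complex_of_real (- eps / b\<^sup>2) * (R (Suc (Suc j)) z / R (Suc j) z)"
      using step_poly_ratio(3)[OF f eps] by eventually_elim (simp add: field_simps)
    from first_coeff_ratio[OF this] show ?thesis using that eps by (auto simp: field_simps)
  qed
  have c0: "\<bar>?c\<bar> > 0" by simp
  show ?thesis unfolding step_b_def
  proof (rule the_equality)
    show "sqrt \<bar>?c\<bar> > 0 \<and> \<bar>first_coeff (\<lambda>z. step_rest f z / complex_of_real ((sqrt \<bar>?c\<bar>)\<^sup>2))\<bar> = 1"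
      using fc[of "sqrt \<bar>?c\<bar>"] c0 eps by (simp add: abs_mult abs_divide)
  next
    fix b assume b: "b > 0 \<and> \<bar>first_coeff (\<lambda>z. step_rest f z / complex_of_real (b\<^sup>2))\<bar> = 1"
    hence "\<bar>eps / b\<^sup>2 * ?c\<bar> = 1" unfolding fc[OF conjunct1[OF b]] by blast
    hence "1 / \<bar>b\<^sup>2\<bar> * \<bar>?c\<bar> = 1" unfolding abs_mult abs_divide[of eps] eps .
    hence "b\<^sup>2 = \<bar>?c\<bar>" using b by (simp add: field_simps)
    thus "b = sqrt \<bar>?c\<bar>" using b by (metis less_imp_le real_sqrt_unique)
  qed
qed

primrec sgn_eps :: "nat \<Rightarrow> real" where
  "sgn_eps 0 = sgn (g (Suc 0))"
| "sgn_eps (Suc j) = sgn_eps j * sgn (g (Suc (Suc j)) / g (Suc j))"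

lemma abs_sgn_eps: "\<bar>sgn_eps j\<bar> = 1"
  by (induction j) (auto simp: abs_mult sgn_divide abs_divide abs_sgn_eq)

text \<open>The quotients of successive solutions, normalized, are the functions of the expansion.\<close>

lemma schur_iterate_ratio:
  "\<forall>\<^sub>F z in at_infinity. schur_iterate (R (Suc 0)) j z =
     complex_of_real (- sgn_eps j * g j / g (Suc j)) * (R (Suc j) z / R j z)"
proof (induction j)
  case 0
  have "\<forall>\<^sub>F z in at_infinity. R (Suc 0) z = complex_of_real (-1) * (R (Suc 0) z / R 0 z)"
    by (simp add: R_0)
  from first_coeff_ratio[OF this] have "first_coeff (R (Suc 0)) = g (Suc 0)" by (simp add: g_0)
  moreover have "sgn (g (Suc 0)) / g (Suc 0) = 1 / \<bar>g (Suc 0)\<bar>" by (simp add: sgn_if)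
  hence "complex_of_real (sgn (g (Suc 0)) / g (Suc 0)) = complex_of_real (1 / \<bar>g (Suc 0)\<bar>)" by simp
  ultimately show ?case by (simp add: R_0 g_0)
next
  case (Suc j)
  let ?c = "g (Suc (Suc j)) / g (Suc j)"
  have b: "(step_b (schur_iterate (R (Suc 0)) j))\<^sup>2 = \<bar>?c\<bar>"
    unfolding step_b_ratio[OF Suc abs_sgn_eps] by simp
  have k: "- sgn_eps j / \<bar>?c\<bar> = - sgn_eps (Suc j) * g (Suc j) / g (Suc (Suc j))"
    by (simp add: sgn_if abs_if divide_simps)
  from step_poly_ratio(3)[OF Suc abs_sgn_eps] show ?case
  proof eventually_elim
    case (elim z)
    have "schur_iterate (R (Suc 0)) (Suc j) z = complex_of_real (- sgn_eps j / \<bar>?c\<bar>) * (R (Suc (Suc j)) z / R (Suc j) z)"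
      unfolding schur_iterate.simps b elim by (simp only: of_real_divide times_divide_eq_left)
    thus ?case unfolding k .
  qed
qed

lemma gjac_p_eq: "gjac_p (R (Suc 0)) j = p j"
  unfolding gjac_p_def by (rule step_poly_ratio(2)[OF schur_iterate_ratio abs_sgn_eps])

lemma gjac_c_eq: "gjac_c (R (Suc 0)) j = g (Suc (Suc j)) / g (Suc j)"
proof -
  have e: "gjac_eps (R (Suc 0)) i = sgn_eps i" for i
    unfolding gjac_eps_def by (rule step_poly_ratio(1)[OF schur_iterate_ratio abs_sgn_eps])
  let ?c = "g (Suc (Suc j)) / g (Suc j)"
  have "gjac_c (R (Suc 0)) j = sgn_eps j * sgn_eps (Suc j) * \<bar>?c\<bar>"
    unfolding gjac_c_def e step_b_ratio[OF schur_iterate_ratio abs_sgn_eps] by simp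
  also have "\<dots> = (\<bar>sgn_eps j\<bar> * \<bar>sgn_eps j\<bar>) * (sgn ?c * \<bar>?c\<bar>)"
    by (simp only: sgn_eps.simps abs_mult_self_eq mult_ac)
  also have "\<dots> = ?c" unfolding abs_sgn_eps by (simp only: sgn_mult_abs mult_1)
  finally show ?thesis .
qed

end

section \<open>Normal indices and the LU factorization\<close>

context measure_on_unit_interval
begin

declare P.simps(2) [simp del]

abbreviation P_at_0 :: "nat \<Rightarrow> real" where "P_at_0 n \<equiv> poly (P n) 0"

lemma P_at_0_1: "P_at_0 (Suc 0) = - rb 0"
  using arg_cong[OF rec_P0, of "\<lambda>p. poly p 0"] by simp

lemma P_at_0_rec: "P_at_0 (Suc (Suc n)) = - rb (Suc n) * P_at_0 (Suc n) - rc n * P_at_0 n"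
  using arg_cong[OF P_Suc_Suc[of n], of "\<lambda>p. poly p 0"] by simp

lemma P_at_0_consecutive: "P_at_0 n = 0 \<Longrightarrow> P_at_0 (Suc n) \<noteq> 0"
proof (induction n)
  case (Suc n)
  hence "P_at_0 n \<noteq> 0" by blast
  thus ?case using rc_pos[of n] Suc.prems by (simp add: P_at_0_rec)
qed simp

definition ns :: "nat \<Rightarrow> nat" where
  "ns = normal_index (\<lambda>j. M ([:0, 1:] ^ (j + 1)))"

text \<open>Index \<open>0\<close> fits the pattern because \<open>P 0 = 1\<close>.\<close>

lemma ns_enumerate: "ns = enumerate {n. P_at_0 n \<noteq> 0}"
proof -
  have "insert 0 {n. n \<ge> 1 \<and> hankel_det (\<lambda>j. M ([:0, 1:] ^ (j + 1))) n \<noteq> 0} = {n. P_at_0 n \<noteq> 0}"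
    unfolding hankel_det_shifted_moments by (auto simp: Suc_le_eq)
  thus ?thesis by (simp add: ns_def normal_index_def)
qed

lemma infinite_normal: "infinite {n. P_at_0 n \<noteq> 0}"
  unfolding infinite_nat_iff_unbounded
proof
  fix m
  show "\<exists>n>m. n \<in> {n. P_at_0 n \<noteq> 0}"
    using P_at_0_consecutive[of "Suc m"] by (cases "P_at_0 (Suc m) = 0") (auto intro: exI[of _ "Suc m"] exI[of _ "Suc (Suc m)"])
qed

lemma P_at_0_ns [simp]: "P_at_0 (ns j) \<noteq> 0"
  using enumerate_in_set[OF infinite_normal, of j] by (simp add: ns_enumerate)

lemma ns_0' [simp]: "ns 0 = 0"
  unfolding ns_enumerate enumerate_0 by (rule Least_equality) auto

lemma ns_Suc': "ns (Suc j) = (if P_at_0 (Suc (ns j)) \<noteq> 0 then Suc (ns j) else Suc (Suc (ns j)))"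
proof -
  have "ns (Suc j) = (LEAST s. s \<in> {n. P_at_0 n \<noteq> 0} \<and> ns j < s)"
    unfolding ns_enumerate by (rule enumerate_Suc''[OF infinite_normal])
  also have "\<dots> = (if P_at_0 (Suc (ns j)) \<noteq> 0 then Suc (ns j) else Suc (Suc (ns j)))"
  proof (rule Least_equality)
    show "(if P_at_0 (Suc (ns j)) \<noteq> 0 then Suc (ns j) else Suc (Suc (ns j))) \<in> {n. P_at_0 n \<noteq> 0} \<and>
        ns j < (if P_at_0 (Suc (ns j)) \<noteq> 0 then Suc (ns j) else Suc (Suc (ns j)))"
      using P_at_0_consecutive[of "Suc (ns j)"] by auto
  next
    fix y assume y: "y \<in> {n. P_at_0 n \<noteq> 0} \<and> ns j < y"
    hence "y \<noteq> Suc (ns j)" if "P_at_0 (Suc (ns j)) = 0" using that by auto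
    with y show "(if P_at_0 (Suc (ns j)) \<noteq> 0 then Suc (ns j) else Suc (Suc (ns j))) \<le> y"
      by (auto simp: Suc_le_eq)
  qed
  finally show ?thesis .
qed

sublocale blocks: blocks_1_2 ns
  by unfold_locales (auto simp: ns_Suc')

lemma sz_eq: "block_size ns j = (if P_at_0 (Suc (ns j)) \<noteq> 0 then 1 else 2)"
  by (auto simp: block_size_def ns_Suc')

definition rho :: "nat \<Rightarrow> real" where
  "rho j = P_at_0 (Suc (ns j)) / P_at_0 (ns j)"

text \<open>The entries of the factors of \<open>J = LU\<close>; those of \<open>L\<close> follow from those of \<open>U\<close> and the subdiagonal
  of \<open>J\<close>.\<close>

definition LU_u0 :: "nat \<Rightarrow> real" where
  "LU_u0 j = (if block_size ns j = 1 then - rho j else rc (ns j))"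

definition LU_u1 :: "nat \<Rightarrow> real" where
  "LU_u1 j = rb (Suc (ns j))"

definition LU_l :: "nat \<Rightarrow> real" where
  "LU_l j = (case j of 0 \<Rightarrow> 0 | Suc i \<Rightarrow>
     if block_size ns i = 1 then rc (ns i) / LU_u0 i else rc (Suc (ns i)))"

lemma rho_nonzero_iff: "rho j \<noteq> 0 \<longleftrightarrow> block_size ns j = 1"
  by (simp add: rho_def sz_eq)

lemma LU_u0_nonzero [simp]: "LU_u0 j \<noteq> 0"
  using rho_nonzero_iff[of j] rc_pos[of "ns j"] by (auto simp: LU_u0_def)

lemma LU_l_nonzero [simp]: "LU_l (Suc j) \<noteq> 0"
  using rc_pos[of "ns j"] rc_pos[of "Suc (ns j)"] by (simp add: LU_l_def less_imp_neq[THEN not_sym])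

text \<open>This is the three-term recurrence evaluated at \<open>0\<close>.\<close>

lemma rb_ns: "rb (ns j) = - rho j + blocks.carry LU_l j"
proof (cases j)
  case 0
  then show ?thesis by (simp add: rho_def P_at_0_1 blocks.carry_def)
next
  case (Suc i)
  show ?thesis
  proof (cases "block_size ns i = 1")
    case True
    hence m: "ns j = Suc (ns i)" by (simp add: Suc ns_Suc' sz_eq split: if_splits)
    have nz: "P_at_0 (Suc (ns i)) \<noteq> 0" using P_at_0_ns[of j] by (simp add: m)
    have "LU_l j = - rc (ns i) * P_at_0 (ns i) / P_at_0 (Suc (ns i))"
      using True nz by (simp add: Suc LU_l_def LU_u0_def rho_def field_simps)
    thus ?thesis using True nz
      by (simp add: blocks.carry_def Suc rho_def m[unfolded Suc] P_at_0_rec field_simps)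
  next
    case False
    hence z: "P_at_0 (Suc (ns i)) = 0" by (simp add: sz_eq split: if_splits)
    hence m: "ns j = Suc (Suc (ns i))" by (simp add: Suc ns_Suc')
    have nz: "P_at_0 (Suc (Suc (ns i))) \<noteq> 0" using P_at_0_ns[of j] by (simp add: m)
    have "P_at_0 (Suc (Suc (Suc (ns i)))) = - rb (ns j) * P_at_0 (ns j)"
      using P_at_0_rec[of "Suc (ns i)"] z by (simp add: m)
    thus ?thesis using False nz by (simp add: blocks.carry_def Suc rho_def m[unfolded Suc] field_simps)
  qed
qed

lemma monic_jacobi_tridiagonal: "monic_jacobi \<sigma> = blocks.tridiagonal rb rc"
  by (intro ext) (simp add: monic_jacobi_def blocks.tridiagonal_def recurrence_coeffs_eq)

lemma monic_jacobi_LU: "monic_jacobi \<sigma> = inf_matrix_mult (L_matrix ns LU_l) (U_matrix ns LU_u0 LU_u1)"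
  unfolding monic_jacobi_tridiagonal
proof (rule blocks.tridiagonal_LU)
  fix j
  show "LU_u0 j + blocks.carry LU_l j = rb (ns j)" if "block_size ns j = 1"
    using that by (simp add: LU_u0_def rb_ns)
  show "blocks.carry LU_l j = rb (ns j) \<and> LU_u0 j = rc (ns j) \<and> LU_u1 j = rb (Suc (ns j))"
    if "block_size ns j = 2"
    using that rho_nonzero_iff[of j] by (simp add: LU_u0_def LU_u1_def rb_ns)
  show "LU_l (Suc j) * (if block_size ns j = 1 then LU_u0 j else 1) = rc (ns (Suc j) - 1)"
    using blocks.sz_cases[of j] by (auto simp: LU_l_def blocks.ns_Suc_eq)
qed

section \<open>The Darboux transform\<close>

text \<open>These are \<open>\<lambda>\<close> times the monic polynomials orthogonal for \<open>t d\<sigma>(t)\<close>. Keeping the factor \<open>\<lambda>\<close> avoids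
  divisions and keeps all integrals with respect to \<open>\<sigma>\<close>.\<close>

definition T :: "nat \<Rightarrow> real poly" where
  "T j = quasi (rho j) (ns j)"

text \<open>The polynomials in the continued fraction, read off from the diagonal blocks of \<open>UL\<close>.\<close>

definition gen_p :: "nat \<Rightarrow> real poly" where
  "gen_p j = (if block_size ns j = 1 then [:- (LU_u0 j + LU_l (Suc j)), 1:]
     else [:- (LU_u0 j + LU_l (Suc j)), - LU_u1 j, 1:])"

text \<open>Rows of \<open>U\<close> applied to the column of the \<open>P n\<close>.\<close>

lemma U_row_1:
  assumes "block_size ns j = 1"
  shows "T j = P (ns (Suc j)) + Polynomial.smult (LU_u0 j) (P (ns j))"
  using assms by (simp add: T_def quasi_def LU_u0_def blocks.ns_Suc_eq)

lemma U_row_2: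
  assumes "block_size ns j = 2"
  shows "T j = P (Suc (ns j))"
    "[:0, 1:] * T j = P (ns (Suc j)) + Polynomial.smult (LU_u1 j) (T j) + Polynomial.smult (LU_u0 j) (P (ns j))"
proof -
  show t: "T j = P (Suc (ns j))"
    using assms rho_nonzero_iff[of j] by (simp add: T_def quasi_def)
  show "[:0, 1:] * T j = P (ns (Suc j)) + Polynomial.smult (LU_u1 j) (T j) + Polynomial.smult (LU_u0 j) (P (ns j))"
    unfolding t using rec_P[of "ns j"] assms by (simp del: mult_pCons_left add: LU_u1_def LU_u0_def blocks.ns_Suc_eq)
qed

text \<open>Rows of \<open>L\<close> applied to the column of the \<open>T j\<close>. The coefficients match because both sides vanish at
  \<open>0\<close>, which is \<open>rb_ns\<close>.\<close>

lemma L_row: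
  "[:0, 1:] * P (ns j) = T j + (if j = 0 then 0 else Polynomial.smult (LU_l j) (T (j - 1)))"
proof (cases j)
  case 0
  then show ?thesis using rec_P0 rb_ns[of 0]
    by (simp del: mult_pCons_left add: T_def quasi_def blocks.carry_def)
next
  case (Suc i)
  show ?thesis
  proof (cases "block_size ns i = 1")
    case True
    hence m: "ns (Suc i) = Suc (ns i)" by (simp add: blocks.ns_Suc_eq)
    have "rb (Suc (ns i)) = - rho (Suc i) + LU_l (Suc i)"
      using rb_ns[of "Suc i"] True by (simp add: m blocks.carry_def)
    moreover have "rc (ns i) = LU_l (Suc i) * LU_u0 i" using True by (simp add: LU_l_def)
    ultimately show ?thesis
      using rec_P[of "ns i"] U_row_1[OF True]
      by (simp del: mult_pCons_left add: Suc T_def[of "Suc i"] quasi_def m smult_add_left smult_add_right smult_diff_left)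
  next
    case False
    hence s2: "block_size ns i = 2" using blocks.sz_cases by blast
    hence m: "ns (Suc i) = Suc (Suc (ns i))" by (simp add: blocks.ns_Suc_eq)
    have "rb (Suc (Suc (ns i))) = - rho (Suc i)"
      using rb_ns[of "Suc i"] s2 by (simp add: m blocks.carry_def)
    moreover have "rc (Suc (ns i)) = LU_l (Suc i)" using s2 by (simp add: LU_l_def)
    ultimately show ?thesis
      using rec_P[of "Suc (ns i)"] U_row_2(1)[OF s2]
      by (simp del: mult_pCons_left add: Suc T_def[of "Suc i"] quasi_def m)
  qed
qed

text \<open>Multiplication by \<open>\<lambda>\<close> is \<open>J = LU\<close> on the \<open>P n\<close>, hence \<open>UL\<close> on the image under \<open>U\<close>: insert \<open>L_row\<close>
  into the rows of \<open>U\<close>.\<close>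

lemma T_recurrence:
  "T (Suc j) = gen_p j * T j -
     (if j = 0 then 0 else Polynomial.smult (LU_u0 j * LU_l j) (T (j - 1)))"
proof -
  let ?t = "if j = 0 then 0 else Polynomial.smult (LU_l j) (T (j - 1))"
  have L1: "[:0, 1:] * P (ns (Suc j)) = T (Suc j) + Polynomial.smult (LU_l (Suc j)) (T j)"
    using L_row[of "Suc j"] by simp
  have L0: "[:0, 1:] * P (ns j) = T j + ?t" by (rule L_row)
  have t: "(if j = 0 then 0 else Polynomial.smult (LU_u0 j * LU_l j) (T (j - 1))) = Polynomial.smult (LU_u0 j) ?t"
    by simp
  show ?thesis unfolding t
  proof (cases "block_size ns j = 1")
    case True
    have "[:0, 1:] * T j = [:0, 1:] * P (ns (Suc j)) + Polynomial.smult (LU_u0 j) ([:0, 1:] * P (ns j))"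
      by (simp only: U_row_1[OF True] distrib_left mult_smult_right)
    also have "\<dots> = T (Suc j) + Polynomial.smult (LU_l (Suc j)) (T j) + Polynomial.smult (LU_u0 j) (T j + ?t)"
      unfolding L1 L0 ..
    finally have e: "[:0, 1:] * T j = T (Suc j) + Polynomial.smult (LU_l (Suc j)) (T j) + Polynomial.smult (LU_u0 j) (T j + ?t)" .
    have "gen_p j * T j = [:0, 1:] * T j - Polynomial.smult (LU_u0 j + LU_l (Suc j)) (T j)"
      using True by (simp add: gen_p_def smult_add_left smult_diff_left)
    thus "T (Suc j) = gen_p j * T j - Polynomial.smult (LU_u0 j) ?t"
      unfolding e by (simp add: smult_add_left smult_add_right)
  next
    case False
    hence s2: "block_size ns j = 2" using blocks.sz_cases by blast
    have "[:0, 1:] * ([:0, 1:] * T j) = [:0, 1:] * P (ns (Suc j)) +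
        Polynomial.smult (LU_u1 j) ([:0, 1:] * T j) + Polynomial.smult (LU_u0 j) ([:0, 1:] * P (ns j))"
      by (subst U_row_2(2)[OF s2]) (simp only: distrib_left mult_smult_right)
    also have "\<dots> = T (Suc j) + Polynomial.smult (LU_l (Suc j)) (T j)
        + Polynomial.smult (LU_u1 j) ([:0, 1:] * T j) + Polynomial.smult (LU_u0 j) (T j + ?t)"
      unfolding L1 L0 ..
    finally have e: "[:0, 1:] * ([:0, 1:] * T j) = T (Suc j) + Polynomial.smult (LU_l (Suc j)) (T j)
        + Polynomial.smult (LU_u1 j) ([:0, 1:] * T j) + Polynomial.smult (LU_u0 j) (T j + ?t)" .
    have "gen_p j * T j = [:0, 1:] * ([:0, 1:] * T j) - Polynomial.smult (LU_u1 j) ([:0, 1:] * T j)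
        - Polynomial.smult (LU_u0 j + LU_l (Suc j)) (T j)"
      using s2 by (simp add: gen_p_def smult_add_left smult_diff_left)
    thus "T (Suc j) = gen_p j * T j - Polynomial.smult (LU_u0 j) ?t"
      unfolding e by (simp add: smult_add_left smult_add_right)
  qed
qed

text \<open>The first nonvanishing moment of \<open>T j\<close>, and so up to sign the leading coefficient of its Cauchy
  transform at infinity.\<close>

definition h :: "nat \<Rightarrow> real" where
  "h j = LU_u0 j * sqn (ns j)"

lemma h_nonzero [simp]: "h j \<noteq> 0"
  by (simp add: h_def)

lemma h_ratio: "h (Suc j) / h j = LU_u0 (Suc j) * LU_l (Suc j)"
proof -
  have "LU_l (Suc j) * LU_u0 j = sqn (ns (Suc j)) / sqn (ns j)"
    using blocks.sz_cases[of j] rho_nonzero_iff[of j]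
    by (auto simp: LU_l_def LU_u0_def[of j] rc_def blocks.ns_Suc_eq)
  thus ?thesis by (simp add: h_def field_simps)
qed

text \<open>\<open>T j\<close> is orthogonal to all degrees below \<open>ns (j + 1) - 1\<close>: in a block of size 2 it is \<open>P (ns j + 1)\<close>,
  which gains one degree of orthogonality.\<close>

lemma T_moments: "M (T j * [:0, 1:] ^ k) = (if Suc k < ns (Suc j) then 0 else h j)" if "Suc k \<le> ns (Suc j)"
proof -
  have d: "deg_less n ([:0, 1:] ^ k)" if "k < n" for n
    using that by (auto simp: deg_less_iff degree_power_eq)
  have c: "coeff ([:0, 1:] ^ k) k = (1::real)"
    by (simp add: monom_altdef[symmetric, of 1, simplified])
  show ?thesis
  proof (cases "block_size ns j = 1")
    case True
    hence m: "ns (Suc j) = Suc (ns j)" by (simp add: blocks.ns_Suc_eq)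
    have "M (T j * [:0, 1:] ^ k) = LU_u0 j * M (P (ns j) * [:0, 1:] ^ k)"
      using P_orth[OF d, of "ns (Suc j)"] that
      by (simp add: U_row_1[OF True] distrib_right M_add M_smult Suc_le_eq)
    also have "M (P (ns j) * [:0, 1:] ^ k) = (if Suc k < ns (Suc j) then 0 else sqn (ns j))"
    proof (cases "k < ns j")
      case True
      thus ?thesis using P_orth[OF d] by (simp add: m)
    next
      case False
      with that have "k = ns j" by (simp add: m)
      thus ?thesis using P_inner_self[OF d, of "ns j"] c by (simp add: m)
    qed
    finally show ?thesis by (simp add: h_def)
  next
    case False
    hence s2: "block_size ns j = 2" using blocks.sz_cases by blast
    hence m: "ns (Suc j) = Suc (Suc (ns j))" by (simp add: blocks.ns_Suc_eq)
    have hj: "h j = sqn (Suc (ns j))" using s2 by (simp add: h_def LU_u0_def rc_def)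
    show ?thesis
    proof (cases "k < Suc (ns j)")
      case True
      thus ?thesis using P_orth[OF d] by (simp add: m U_row_2(1)[OF s2])
    next
      case False
      with that have "k = Suc (ns j)" by (simp add: m)
      thus ?thesis using P_inner_self[OF d, of "Suc (ns j)"] c by (simp add: m U_row_2(1)[OF s2] hj)
    qed
  qed
qed

section \<open>Cauchy transforms\<close>

definition cauchy :: "real poly \<Rightarrow> complex \<Rightarrow> complex" where
  "cauchy p z = (LINT t|\<sigma>. complex_of_real (poly p t) / (complex_of_real t - z))"

lemma norm_integral_le:
  fixes f :: "real \<Rightarrow> 'a :: {banach, second_countable_topology}"
  assumes "integrable \<sigma> f" "AE t in \<sigma>. norm (f t) \<le> B"
  shows "norm (LINT t|\<sigma>. f t) \<le> B * M 1"
proof -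
  have "norm (LINT t|\<sigma>. f t) \<le> (LINT t|\<sigma>. norm (f t))" by (rule integral_norm_bound)
  also have "\<dots> \<le> (LINT t|\<sigma>. B)" using assms by (intro integral_mono_AE) auto
  finally show ?thesis by (simp add: M_def mult.commute)
qed

lemma poly_bounded_on_unit_interval:
  obtains B where "B \<ge> 0" "\<And>t. t \<in> {-1..1} \<Longrightarrow> \<bar>poly p t\<bar> \<le> (B :: real)"
proof -
  have "bounded (poly p ` {-1..1})"
    by (intro compact_imp_bounded compact_continuous_image continuous_intros) auto
  then obtain B where B: "\<forall>t\<in>{-1..1}. \<bar>poly p t\<bar> \<le> B" by (auto simp: bounded_iff)
  show ?thesis by (rule that[of "max B 0"]) (use B in fastforce)+
qed

lemma cauchy_kernel_bound:
  assumes "cmod z > 1" "\<bar>a\<bar> \<le> B" "t \<in> {-1..1}"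
  shows "cmod (complex_of_real a / (complex_of_real t - z)) \<le> B / (cmod z - 1)"
proof -
  have "cmod (complex_of_real t - z) \<ge> cmod z - \<bar>t\<bar>"
    using norm_triangle_ineq2[of z "complex_of_real t"] by (simp add: norm_minus_commute)
  hence "cmod (complex_of_real t - z) \<ge> cmod z - 1" using assms by auto
  thus ?thesis unfolding norm_divide using assms by (intro frac_le) auto
qed

lemma integrable_cauchy:
  assumes "cmod z > 1"
  shows "integrable \<sigma> (\<lambda>t. complex_of_real (poly p t) / (complex_of_real t - z))"
proof -
  obtain B where B: "B \<ge> 0" "\<And>t. t \<in> {-1..1} \<Longrightarrow> \<bar>poly p t\<bar> \<le> B" by (rule poly_bounded_on_unit_interval[of p]) blast
  show ?thesis
  proof (rule integrable_bounded)
    show "(\<lambda>t. complex_of_real (poly p t) / (complex_of_real t - z)) \<in> borel_measurable borel"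
      by (intro borel_measurable_divide borel_measurable_continuous_onI continuous_intros)
  qed (rule cauchy_kernel_bound[OF assms B(2)])
qed

text \<open>From \<open>t = z + (t - z)\<close>.\<close>

lemma cauchy_X_mult:
  assumes "cmod z > 1"
  shows "cauchy ([:0, 1:] * p) z = z * cauchy p z + complex_of_real (M p)"
proof -
  have int: "integrable \<sigma> (\<lambda>t. complex_of_real (poly p t))"
    by (rule integrable_continuous) (intro continuous_intros)
  have "cauchy ([:0, 1:] * p) z =
      (LINT t|\<sigma>. z * (complex_of_real (poly p t) / (complex_of_real t - z)) + complex_of_real (poly p t))"
    unfolding cauchy_def
  proof (rule Bochner_Integration.integral_cong_AE)
    show "AE t in \<sigma>. complex_of_real (poly ([:0, 1:] * p) t) / (complex_of_real t - z) =
        z * (complex_of_real (poly p t) / (complex_of_real t - z)) + complex_of_real (poly p t)"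
      using AE_unit_interval
    proof eventually_elim
      case (elim t)
      have "cmod (complex_of_real t) \<le> 1" using elim by auto
      hence ne: "complex_of_real t - z \<noteq> 0" using assms by auto
      thus ?case by (simp add: field_simps)
    qed
  qed (intro borel_measurable_integrable integrable_cauchy assms Bochner_Integration.integrable_add
      integrable_mult_right int)+
  also have "\<dots> = z * cauchy p z + complex_of_real (M p)"
    unfolding cauchy_def M_def
    by (subst Bochner_Integration.integral_add) (simp_all only: integral_complex_of_real
        integral_mult_right_zero integrable_mult_right integrable_cauchy[OF assms] int)
  finally show ?thesis .
qed

lemma cauchy_partial_expansion:
  assumes "cmod z > 1"
  shows "cauchy p z + (\<Sum>i<N. complex_of_real (M (p * [:0, 1:] ^ i)) / z ^ (i + 1)) =
    cauchy (p * [:0, 1:] ^ N) z / z ^ N"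
proof (induction N)
  case (Suc N)
  have "p * [:0, 1:] ^ Suc N = [:0, 1:] * (p * [:0, 1:] ^ N)" by simp
  hence "cauchy (p * [:0, 1:] ^ Suc N) z =
      z * cauchy (p * [:0, 1:] ^ N) z + complex_of_real (M (p * [:0, 1:] ^ N))"
    using cauchy_X_mult[OF assms, of "p * [:0, 1:] ^ N"] by metis
  moreover have "z \<noteq> 0" using assms by auto
  ultimately show ?case
    unfolding sum.lessThan_Suc add.assoc[symmetric] Suc by (simp add: add_divide_distrib)
qed simp

lemma cauchy_power_bound:
  assumes z: "cmod z > 1" and B: "\<And>t. t \<in> {-1..1} \<Longrightarrow> \<bar>poly p t\<bar> \<le> B"
  shows "cmod (cauchy (p * [:0, 1:] ^ N) z) \<le> B / (cmod z - 1) * M 1"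
proof -
  have bd: "\<bar>poly (p * [:0, 1:] ^ N) t\<bar> \<le> B" if "t \<in> {-1..1}" for t
  proof -
    have "\<bar>t\<bar> ^ N \<le> 1" using that by (intro power_le_one) auto
    thus ?thesis using mult_mono[of "\<bar>poly p t\<bar>" B "\<bar>t\<bar> ^ N" 1] B[OF that]
      by (simp add: abs_mult power_abs)
  qed
  have "AE t in \<sigma>. cmod (complex_of_real (poly (p * [:0, 1:] ^ N) t) / (complex_of_real t - z)) \<le> B / (cmod z - 1)"
    using AE_unit_interval by eventually_elim (rule cauchy_kernel_bound[OF z bd])
  thus ?thesis unfolding cauchy_def by (intro norm_integral_le integrable_cauchy z)
qed

text \<open>The remainder in \<open>cauchy_partial_expansion\<close> tends to \<open>0\<close> for \<open>\<bar>z\<bar> > 1\<close>, since multiplication by \<open>t\<close> does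
  not enlarge a function on the unit interval.\<close>

lemma cauchy_expansion:
  "real_laurent (cauchy p) (fps_to_fls (Abs_fps (\<lambda>k. if k = 0 then 0 else - complex_of_real (M (p * [:0, 1:] ^ (k - 1))))))"
  unfolding real_laurent_def
proof
  let ?F = "Abs_fps (\<lambda>k. if k = 0 then 0 else - complex_of_real (M (p * [:0, 1:] ^ (k - 1))))"
  define f where "f y = (if y = 0 then 0 else cauchy p (1 / y))" for y
  obtain B where B: "B \<ge> 0" "\<And>t. t \<in> {-1..1} \<Longrightarrow> \<bar>poly p t\<bar> \<le> B" by (rule poly_bounded_on_unit_interval[of p]) blast
  have sums: "(\<lambda>n. fps_nth ?F n * y ^ n) sums f y" if y: "cmod y < 1" for y
  proof (cases "y = 0")
    case True
    have "(\<lambda>n. fps_nth ?F n * y ^ n) = (\<lambda>n. 0)" using True by (auto simp: fun_eq_iff power_0_left)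
    thus ?thesis using True by (simp add: f_def)
  next
    case False
    define z where "z = 1 / y"
    have z: "cmod z > 1" using False y by (simp add: z_def norm_divide)
    have part: "(\<Sum>n<Suc N. fps_nth ?F n * y ^ n) = cauchy p z - y ^ N * cauchy (p * [:0, 1:] ^ N) z" for N
    proof -
      have "(\<Sum>n<Suc N. fps_nth ?F n * y ^ n) = - (\<Sum>i<N. complex_of_real (M (p * [:0, 1:] ^ i)) / z ^ (i + 1))"
        unfolding sum.lessThan_Suc_shift by (simp add: z_def power_one_over sum_negf)
      thus ?thesis using cauchy_partial_expansion[OF z, of p N]
        by (simp add: z_def power_one_over algebra_simps)
    qed
    have bnd: "cmod (y ^ N * cauchy (p * [:0, 1:] ^ N) z) \<le> cmod y ^ N * (B / (cmod z - 1) * M 1)" for N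
      unfolding norm_mult norm_power by (rule mult_left_mono[OF cauchy_power_bound[OF z B(2)] zero_le_power[OF norm_ge_zero]])
    have "(\<lambda>N. y ^ N * cauchy (p * [:0, 1:] ^ N) z) \<longlonglongrightarrow> 0"
    proof (rule Lim_null_comparison)
      show "\<forall>\<^sub>F N in sequentially. cmod (y ^ N * cauchy (p * [:0, 1:] ^ N) z) \<le>
          cmod y ^ N * (B / (cmod z - 1) * M 1)" using bnd by simp
      show "(\<lambda>N. cmod y ^ N * (B / (cmod z - 1) * M 1)) \<longlonglongrightarrow> 0"
        using y by (intro tendsto_mult_left_zero LIMSEQ_power_zero) auto
    qed
    hence "(\<lambda>N. \<Sum>n<Suc N. fps_nth ?F n * y ^ n) \<longlonglongrightarrow> cauchy p z - 0"
      unfolding part by (intro tendsto_diff tendsto_const)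
    hence "(\<lambda>N. \<Sum>n<N. fps_nth ?F n * y ^ n) \<longlonglongrightarrow> f y"
      using False by (simp only: filterlim_sequentially_Suc[of "\<lambda>N. \<Sum>n<N. fps_nth ?F n * y ^ n"]) (simp add: f_def z_def)
    thus ?thesis by (simp add: sums_def)
  qed
  have "f has_fps_expansion ?F"
  proof (rule has_fps_expansionI)
    show "\<forall>\<^sub>F u in nhds 0. (\<lambda>n. fps_nth ?F n * u ^ n) sums f u"
    proof (rule eventually_mono[OF eventually_nhds_in_open[of "ball 0 1" "0::complex"]])
      fix u :: complex assume "u \<in> ball 0 1"
      thus "(\<lambda>n. fps_nth ?F n * u ^ n) sums f u" by (intro sums) simp
    qed auto
  qed
  hence "f has_laurent_expansion fps_to_fls ?F" by (rule has_laurent_expansion_fps)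
  moreover have ev: "\<forall>\<^sub>F y in at 0. f y = cauchy p (1 / y)"
    by (rule eventually_mono[OF eventually_neq_at_within[of 0]]) (simp add: f_def)
  ultimately show "(\<lambda>y. cauchy p (1 / y)) has_laurent_expansion fps_to_fls ?F"
    using has_laurent_expansion_cong[OF ev refl] by simp
  show "\<forall>\<^sub>F x in at_top. cauchy p (complex_of_real x) \<in> \<real>"
  proof (intro always_eventually allI)
    fix x
    have "cauchy p (complex_of_real x) = (LINT t|\<sigma>. complex_of_real (poly p t / (t - x)))"
      unfolding cauchy_def by simp
    also have "\<dots> = complex_of_real (LINT t|\<sigma>. poly p t / (t - x))"
      by (rule integral_complex_of_real)
    finally show "cauchy p (complex_of_real x) \<in> \<real>" by simp
  qed
qed

lemma cauchy_add: "cmod z > 1 \<Longrightarrow> cauchy (p + q) z = cauchy p z + cauchy q z"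
  unfolding cauchy_def
  using integrable_cauchy[of z p] integrable_cauchy[of z q]
  by (simp add: add_divide_distrib)

lemma cauchy_smult: "cauchy (Polynomial.smult a p) z = complex_of_real a * cauchy p z"
  unfolding cauchy_def by (simp flip: times_divide_eq_right)

section \<open>The UL factorization of the generalized Jacobi matrix\<close>

lemma T_0: "T 0 = [:0, 1:]"
  using L_row[of 0] by simp

text \<open>The data of the locale \<open>continued_fraction\<close> for the function \<open>cauchy [:0, 1:]\<close>, which is \<open>\<FF>\<close>.\<close>

definition second_kind :: "nat \<Rightarrow> complex \<Rightarrow> complex" where
  "second_kind j = (case j of 0 \<Rightarrow> (\<lambda>_. - 1) | Suc i \<Rightarrow> cauchy (T i))"

lemma second_kind_Suc: "second_kind (Suc j) = cauchy (T j)"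
  by (simp add: second_kind_def)

definition second_kind_series :: "nat \<Rightarrow> complex fls" where
  "second_kind_series j = (case j of 0 \<Rightarrow> fls_const (- 1) | Suc i \<Rightarrow>
     fps_to_fls (Abs_fps (\<lambda>k. if k = 0 then 0 else - complex_of_real (M (T i * [:0, 1:] ^ (k - 1))))))"

definition second_kind_lead :: "nat \<Rightarrow> real" where
  "second_kind_lead j = (case j of 0 \<Rightarrow> 1 | Suc i \<Rightarrow> h i)"

text \<open>The Cauchy transform turns multiplication of \<open>T j\<close> by \<open>gen_p j\<close> into multiplication by its value at
  \<open>z\<close>, up to moments of \<open>T j\<close>. They vanish except for \<open>j = 0\<close>, where they supply the term with
  \<open>second_kind 0 = - 1\<close>.\<close>

lemma cauchy_T_recurrence:
  assumes z: "cmod z > 1"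
  shows "cauchy (T (Suc j)) z = poly (cpoly (gen_p j)) z * cauchy (T j) z
    - complex_of_real (second_kind_lead (Suc j) / second_kind_lead j) * second_kind j z"
proof -
  have gp: "cauchy (gen_p j * T j) z = poly (cpoly (gen_p j)) z * cauchy (T j) z + (if j = 0 then complex_of_real (h 0) else 0)"
  proof (cases "block_size ns j = 1")
    case True
    have m: "ns (Suc j) = Suc (ns j)" using True by (simp add: blocks.ns_Suc_eq)
    have "0 < ns j \<longleftrightarrow> j \<noteq> 0" using blocks.ns_eq_iff[of j 0] by (auto simp del: blocks.ns_eq_iff)
    hence "M (T j) = (if j = 0 then h 0 else 0)" using T_moments[of 0 j] by (simp add: m)
    moreover have "gen_p j * T j = Polynomial.smult (coeff (gen_p j) 0) (T j) + [:0, 1:] * T j"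
      using True by (simp add: gen_p_def)
    ultimately show ?thesis using True
      by (simp only: cauchy_add[OF z] cauchy_smult cauchy_X_mult[OF z])
        (simp add: gen_p_def map_poly_pCons algebra_simps)
  next
    case False
    hence s2: "block_size ns j = 2" using blocks.sz_cases by blast
    have m: "ns (Suc j) = Suc (Suc (ns j))" using s2 by (simp add: blocks.ns_Suc_eq)
    have j0: "0 < ns j \<longleftrightarrow> j \<noteq> 0" using blocks.ns_eq_iff[of j 0] by (auto simp del: blocks.ns_eq_iff)
    have "M (T j) = 0" using T_moments[of 0 j] by (simp add: m)
    moreover have "M ([:0, 1:] * T j) = (if j = 0 then h 0 else 0)"
      using T_moments[of 1 j] j0 by (simp add: m mult.commute del: mult_pCons_left mult_pCons_right)
    moreover have "gen_p j * T j = Polynomial.smult (coeff (gen_p j) 0) (T j) +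
        (Polynomial.smult (coeff (gen_p j) 1) ([:0, 1:] * T j) + [:0, 1:] * ([:0, 1:] * T j))"
      using s2 by (simp add: gen_p_def)
    ultimately show ?thesis using s2
      by (simp only: cauchy_add[OF z] cauchy_smult cauchy_X_mult[OF z])
        (simp add: gen_p_def map_poly_pCons algebra_simps)
  qed
  show ?thesis
  proof (cases j)
    case 0
    show ?thesis using gp T_recurrence[of 0] by (simp add: 0 second_kind_def second_kind_lead_def)
  next
    case (Suc i)
    have "T (Suc j) = gen_p j * T j + Polynomial.smult (- (LU_u0 j * LU_l j)) (T i)"
      using T_recurrence[of j] by (simp add: Suc)
    hence "cauchy (T (Suc j)) z = cauchy (gen_p j * T j) z + complex_of_real (- (LU_u0 j * LU_l j)) * cauchy (T i) z"
      by (simp only: cauchy_add[OF z] cauchy_smult)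
    moreover have "second_kind_lead (Suc j) / second_kind_lead j = LU_u0 j * LU_l j" using h_ratio[of i] by (simp add: second_kind_lead_def Suc)
    ultimately show ?thesis using gp by (simp add: Suc second_kind_def)
  qed
qed

sublocale cf: continued_fraction second_kind second_kind_series second_kind_lead ns gen_p
proof
  show "real_laurent (second_kind j) (second_kind_series j)" for j
  proof (cases j)
    case 0
    have "(\<lambda>_. - 1 :: complex) has_laurent_expansion fls_const (- 1)" by (rule has_laurent_expansion_const)
    thus ?thesis by (simp add: 0 second_kind_def second_kind_series_def real_laurent_def)
  qed (use cauchy_expansion in \<open>auto simp: second_kind_def second_kind_series_def\<close>)
  show "fls_nth (second_kind_series j) k = 0" if "k < int (ns j)" for k j
  proof (cases j)
    case 0
    thus ?thesis using that by (simp add: second_kind_series_def fls_const_nth)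
  next
    case (Suc i)
    show ?thesis
    proof (cases "k \<le> 0")
      case False
      hence "M (T i * [:0, 1:] ^ (nat k - 1)) = 0"
        using that Suc by (subst T_moments) auto
      thus ?thesis using False by (simp add: second_kind_series_def Suc)
    qed (auto simp: second_kind_series_def Suc)
  qed
  show "fls_nth (second_kind_series j) (int (ns j)) = - complex_of_real (second_kind_lead j)" for j
  proof (cases j)
    case (Suc i)
    have "0 < ns j" using blocks.ns_eq_iff[of j 0] Suc by (simp del: blocks.ns_eq_iff)
    thus ?thesis using T_moments[of "ns j - 1" i] by (simp add: second_kind_series_def second_kind_lead_def Suc)
  qed (simp add: second_kind_series_def second_kind_lead_def fls_const_nth)
  show "second_kind_lead j \<noteq> 0" for j by (cases j) (auto simp: second_kind_lead_def)
  show "second_kind 0 = (\<lambda>_. - 1)" "second_kind_lead 0 = 1" by (auto simp: second_kind_def second_kind_lead_def)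
  show "ns j < ns (Suc j)" for j by (simp add: ns_Suc')
  show "lead_coeff (gen_p j) = 1" for j by (simp add: gen_p_def)
  show "\<forall>\<^sub>F z in at_infinity. second_kind (Suc (Suc j)) z =
      poly (map_poly complex_of_real (gen_p j)) z * second_kind (Suc j) z - complex_of_real (second_kind_lead (Suc j) / second_kind_lead j) * second_kind j z" for j
  proof -
    have "\<forall>\<^sub>F z::complex in at_infinity. cmod z > 1"
      by (simp add: eventually_at_infinity) (metis gt_ex less_le_trans)
    thus ?thesis
      by eventually_elim (simp only: second_kind_Suc cauchy_T_recurrence)
  qed
qed

lemma asymp_coeffs_cauchy: "asymp_coeffs (cauchy [:0, 1:]) = (\<lambda>j. M ([:0, 1:] ^ (j + 1)))"
  by (subst asymp_coeffs_real_laurent[OF cauchy_expansion]) (auto simp: nat_add_distrib)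

lemma monic_gen_jacobi_UL:
  "monic_gen_jacobi (cauchy [:0, 1:]) = inf_matrix_mult (U_matrix ns LU_u0 LU_u1) (L_matrix ns LU_l)"
proof -
  have R1: "second_kind (Suc 0) = cauchy [:0, 1:]" by (simp add: second_kind_def T_0)
  show ?thesis
    unfolding monic_gen_jacobi_def Let_def asymp_coeffs_cauchy ns_def[symmetric]
  proof (rule blocks.block_tridiagonal_UL)
    fix j
    show "- coeff (gjac_p (cauchy [:0, 1:]) j) 0 = LU_u0 j + LU_l (Suc j)"
      unfolding R1[symmetric] cf.gjac_p_eq by (simp add: gen_p_def)
    show "- coeff (gjac_p (cauchy [:0, 1:]) j) 1 = LU_u1 j" if "block_size ns j = 2"
      unfolding R1[symmetric] cf.gjac_p_eq using that by (simp add: gen_p_def)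
    show "gjac_c (cauchy [:0, 1:]) j = LU_u0 (Suc j) * LU_l (Suc j)"
      unfolding R1[symmetric] cf.gjac_c_eq using h_ratio[of j] by (simp add: second_kind_lead_def)
  qed
qed

text \<open>The corner prescribed for the \<open>UL\<close> factorization is the one of the \<open>LU\<close> factorization.\<close>

lemma LU_u0_start: "M ([:0, 1:] ^ (ns 1 - 1 + 1)) / M 1 = LU_u0 0"
proof -
  have "M ([:0, 1:] ^ (ns 1 - 1 + 1)) = M (T 0 * [:0, 1:] ^ (ns 1 - 1))"
    by (simp add: T_0)
  also have "\<dots> = h 0" using T_moments[of "ns 1 - 1" 0] cf.ns_less[of 0] by simp
  also have "\<dots> = LU_u0 0 * M 1" by (simp add: h_def sqn_def)
  finally show ?thesis using sqn_nz[of 0] by (simp add: sqn_def)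
qed

lemma UL_bounded_iff:
  "(\<exists>U L. block_UL ns (monic_gen_jacobi (cauchy [:0, 1:])) U L (M ([:0, 1:] ^ (ns 1 - 1 + 1)) / M 1) \<and> bounded_in_ell2 U)
     \<longleftrightarrow> bounded_in_ell2 (U_matrix ns LU_u0 LU_u1)"
  unfolding LU_u0_start monic_gen_jacobi_UL block_UL_def
  using blocks.UL_unique[of _ _ _ LU_u0 LU_u1 LU_l] LU_l_nonzero by metis

lemma LU_bounded_iff:
  "(\<exists>L U. block_LU ns (monic_jacobi \<sigma>) L U \<and> bounded_in_ell2 U)
     \<longleftrightarrow> bounded_in_ell2 (U_matrix ns LU_u0 LU_u1)"
  unfolding monic_jacobi_LU block_LU_def
  using blocks.LU_unique[of _ _ _ LU_l LU_u0 LU_u1] LU_u0_nonzero by metis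

lemma U_bounded_iff_rho: "bounded_in_ell2 (U_matrix ns LU_u0 LU_u1) \<longleftrightarrow> (\<exists>C. \<forall>j. \<bar>rho j\<bar> \<le> C)"
proof -
  have "bounded_in_ell2 (U_matrix ns LU_u0 LU_u1) \<longleftrightarrow> (\<exists>C. \<forall>j. \<bar>LU_u0 j\<bar> \<le> C)"
    by (rule blocks.U_matrix_bounded_iff[of _ 1]) (simp add: LU_u1_def rb_bound)
  also have "\<dots> \<longleftrightarrow> (\<exists>C. \<forall>j. \<bar>rho j\<bar> \<le> C)"
  proof
    assume "\<exists>C. \<forall>j. \<bar>LU_u0 j\<bar> \<le> C"
    then obtain C where C: "\<And>j. \<bar>LU_u0 j\<bar> \<le> C" by blast
    have "\<bar>rho j\<bar> \<le> max C 0" for j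
      using C[of j] rho_nonzero_iff[of j] by (cases "block_size ns j = 1") (auto simp: LU_u0_def)
    thus "\<exists>C. \<forall>j. \<bar>rho j\<bar> \<le> C" by blast
  next
    assume "\<exists>C. \<forall>j. \<bar>rho j\<bar> \<le> C"
    then obtain C where C: "\<And>j. \<bar>rho j\<bar> \<le> C" by blast
    have "\<bar>rc n\<bar> \<le> 1" for n using rc_le_1[of n] rc_pos[of n] by linarith
    hence "\<bar>LU_u0 j\<bar> \<le> max C 1" for j
      using C[of j] by (auto simp: LU_u0_def le_max_iff_disj)
    thus "\<exists>C. \<forall>j. \<bar>LU_u0 j\<bar> \<le> C" by blast
  qed
  finally show ?thesis .
qed

end

section \<open>The Riemann sphere\<close>

lemma stereo_Some:
  "stereo (Some w) = (2 * w / complex_of_real (1 + (cmod w)\<^sup>2), 1 - 2 / (1 + (cmod w)\<^sup>2))"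
proof -
  have "(x - 1) / (x + 1) = 1 - 2 / (1 + x)" if "x \<ge> 0" for x :: real
    using that by (simp add: divide_simps)
  thus ?thesis by (simp add: stereo_def)
qed

lemma stereo_None: "stereo None = (0, 1)"
  by (simp add: stereo_def)

lemma one_plus_cmod_sq_pos: "1 + (cmod w)\<^sup>2 > 0"
  by (simp add: add_pos_nonneg)

text \<open>The square of the chordal distance is \<open>4 \<bar>a - b\<bar>\<^sup>2 / ((1 + \<bar>a\<bar>\<^sup>2) (1 + \<bar>b\<bar>\<^sup>2))\<close>.\<close>

lemma dist_stereo_Some:
  "dist (stereo (Some a)) (stereo (Some b)) \<le> 2 * dist a b"
proof -
  obtain a1 a2 b1 b2 where a: "a = Complex a1 a2" and b: "b = Complex b1 b2"
    by (metis complex.exhaust)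
  define A where "A = 1 + a1\<^sup>2 + a2\<^sup>2"
  define B where "B = 1 + b1\<^sup>2 + b2\<^sup>2"
  define p where "p = 1 / A"
  define q where "q = 1 / B"
  have AB: "A \<ge> 1" "B \<ge> 1" by (auto simp: A_def B_def)
  have pq: "A * p = 1" "B * q = 1" "p > 0" "q > 0" "p \<le> 1" "q \<le> 1" using AB by (auto simp: p_def q_def)
  have sa: "stereo (Some a) = (2 * complex_of_real p * a, 1 - 2 * p)"
    unfolding stereo_Some p_def A_def by (simp add: a cmod_power2 add.assoc)
  have sb: "stereo (Some b) = (2 * complex_of_real q * b, 1 - 2 * q)"
    unfolding stereo_Some q_def B_def by (simp add: b cmod_power2 add.assoc)
  have d: "(dist a b)\<^sup>2 = (a1 - b1)\<^sup>2 + (a2 - b2)\<^sup>2"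
    by (simp add: dist_norm a b cmod_power2)
  have "(dist (stereo (Some a)) (stereo (Some b)))\<^sup>2 =
      (2 * p * a1 - 2 * q * b1)\<^sup>2 + (2 * p * a2 - 2 * q * b2)\<^sup>2 + (2 * q - 2 * p)\<^sup>2"
    unfolding sa sb dist_Pair_Pair
    by (simp add: dist_norm cmod_power2 a b power2_commute)
  also have "\<dots> = 4 * (p * (A * p) + q * (B * q) - 2 * (p * q) * (1 + a1 * b1 + a2 * b2))"
    unfolding A_def B_def by (simp add: power2_eq_square algebra_simps)
  also have "\<dots> = 4 * (p * (B * q) + q * (A * p) - 2 * (p * q) * (1 + a1 * b1 + a2 * b2))"
    unfolding pq(1,2) by simp
  also have "\<dots> = 4 * ((p * q) * (dist a b)\<^sup>2)"
    unfolding d A_def B_def by (simp add: power2_eq_square algebra_simps)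
  also have "\<dots> \<le> 4 * (1 * (dist a b)\<^sup>2)"
    using pq mult_mono[of p 1 q 1] by (intro mult_left_mono mult_right_mono) auto
  also have "\<dots> = (2 * dist a b)\<^sup>2" by (simp add: power_mult_distrib)
  finally show ?thesis by (rule power2_le_imp_le) simp
qed

lemma stereo_near_infinity:
  assumes "dist (stereo (Some w)) (stereo None) < 2 / (1 + k\<^sup>2)" "k \<ge> 0"
  shows "cmod w > k"
proof -
  have "\<bar>1 - 2 / (1 + (cmod w)\<^sup>2) - 1\<bar> \<le> dist (stereo (Some w)) (stereo None)"
    using dist_snd_le[of "stereo (Some w)" "stereo None"] by (simp add: stereo_Some stereo_None dist_real_def)
  moreover have "\<bar>1 - 2 / (1 + (cmod w)\<^sup>2) - 1\<bar> = 2 / (1 + (cmod w)\<^sup>2)"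
    using one_plus_cmod_sq_pos[of w] by simp
  ultimately have "2 / (1 + (cmod w)\<^sup>2) < 2 / (1 + k\<^sup>2)" using assms by linarith
  hence "k\<^sup>2 < (cmod w)\<^sup>2" by (simp add: divide_simps add_pos_nonneg split: if_splits)
  thus ?thesis by (rule power_less_imp_less_base) simp
qed

lemma dist_stereo_infinity:
  "dist (stereo (Some w)) (stereo None) = 2 / sqrt (1 + (cmod w)\<^sup>2)"
proof -
  define p where "p = 1 / (1 + (cmod w)\<^sup>2)"
  have p: "p > 0" "p * (1 + (cmod w)\<^sup>2) = 1" using one_plus_cmod_sq_pos[of w] by (auto simp: p_def)
  have sa: "stereo (Some w) = (2 * complex_of_real p * w, 1 - 2 * p)"
    unfolding stereo_Some p_def by simp
  have "(dist (stereo (Some w)) (stereo None))\<^sup>2 = 4 * p * (p * (1 + (cmod w)\<^sup>2))"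
    unfolding sa stereo_None dist_Pair_Pair
    by (simp add: dist_norm norm_mult power_mult_distrib power2_eq_square algebra_simps)
  also have "\<dots> = (2 / sqrt (1 + (cmod w)\<^sup>2))\<^sup>2"
    unfolding p(2) using one_plus_cmod_sq_pos[of w] by (simp add: p_def power_divide)
  finally show ?thesis
    by (rule power2_eq_imp_eq) simp_all
qed

text \<open>Stereographic projection inverts \<open>stereo\<close> continuously away from the north pole.\<close>

lemma stereo_near_finite:
  assumes "d > 0"
  obtains r where "r > 0" "\<And>w. dist (stereo w) (stereo (Some z)) < r \<Longrightarrow> \<exists>w'. w = Some w' \<and> dist w' z < d"
proof -
  define \<phi> where "\<phi> q = fst q / complex_of_real (1 - snd q)" for q :: "complex \<times> real"
  have A: "1 + (cmod w)\<^sup>2 \<noteq> 0" for w using one_plus_cmod_sq_pos[of w] by (rule less_imp_neq[THEN not_sym])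
  have inv: "\<phi> (stereo (Some w)) = w" for w
    unfolding \<phi>_def stereo_Some using A[of w] by (simp add: field_simps del: of_real_add)
  have ne: "snd (stereo (Some z)) < 1"
    unfolding stereo_Some using add_pos_nonneg[of 1 "(cmod z)\<^sup>2"] by simp
  have "continuous (at (stereo (Some z))) \<phi>"
    unfolding \<phi>_def using ne by (intro continuous_intros) auto
  then obtain r1 where r1: "r1 > 0" "\<And>q. dist q (stereo (Some z)) < r1 \<Longrightarrow> dist (\<phi> q) (\<phi> (stereo (Some z))) < d"
    using assms unfolding continuous_at_eps_delta by blast
  define r where "r = min r1 (1 - snd (stereo (Some z)))"
  show ?thesis
  proof (rule that[of r])
    show "r > 0" using r1 ne by (simp add: r_def)
    fix w assume w: "dist (stereo w) (stereo (Some z)) < r"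
    show "\<exists>w'. w = Some w' \<and> dist w' z < d"
    proof (cases w)
      case None
      have "1 - snd (stereo (Some z)) \<le> dist (stereo w) (stereo (Some z))"
        using dist_snd_le[of "stereo w" "stereo (Some z)"] ne by (simp add: None dist_real_def stereo_def[of None])
      with w show ?thesis by (simp add: r_def)
    next
      case (Some w')
      thus ?thesis using r1(2)[of "stereo w"] w by (simp add: r_def inv)
    qed
  qed
qed

text \<open>Pointwise convergence on a finite net is uniform, and the common Lipschitz constant carries it over
  to the whole set.\<close>

lemma equi_lipschitz_pointwise_imp_uniform_limit:
  fixes f :: "nat \<Rightarrow> 'a :: metric_space \<Rightarrow> 'b :: metric_space"
  assumes "compact S" and lip: "\<And>n x y. x \<in> S \<Longrightarrow> y \<in> S \<Longrightarrow> dist (f n x) (f n y) \<le> L * dist x y"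
    and glip: "\<And>x y. x \<in> S \<Longrightarrow> y \<in> S \<Longrightarrow> dist (g x) (g y) \<le> L * dist x y"
    and lim: "\<And>x. x \<in> S \<Longrightarrow> (\<lambda>n. f n x) \<longlonglongrightarrow> g x" and "L > 0"
  shows "uniform_limit S f g sequentially"
proof (rule uniform_limitI)
  fix e :: real assume e: "e > 0"
  define d where "d = e / (3 * L)"
  have d: "d > 0" "L * d = e / 3" using e \<open>L > 0\<close> by (auto simp: d_def)
  obtain k where k: "finite k" "k \<subseteq> S" "S \<subseteq> (\<Union>x\<in>k. ball x d)"
    using d(1) by (rule_tac compactE_image[OF \<open>compact S\<close>, of S "\<lambda>x. ball x d"]) auto
  have "\<forall>\<^sub>F n in sequentially. dist (f n x) (g x) < e / 3" if "x \<in> k" for x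
    by (rule tendstoD[OF lim]) (use that k(2) e in auto)
  hence "\<forall>\<^sub>F n in sequentially. \<forall>x\<in>k. dist (f n x) (g x) < e / 3"
    using k(1) by (intro eventually_ball_finite ballI)
  thus "\<forall>\<^sub>F n in sequentially. \<forall>x\<in>S. dist (f n x) (g x) < e"
  proof eventually_elim
    case (elim n)
    show ?case
    proof
      fix x assume x: "x \<in> S"
      with k(3) obtain y where y: "y \<in> k" "dist y x < d" by (auto simp: ball_def)
      have yS: "y \<in> S" using y(1) k(2) by blast
      have "L * dist y x < L * d" using y(2) \<open>L > 0\<close> by (rule mult_strict_left_mono)
      hence "L * dist y x < e / 3" unfolding d(2) .
      moreover have "dist (f n x) (f n y) \<le> L * dist y x"
        using lip[OF x yS] by (simp add: dist_commute)
      moreover have "dist (g y) (g x) \<le> L * dist y x" by (rule glip[OF yS x])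
      moreover have "dist (f n y) (g y) < e / 3" using elim y(1) by blast
      moreover have "dist (f n x) (g x) \<le> dist (f n x) (f n y) + (dist (f n y) (g y) + dist (g y) (g x))"
        using dist_triangle[of "f n x" "g x" "f n y"] dist_triangle[of "f n y" "g x" "g y"] by linarith
      ultimately show "dist (f n x) (g x) < e" by linarith
    qed
  qed
qed

section \<open>Pade approximants and partial fractions\<close>

text \<open>A nonzero polynomial vanishes at \<open>0\<close> to an order at most its degree.\<close>

lemma poly_bigo_imp_zero:
  fixes D :: "complex poly"
  assumes "degree D \<le> N" "poly D \<in> O[at 0](\<lambda>y. y ^ (N + 1))"
  shows "D = 0"
proof (rule ccontr)
  assume D0: "D \<noteq> 0"
  define k where "k = order 0 D"
  from order_decomp[OF D0, of 0] obtain E where E: "D = [:- 0, 1:] ^ k * E" "\<not> [:- 0, 1:] dvd E"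
    unfolding k_def by blast
  have E0: "poly E 0 \<noteq> 0" using E(2) by (simp add: poly_eq_0_iff_dvd)
  have kN: "k \<le> N" using order_degree[OF D0, of 0] assms(1) by (simp add: k_def)
  obtain C where C: "\<forall>\<^sub>F y in at 0. cmod (poly D y) \<le> C * cmod (y ^ (N + 1))" "C > 0"
    using landau_o.bigE[OF assms(2)] by blast
  have "\<forall>\<^sub>F y in at 0. cmod (poly E y) \<le> C * cmod (y ^ (N + 1 - k))"
    using C(1) eventually_neq_at_within[of 0]
  proof eventually_elim
    case (elim y)
    have "y ^ (N + 1) = y ^ k * y ^ (N + 1 - k)" using kN by (simp flip: power_add)
    hence "cmod y ^ k * cmod (poly E y) \<le> cmod y ^ k * (C * cmod (y ^ (N + 1 - k)))"
      using elim(1) by (simp add: E(1) norm_mult norm_power mult_ac)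
    thus ?case using elim(2) by (simp add: mult_le_cancel_left_pos)
  qed
  moreover have "((\<lambda>y. C * cmod (y ^ (N + 1 - k))) \<longlongrightarrow> 0) (at 0)"
    using kN by (auto intro!: tendsto_eq_intros simp: power_0_left)
  moreover have "((\<lambda>y. cmod (poly E y)) \<longlongrightarrow> cmod (poly E 0)) (at 0)"
    using poly_isCont[of 0 E] unfolding isCont_def by (intro tendsto_norm)
  ultimately have "cmod (poly E 0) \<le> 0" by (intro tendsto_le[of "at 0"]) auto
  with E0 show False by simp
qed

lemma sphere_ratio_smult:
  assumes "c \<noteq> 0"
  shows "sphere_ratio (Polynomial.smult c A) (Polynomial.smult c B) = sphere_ratio A B"
proof
  fix z
  have "(\<Sum>i\<le>N. c * coeff C i * w ^ (N - i)) = c * (\<Sum>i\<le>N. coeff C i * w ^ (N - i))" for N C w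
    by (simp add: sum_distrib_left mult.assoc)
  thus "sphere_ratio (Polynomial.smult c A) (Polynomial.smult c B) z = sphere_ratio A B z"
    using assms by (cases z) (auto simp: sphere_ratio_def Let_def)
qed

text \<open>For two approximants \<open>A / B\<close> and \<open>A' / B'\<close> the polynomial \<open>A B' - A' B\<close> has degree at most \<open>L + M\<close> but
  vanishes to a higher order, so the fractions agree; being in lowest terms they are proportional.\<close>

lemma pade_approximant_unique:
  assumes "pade_approximant s L M R" "pade_approximant s L M R'"
  shows "R = R'"
proof -
  from assms(1) obtain A B where AB: "degree A \<le> L" "degree B \<le> M" "poly B 0 \<noteq> 0" "coprime A B"
    "(\<lambda>z. (\<Sum>j<L + M. complex_of_real (s j) / z ^ (j + 1)) + poly A (1 / z) / poly B (1 / z))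
        \<in> O[at_infinity](\<lambda>z. 1 / z ^ (L + M + 1))" "R = sphere_ratio A B"
    unfolding pade_approximant_def by blast
  from assms(2) obtain A' B' where AB': "degree A' \<le> L" "degree B' \<le> M" "poly B' 0 \<noteq> 0" "coprime A' B'"
    "(\<lambda>z. (\<Sum>j<L + M. complex_of_real (s j) / z ^ (j + 1)) + poly A' (1 / z) / poly B' (1 / z))
        \<in> O[at_infinity](\<lambda>z. 1 / z ^ (L + M + 1))" "R' = sphere_ratio A' B'"
    unfolding pade_approximant_def by blast
  have nz: "\<forall>\<^sub>F y in at 0. poly C y \<noteq> 0" if "poly C 0 \<noteq> 0" for C :: "complex poly"
    using poly_isCont[of 0 C] that unfolding isCont_def by (intro tendsto_imp_eventually_ne)
  have bd: "poly C \<in> O[at 0](\<lambda>_. 1)" for C :: "complex poly"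
    using poly_isCont[of 0 C] unfolding isCont_def by (intro bigoI_tendsto) auto
  from sum_in_bigo(2)[OF AB(5) AB'(5)]
  have "(\<lambda>z. poly A (1 / z) / poly B (1 / z) - poly A' (1 / z) / poly B' (1 / z))
      \<in> O[at_infinity](\<lambda>z. 1 / z ^ (L + M + 1))" by simp
  from landau_o.big.compose[OF this filterlim_one_over_at_0]
  have o: "(\<lambda>y. poly A y / poly B y - poly A' y / poly B' y) \<in> O[at 0](\<lambda>y. y ^ (L + M + 1))"
    by (simp add: power_one_over)
  define D where "D = A * B' - A' * B"
  have "(\<lambda>y. (poly A y / poly B y - poly A' y / poly B' y) * (poly B y * poly B' y)) \<in>
      O[at 0](\<lambda>y. y ^ (L + M + 1) * (1 * 1))"
    by (intro landau_o.big.mult o bd)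
  moreover have "\<forall>\<^sub>F y in at 0. (poly A y / poly B y - poly A' y / poly B' y) * (poly B y * poly B' y) = poly D y"
    using nz[OF AB(3)] nz[OF AB'(3)] by eventually_elim (simp add: D_def field_simps)
  ultimately have "poly D \<in> O[at 0](\<lambda>y. y ^ (L + M + 1))"
    using landau_o.big.in_cong by force
  moreover have "degree D \<le> L + M"
    unfolding D_def using AB(1,2) AB'(1,2)
    by (intro degree_diff_le order.trans[OF degree_mult_le]) auto
  ultimately have "D = 0" by (intro poly_bigo_imp_zero)
  hence eq: "A * B' = A' * B" by (simp add: D_def)
  have B0: "B \<noteq> 0" "B' \<noteq> 0" using AB(3) AB'(3) by auto
  have "B dvd A * B'" by (simp add: eq)
  hence "B dvd B'" using coprime_dvd_mult_right_iff[of B A B'] AB(4) by (simp add: coprime_commute)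
  then obtain u where u: "B' = B * u" by (rule dvdE)
  have "B' dvd A' * B" by (simp flip: eq)
  hence "B' dvd B" using coprime_dvd_mult_right_iff[of B' A' B] AB'(4) by (simp add: coprime_commute)
  hence "degree B' \<le> degree B" using B0 by (intro dvd_imp_degree_le)
  hence "degree u = 0" using B0 by (simp add: u degree_mult_eq)
  then obtain c where c: "u = [:c:]" by (rule degree_eq_zeroE)
  have B': "B' = Polynomial.smult c B" by (simp add: u c)
  hence c0: "c \<noteq> 0" using B0 by auto
  have "A' * B = Polynomial.smult c A * B" using eq by (simp add: B')
  hence "A' = Polynomial.smult c A" using B0(1) by (metis mult_right_cancel)
  thus ?thesis using B' sphere_ratio_smult[OF c0] AB(6) AB'(6) by simp
qed

lemma geometric_kernel:
  fixes y z :: complex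
  assumes "y \<noteq> z" "z \<noteq> 0"
  shows "(\<Sum>i<m. y ^ i / z ^ (i + 1)) + 1 / (y - z) = (y / z) ^ m / (y - z)"
proof (induction m)
  case (Suc m)
  have "(\<Sum>i<Suc m. y ^ i / z ^ (i + 1)) + 1 / (y - z) = (y / z) ^ m / (y - z) + y ^ m / z ^ (m + 1)"
    using Suc by (simp add: algebra_simps)
  also have "\<dots> = (y / z) ^ m * (1 / (y - z) + 1 / z)" by (simp add: distrib_left power_divide)
  also have "1 / (y - z) + 1 / z = y / z / (y - z)" using assms by (simp add: divide_simps)
  finally show ?case by (simp add: mult_ac)
qed simp

text \<open>The partial fraction \<open>\<Sum>x\<in>Y. c x / (x - z)\<close> as a quotient of polynomials in \<open>1 / z\<close>, by
  \<open>c x / (x - z) = - c x y / (1 - x y)\<close> with \<open>y = 1 / z\<close>.\<close>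

definition pf_denom :: "complex set \<Rightarrow> complex poly" where
  "pf_denom Y = (\<Prod>x\<in>Y. [:1, - x:])"

definition pf_numer :: "complex set \<Rightarrow> (complex \<Rightarrow> complex) \<Rightarrow> complex poly" where
  "pf_numer Y c = (\<Sum>x\<in>Y. Polynomial.smult (- c x) ([:0, 1:] * pf_denom (Y - {x})))"

text \<open>The numerator is nonzero at each root \<open>1 / x\<close> of the denominator because exactly one of its
  summands survives there. At \<open>z = 0\<close> the value is the quotient of the top coefficients.\<close>

lemma sphere_ratio_partial_fraction:
  assumes Y: "finite Y" "0 \<notin> Y" and c: "\<forall>x\<in>Y. c x \<noteq> 0"
  defines "A \<equiv> pf_numer Y c" and "B \<equiv> pf_denom Y"
  shows "degree A \<le> card Y" "degree B \<le> card Y" "poly B 0 \<noteq> 0" "coprime A B"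
    "z \<noteq> 0 \<Longrightarrow> z \<notin> Y \<Longrightarrow> poly A (1 / z) / poly B (1 / z) = (\<Sum>x\<in>Y. c x / (x - z))"
    "sphere_ratio A B = (\<lambda>z. case z of None \<Rightarrow> Some 0
       | Some w \<Rightarrow> if w \<in> Y then None else Some (\<Sum>x\<in>Y. c x / (x - w)))"
proof -
  have pB: "poly (pf_denom Z) y = (\<Prod>x\<in>Z. 1 - x * y)" for Z y
    by (simp add: pf_denom_def poly_prod mult.commute)
  have dZ: "degree (pf_denom Z) = card Z" if "Z \<subseteq> Y" for Z
  proof -
    have "degree [:1, - x:] = 1" if "x \<in> Z" for x using that \<open>Z \<subseteq> Y\<close> Y by auto
    thus ?thesis unfolding pf_denom_def by (subst degree_prod_eq_sum_degree) auto
  qed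
  have lZ: "coeff (pf_denom Z) (card Z) = (\<Prod>x\<in>Z. - x)" if "Z \<subseteq> Y" for Z
  proof -
    have "lead_coeff (pf_denom Z) = (\<Prod>x\<in>Z. - x)"
      unfolding pf_denom_def lead_coeff_prod using that Y by (intro prod.cong) auto
    thus ?thesis by (simp add: dZ[OF that])
  qed
  have dB: "degree B = card Y" unfolding B_def by (rule dZ) simp
  thus "degree B \<le> card Y" by simp
  have cardm: "Suc (card (Y - {x})) = card Y" if "x \<in> Y" for x
    using card_Suc_Diff1[OF Y(1) that] .
  show dA: "degree A \<le> card Y"
    unfolding A_def pf_numer_def
  proof (intro degree_sum_le Y)
    fix x assume x: "x \<in> Y"
    have "degree ([:0, 1:] * pf_denom (Y - {x})) \<le> 1 + card (Y - {x})"
      by (rule order.trans[OF degree_mult_le]) (simp add: dZ)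
    thus "degree (Polynomial.smult (- c x) ([:0, 1:] * pf_denom (Y - {x}))) \<le> card Y"
      using cardm[OF x] by (intro order.trans[OF degree_smult_le]) simp
  qed
  show B0: "poly B 0 \<noteq> 0" by (simp add: B_def pB)
  have pA: "poly A y = (\<Sum>x\<in>Y. - c x * (y * (\<Prod>x'\<in>Y - {x}. 1 - x' * y)))" for y
    by (simp add: A_def pf_numer_def poly_sum pB mult_ac)
  have rootB: "poly B y = 0 \<longleftrightarrow> (\<exists>x\<in>Y. x * y = 1)" for y
    using Y by (auto simp: B_def pB)
  show "coprime A B"
  proof (rule coprimeI)
    fix d assume d: "d dvd A" "d dvd B"
    show "is_unit d"
    proof (rule ccontr)
      assume "\<not> is_unit d"
      moreover have "d \<noteq> 0" using d(2) B0 by auto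
      ultimately have "degree d \<noteq> 0" by (simp add: is_unit_iff_degree)
      then obtain y where y: "poly d y = 0"
        using fundamental_theorem_of_algebra[of d] by (auto simp: constant_degree)
      have "poly A y = 0" "poly B y = 0" using d y by (auto simp: dvd_def)
      then obtain x where x: "x \<in> Y" "x * y = 1" using rootB by auto
      have y0: "y \<noteq> 0" using x(2) by auto
      have "(\<Sum>v\<in>Y - {x}. - c v * (y * (\<Prod>x'\<in>Y - {v}. 1 - x' * y))) = 0"
      proof (rule sum.neutral, rule ballI)
        fix v assume "v \<in> Y - {x}"
        hence "(\<Prod>x'\<in>Y - {v}. 1 - x' * y) = 0" using x Y by (intro prod_zero) auto
        thus "- c v * (y * (\<Prod>x'\<in>Y - {v}. 1 - x' * y)) = 0" by simp
      qed
      hence "poly A y = - c x * (y * (\<Prod>x'\<in>Y - {x}. 1 - x' * y))"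
        unfolding pA by (subst sum.remove[OF Y(1) x(1)]) (simp only: add_0_right)
      moreover have "1 - x' * y \<noteq> 0" if "x' \<in> Y - {x}" for x'
        using x(2) that y0 by (metis DiffE insertI1 mult_right_cancel right_minus_eq)
      ultimately have "poly A y \<noteq> 0" using bspec[OF c x(1)] y0 Y(1) by simp
      with \<open>poly A y = 0\<close> show False by simp
    qed
  qed
  show frac: "poly A (1 / z) / poly B (1 / z) = (\<Sum>x\<in>Y. c x / (x - z))" if z: "z \<noteq> 0" "z \<notin> Y" for z
  proof -
    have Bz: "poly B (1 / z) \<noteq> 0" using z by (auto simp: rootB)
    have "(\<Sum>x\<in>Y. c x / (x - z)) = (\<Sum>x\<in>Y. - c x * (1 / z * (\<Prod>x'\<in>Y - {x}. 1 - x' * (1 / z))) / poly B (1 / z))"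
    proof (intro sum.cong refl)
      fix x assume x: "x \<in> Y"
      have "poly B (1 / z) = (1 - x * (1 / z)) * (\<Prod>x'\<in>Y - {x}. 1 - x' * (1 / z))"
        unfolding B_def pB using prod.remove[OF Y(1) x] .
      moreover have "(\<Prod>x'\<in>Y - {x}. 1 - x' * (1 / z)) \<noteq> 0"
        using z Y by (auto simp: divide_simps split: if_splits)
      moreover have "x \<noteq> z" using x z by auto
      ultimately show "c x / (x - z) = - c x * (1 / z * (\<Prod>x'\<in>Y - {x}. 1 - x' * (1 / z))) / poly B (1 / z)"
      proof -
        assume B: "poly B (1 / z) = (1 - x * (1 / z)) * (\<Prod>x'\<in>Y - {x}. 1 - x' * (1 / z))"
          and P: "(\<Prod>x'\<in>Y - {x}. 1 - x' * (1 / z)) \<noteq> 0" and xz: "x \<noteq> z"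
        have "- c x * (1 / z * (\<Prod>x'\<in>Y - {x}. 1 - x' * (1 / z))) / poly B (1 / z) =
            (- c x / z) / (1 - x * (1 / z))"
          unfolding B using P by (simp only: mult.assoc[symmetric] mult_divide_mult_cancel_right) simp
        also have "1 - x * (1 / z) = - (x - z) / z" using z by (simp add: diff_divide_distrib)
        also have "(- c x / z) / (- (x - z) / z) = c x / (x - z)"
          using z by (simp del: minus_diff_eq)
        finally show ?thesis ..
      qed
    qed
    thus ?thesis by (simp add: pA sum_divide_distrib)
  qed
  show "sphere_ratio A B = (\<lambda>z. case z of None \<Rightarrow> Some 0
       | Some w \<Rightarrow> if w \<in> Y then None else Some (\<Sum>x\<in>Y. c x / (x - w)))"
  proof
    fix z
    have N: "max (degree A) (degree B) = card Y" using dA dB by simp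
    have hom: "(\<Sum>i\<le>card Y. coeff C i * w ^ (card Y - i)) = w ^ card Y * poly C (1 / w)"
      if "degree C \<le> card Y" "w \<noteq> 0" for C :: "complex poly" and w
    proof -
      have "poly C (1 / w) = (\<Sum>i\<le>card Y. coeff C i * (1 / w) ^ i)"
        unfolding poly_altdef using that(1)
        by (intro sum.mono_neutral_left) (auto simp: coeff_eq_0)
      also have "w ^ card Y * \<dots> = (\<Sum>i\<le>card Y. coeff C i * w ^ (card Y - i))"
        unfolding sum_distrib_left
      proof (intro sum.cong refl)
        fix i assume "i \<in> {..card Y}"
        hence "w ^ card Y = w ^ (card Y - i) * w ^ i" by (simp flip: power_add)
        hence "w ^ card Y * (coeff C i * (1 / w) ^ i) = coeff C i * w ^ (card Y - i) * (w ^ i * (1 / w) ^ i)"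
          by (simp only: mult_ac)
        also have "w ^ i * (1 / w) ^ i = 1" using that(2) by (simp flip: power_mult_distrib)
        finally show "w ^ card Y * (coeff C i * (1 / w) ^ i) = coeff C i * w ^ (card Y - i)" by simp
      qed
      finally show ?thesis ..
    qed
    have hom0: "(\<Sum>i\<le>card Y. coeff C i * 0 ^ (card Y - i)) = coeff C (card Y)" for C :: "complex poly"
    proof -
      have "(\<Sum>i\<le>card Y. coeff C i * 0 ^ (card Y - i)) = (\<Sum>i\<le>card Y. if i = card Y then coeff C (card Y) else 0)"
        by (intro sum.cong) (auto simp: power_0_left)
      thus ?thesis by simp
    qed
    show "sphere_ratio A B z = (case z of None \<Rightarrow> Some 0
       | Some w \<Rightarrow> if w \<in> Y then None else Some (\<Sum>x\<in>Y. c x / (x - w)))"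
    proof (cases z)
      case None
      have "coeff B 0 \<noteq> 0" using B0 by (simp add: poly_0_coeff_0)
      moreover have "coeff A 0 = 0" using pA[of 0] by (simp add: poly_0_coeff_0)
      ultimately show ?thesis by (simp add: None sphere_ratio_def Let_def)
    next
      case (Some w)
      show ?thesis
      proof (cases "w = 0")
        case True
        have B: "coeff B (card Y) = (\<Prod>x\<in>Y. - x)" unfolding B_def by (rule lZ) simp
        have Bn: "coeff B (card Y) \<noteq> 0" unfolding B using Y by simp
        have "coeff A (card Y) = (\<Sum>x\<in>Y. - c x * (\<Prod>x'\<in>Y - {x}. - x'))"
          unfolding A_def pf_numer_def coeff_sum
        proof (intro sum.cong refl)
          fix x assume x: "x \<in> Y"
          show "coeff (Polynomial.smult (- c x) ([:0, 1:] * pf_denom (Y - {x}))) (card Y) = - c x * (\<Prod>x'\<in>Y - {x}. - x')"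
            using lZ[of "Y - {x}"] by (simp flip: cardm[OF x])
        qed
        hence "coeff A (card Y) / coeff B (card Y) = (\<Sum>x\<in>Y. - c x * (\<Prod>x'\<in>Y - {x}. - x') / coeff B (card Y))"
          by (simp add: sum_divide_distrib)
        also have "\<dots> = (\<Sum>x\<in>Y. c x / (x - 0))"
        proof (intro sum.cong refl)
          fix x assume x: "x \<in> Y"
          have "coeff B (card Y) = - x * (\<Prod>x'\<in>Y - {x}. - x')"
            unfolding B using prod.remove[OF Y(1) x] .
          thus "- c x * (\<Prod>x'\<in>Y - {x}. - x') / coeff B (card Y) = c x / (x - 0)"
            using Bn by auto
        qed
        finally show ?thesis using Bn Y(2)
          by (simp add: Some True sphere_ratio_def Let_def N hom0)
      next
        case False
        have "poly B (1 / w) = 0 \<longleftrightarrow> w \<in> Y" using False by (auto simp: rootB)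
        thus ?thesis using False frac[of w]
          by (auto simp: Some sphere_ratio_def Let_def N hom dA dB)
      qed
    qed
  qed
qed

section \<open>Quadrature and convergence\<close>

context measure_on_unit_interval
begin

definition weight :: "nat \<Rightarrow> real \<Rightarrow> real" where
  "weight j = (SOME w. (\<forall>x\<in>nodes (rho j) (ns j). w x > 0) \<and>
     (\<forall>f. deg_less (Suc (2 * ns j)) f \<longrightarrow> M f = (\<Sum>x\<in>nodes (rho j) (ns j). w x * poly f x)))"

abbreviation X :: "nat \<Rightarrow> real set" where "X j \<equiv> nodes (rho j) (ns j)"

lemma weight_pos: "x \<in> X j \<Longrightarrow> weight j x > 0"
  and quadrature: "deg_less (Suc (2 * ns j)) f \<Longrightarrow> M f = (\<Sum>x\<in>X j. weight j x * poly f x)"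
proof -
  have "\<exists>w. (\<forall>x\<in>X j. w x > 0) \<and> (\<forall>f. deg_less (Suc (2 * ns j)) f \<longrightarrow> M f = (\<Sum>x\<in>X j. w x * poly f x))"
    by (rule quasi_quadrature[of "rho j" "ns j"]) blast
  from someI_ex[OF this]
  show "x \<in> X j \<Longrightarrow> weight j x > 0"
    "deg_less (Suc (2 * ns j)) f \<Longrightarrow> M f = (\<Sum>x\<in>X j. weight j x * poly f x)"
    unfolding weight_def by blast+
qed

lemma zero_in_X: "0 \<in> X j"
  by (simp add: nodes_def quasi_def rho_def)

definition approx :: "nat \<Rightarrow> complex \<Rightarrow> complex" where
  "approx j z = (\<Sum>x\<in>X j. complex_of_real (weight j x) * (complex_of_real x / (complex_of_real x - z)))"

text \<open>The approximant as a map of the sphere, with its poles at the nonzero nodes; the summand of \<open>approx\<close>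
  at the node \<open>0\<close> vanishes, also for \<open>z = 0\<close>.\<close>

definition approximant :: "nat \<Rightarrow> complex option \<Rightarrow> complex option" where
  "approximant j z = (case z of None \<Rightarrow> Some 0
     | Some w \<Rightarrow> if w \<in> complex_of_real ` (X j - {0}) then None else Some (approx j w))"

lemma quadrature_power:
  assumes "k \<le> 2 * ns j"
  shows "M ([:0, 1:] ^ k) = (\<Sum>x\<in>X j. weight j x * x ^ k)"
  using quadrature[of j "[:0, 1:] ^ k"] assms by (simp add: deg_less_iff degree_power_eq)

lemma sum_weight: "(\<Sum>x\<in>X j. weight j x) = M 1"
  using quadrature_power[of 0 j] by simp

text \<open>The counterpart of \<open>cauchy_partial_expansion\<close> for the quadrature rule: as the moments agree, \<open>approx j\<close>
  and \<open>\<FF>\<close> have the same first \<open>2 n\<close> coefficients at infinity, where \<open>n = ns j\<close>.\<close>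

lemma approx_expansion:
  assumes "w \<notin> complex_of_real ` X j"
  shows "approx j w + (\<Sum>i<2 * ns j. complex_of_real (M ([:0, 1:] ^ (i + 1))) / w ^ (i + 1)) =
    (\<Sum>x\<in>X j. complex_of_real (weight j x) *
      (complex_of_real x * ((complex_of_real x / w) ^ (2 * ns j) / (complex_of_real x - w))))"
proof -
  have w0: "w \<noteq> 0" using assms zero_in_X[of j] by force
  let ?c = "\<lambda>x. complex_of_real (weight j x) * complex_of_real x"
  let ?q = "\<lambda>x. \<Sum>i<2 * ns j. complex_of_real x ^ i / w ^ (i + 1)"
  have "(\<Sum>i<2 * ns j. complex_of_real (M ([:0, 1:] ^ (i + 1))) / w ^ (i + 1)) =
      (\<Sum>i<2 * ns j. \<Sum>x\<in>X j. ?c x * (complex_of_real x ^ i / w ^ (i + 1)))"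
  proof (intro sum.cong refl)
    fix i assume "i \<in> {..<2 * ns j}"
    hence "M ([:0, 1:] ^ (i + 1)) = (\<Sum>x\<in>X j. weight j x * x ^ (i + 1))"
      by (intro quadrature_power) auto
    thus "complex_of_real (M ([:0, 1:] ^ (i + 1))) / w ^ (i + 1) =
        (\<Sum>x\<in>X j. ?c x * (complex_of_real x ^ i / w ^ (i + 1)))"
      by (simp add: sum_divide_distrib mult.assoc)
  qed
  also have "\<dots> = (\<Sum>x\<in>X j. ?c x * ?q x)"
    unfolding sum_distrib_left by (rule sum.swap)
  finally have "approx j w + (\<Sum>i<2 * ns j. complex_of_real (M ([:0, 1:] ^ (i + 1))) / w ^ (i + 1)) =
      (\<Sum>x\<in>X j. ?c x * (?q x + 1 / (complex_of_real x - w)))"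
    by (simp add: approx_def distrib_left sum.distrib)
  also have "\<dots> = (\<Sum>x\<in>X j. ?c x * ((complex_of_real x / w) ^ (2 * ns j) / (complex_of_real x - w)))"
    by (intro sum.cong refl arg_cong2[of _ _ _ _ "(*)"] geometric_kernel) (use assms w0 in auto)
  finally show ?thesis by (simp only: mult.assoc)
qed

lemma pade_approximant_approximant:
  "pade_approximant (\<lambda>j. M ([:0, 1:] ^ (j + 1))) (ns j) (ns j) (approximant j)"
proof -
  define n where "n = ns j"
  define Y where "Y = complex_of_real ` (X j - {0})"
  define c where "c y = complex_of_real (weight j (Re y)) * y" for y
  have cardY: "card Y = n"
    unfolding Y_def using zero_in_X[of j] card_nodes[of "rho j" "ns j"]
    by (subst card_image) (auto simp: inj_on_def n_def)
  have Y: "finite Y" "0 \<notin> Y" by (auto simp: Y_def)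
  have c: "\<forall>y\<in>Y. c y \<noteq> 0" using weight_pos[of _ j] by (force simp: Y_def c_def)
  have approxY: "approx j z = (\<Sum>y\<in>Y. c y / (y - z))" for z
  proof -
    have "(\<Sum>y\<in>Y. c y / (y - z)) =
        (\<Sum>x\<in>X j - {0}. complex_of_real (weight j x) * (complex_of_real x / (complex_of_real x - z)))"
      unfolding Y_def by (subst sum.reindex) (auto simp: inj_on_def c_def)
    also have "\<dots> = approx j z" unfolding approx_def by (rule sum.mono_neutral_left) auto
    finally show ?thesis ..
  qed
  note pf = sphere_ratio_partial_fraction[OF Y c]
  let ?A = "pf_numer Y c" and ?B = "pf_denom Y"
  let ?f = "\<lambda>z. (\<Sum>i<n + n. complex_of_real (M ([:0, 1:] ^ (i + 1))) / z ^ (i + 1)) + poly ?A (1 / z) / poly ?B (1 / z)"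
  let ?g = "\<lambda>z. \<Sum>x\<in>X j. complex_of_real (weight j x) *
    (complex_of_real x ^ (n + n + 1) * (1 / (complex_of_real x / z - 1)))"
  have far: "\<forall>\<^sub>F z in at_infinity. z \<notin> complex_of_real ` X j"
  proof -
    obtain b where b: "\<forall>y\<in>complex_of_real ` X j. cmod y \<le> b"
      using finite_imp_bounded[of "complex_of_real ` X j"] by (auto simp: bounded_iff)
    show ?thesis
      unfolding eventually_at_infinity by (intro exI[of _ "b + 1"] allI impI) (use b in force)
  qed
  have z0: "z \<noteq> 0" if "z \<notin> complex_of_real ` X j" for z using that zero_in_X[of j] by force
  have f_eq: "?g z = ?f z / (1 / z ^ (n + n + 1))" if z: "z \<notin> complex_of_real ` X j" for z
  proof -
    have "z \<notin> Y" using z by (auto simp: Y_def)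
    hence "?f z = (\<Sum>x\<in>X j. complex_of_real (weight j x) *
        (complex_of_real x * ((complex_of_real x / z) ^ (n + n) / (complex_of_real x - z))))"
      using approx_expansion[OF z] pf(5)[OF z0[OF z]] by (simp add: approxY n_def add.commute flip: mult_2)
    hence "?f z / (1 / z ^ (n + n + 1)) = (\<Sum>x\<in>X j. complex_of_real (weight j x) *
        (complex_of_real x * ((complex_of_real x / z) ^ (n + n) / (complex_of_real x - z))) / (1 / z ^ (n + n + 1)))"
      by (simp only: sum_divide_distrib)
    also have "\<dots> = ?g z"
    proof (intro sum.cong refl)
      fix x assume "x \<in> X j"
      hence "complex_of_real x - z \<noteq> 0" using z by auto
      have "1 / (complex_of_real x / z - 1) = z / (complex_of_real x - z)"
        using z0[OF z] by (simp add: diff_divide_distrib[symmetric] divide_simps)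
      thus "complex_of_real (weight j x) *
          (complex_of_real x * ((complex_of_real x / z) ^ (n + n) / (complex_of_real x - z))) / (1 / z ^ (n + n + 1)) =
          complex_of_real (weight j x) * (complex_of_real x ^ (n + n + 1) * (1 / (complex_of_real x / z - 1)))"
        using z0[OF z] by (simp add: power_divide)
    qed
    finally show ?thesis ..
  qed
  have "?f \<in> O[at_infinity](\<lambda>z. 1 / z ^ (n + n + 1))"
  proof (rule bigoI_tendsto)
    have "(?g \<longlongrightarrow> (\<Sum>x\<in>X j. complex_of_real (weight j x) * (complex_of_real x ^ (n + n + 1) * (1 / (0 - 1))))) at_infinity"
      by (intro tendsto_intros tendsto_divide_0[OF tendsto_const] filterlim_ident) auto
    moreover have "\<forall>\<^sub>F z in at_infinity. ?g z = ?f z / (1 / z ^ (n + n + 1))"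
      using far by eventually_elim (rule f_eq)
    ultimately show "((\<lambda>z. ?f z / (1 / z ^ (n + n + 1))) \<longlongrightarrow>
        (\<Sum>x\<in>X j. complex_of_real (weight j x) * (complex_of_real x ^ (n + n + 1) * (1 / (0 - 1))))) at_infinity"
      by (rule Lim_transform_eventually)
    show "\<forall>\<^sub>F z in at_infinity. 1 / z ^ (n + n + 1) \<noteq> (0::complex)"
      using far by eventually_elim (use z0 in auto)
  qed
  moreover have "approximant j = sphere_ratio ?A ?B"
    unfolding pf(6) by (auto simp: fun_eq_iff approximant_def approxY Y_def[symmetric] split: option.split)
  ultimately show ?thesis
    unfolding pade_approximant_def using pf(1-4) cardY by (auto simp: n_def)
qed

lemma approximant_unique:
  "(\<forall>j. pade_approximant (\<lambda>j. M ([:0, 1:] ^ (j + 1))) (ns j) (ns j) (R j)) \<longleftrightarrow> R = approximant"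
  using pade_approximant_unique pade_approximant_approximant by blast

text \<open>Near infinity \<open>\<FF>\<close> has modulus at most 1, so its image stays at distance at least 1 from the north
  pole of the sphere. From some index on, the approximants are within distance 1 of it and have no
  poles there. Every nonzero node is a pole, which bounds the nodes and thereby \<open>rho\<close>.\<close>

lemma rho_bounded_of_convergence:
  assumes lim: "locally_uniform_limit S approximant (\<lambda>z. case z of None \<Rightarrow> Some 0 | Some w \<Rightarrow> Some (cauchy [:0, 1:] w))"
    and S: "None \<in> S" "\<And>w. cmod w > K \<Longrightarrow> Some w \<in> S"
  shows "\<exists>C. \<forall>j. \<bar>rho j\<bar> \<le> C"
proof -
  let ?F = "\<lambda>z. case z of None \<Rightarrow> Some 0 | Some w \<Rightarrow> Some (cauchy [:0, 1:] w)"
  obtain r where r: "r > 0" and u: "uniform_limit {w \<in> S. dist (stereo w) (stereo None) < r}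
       (\<lambda>n w. stereo (approximant n w)) (\<lambda>w. stereo (?F w)) sequentially"
    using lim S(1) unfolding locally_uniform_limit_def by blast
  define m where "m = M 1"
  \<comment> \<open>beyond \<open>K'\<close> points lie in the neighbourhood of infinity given by \<open>r\<close>, and \<open>\<FF>\<close> is at most 1 in modulus\<close>
  define K' where "K' = max (max 3 K) (max (1 + m) (2 / r)) + 1"
  have K': "K' > 3" "K' > K" "K' \<ge> 2 + m" "K' > 2 / r" by (auto simp: K'_def)
  have small: "cmod (cauchy [:0, 1:] w) \<le> 1" if "cmod w \<ge> K'" for w
  proof -
    have w1: "cmod w > 1" using that K' by linarith
    have "cmod (cauchy [:0, 1:] w) \<le> 1 / (cmod w - 1) * m"
      using cauchy_power_bound[OF w1, of "[:0, 1:]" 1 0] by (simp add: m_def abs_le_iff)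
    also have "\<dots> \<le> 1" using w1 that K' by (simp add: divide_simps)
    finally show ?thesis .
  qed
  have near: "dist (stereo (Some w)) (stereo None) < r" if "cmod w \<ge> K'" for w
  proof -
    have "2 / r < cmod w" using that K' by linarith
    also have "cmod w \<le> sqrt (1 + (cmod w)\<^sup>2)" by (intro real_le_rsqrt) simp
    finally have "2 < sqrt (1 + (cmod w)\<^sup>2) * r" using r by (simp add: pos_divide_less_eq)
    moreover have "0 < sqrt (1 + (cmod w)\<^sup>2)" using one_plus_cmod_sq_pos[of w] by (rule real_sqrt_gt_zero)
    ultimately show ?thesis unfolding dist_stereo_infinity by (simp only: pos_divide_less_eq mult.commute)
  qed
  have "\<forall>\<^sub>F n in sequentially. \<forall>w\<in>{w \<in> S. dist (stereo w) (stereo None) < r}. dist (stereo (approximant n w)) (stereo (?F w)) < 1"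
    using uniform_limitD[OF u, of 1] by simp
  then obtain N where N: "\<And>n w. n \<ge> N \<Longrightarrow> w \<in> S \<Longrightarrow> dist (stereo w) (stereo None) < r \<Longrightarrow>
      dist (stereo (approximant n w)) (stereo (?F w)) < 1"
    unfolding eventually_sequentially by blast
  have big: "\<bar>rho n\<bar> \<le> K' + 2" if "n \<ge> N" for n
  proof (rule parameter_bounded_by_nodes[of K' "rho n" "ns n"])
    show "K' \<ge> 3" using K' by simp
    fix x assume x: "x \<in> X n"
    show "\<bar>x\<bar> < K'"
    proof (rule ccontr)
      assume "\<not> ?thesis"
      hence xK: "cmod (complex_of_real x) \<ge> K'" by simp
      have "x \<noteq> 0" using xK K' by auto
      hence "approximant n (Some (complex_of_real x)) = None" using x by (auto simp: approximant_def)
      hence d: "dist (stereo None) (stereo (Some (cauchy [:0, 1:] (complex_of_real x)))) < 1"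
        using N[OF that S(2) near[OF xK]] xK K' by simp
      let ?v = "cauchy [:0, 1:] (complex_of_real x)"
      have "1 + (cmod ?v)\<^sup>2 \<le> 2" using small[OF xK] by (simp add: power_le_one)
      hence "sqrt (1 + (cmod ?v)\<^sup>2) \<le> 2" by (intro real_le_lsqrt) auto
      hence "2 / sqrt (1 + (cmod ?v)\<^sup>2) \<ge> 1" using one_plus_cmod_sq_pos[of ?v] by (simp add: divide_simps)
      thus False using d unfolding dist_commute[of "stereo None"] dist_stereo_infinity by linarith
    qed
  qed
  have "\<bar>rho j\<bar> \<le> max (K' + 2) (Max ((\<lambda>i. \<bar>rho i\<bar>) ` {..N}))" for j
  proof (cases "j \<ge> N")
    case False
    hence "\<bar>rho j\<bar> \<le> Max ((\<lambda>i. \<bar>rho i\<bar>) ` {..N})" by (intro Max_ge) auto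
    thus ?thesis by simp
  qed (use big[of j] in auto)
  thus ?thesis by blast
qed

end

locale measure_with_gap = measure_on_unit_interval +
  fixes \<alpha> \<beta> :: real
  assumes gap: "\<alpha> \<le> 0" "0 \<le> \<beta>"
    and null_outside_E: "emeasure \<sigma> (- ({-1..\<alpha>} \<union> {\<beta>..1})) = 0"
begin

lemma AE_E: "AE t in \<sigma>. t \<in> {-1..\<alpha>} \<union> {\<beta>..1}"
proof (rule AE_I)
  show "{t \<in> space \<sigma>. t \<notin> {-1..\<alpha>} \<union> {\<beta>..1}} \<subseteq> - ({-1..\<alpha>} \<union> {\<beta>..1})" by auto
  show "- ({-1..\<alpha>} \<union> {\<beta>..1}) \<in> sets \<sigma>" by (simp add: sets_borel)
qed (rule null_outside_E)

text \<open>A second root in the gap would give the factor \<open>t (t - x)\<close>, which is nonnegative on the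
  support.\<close>

lemma no_node_in_gap:
  assumes "x \<in> X j" "x \<noteq> 0"
  shows "x \<le> \<alpha> \<or> \<beta> \<le> x"
proof (rule ccontr)
  assume neg: "\<not> ?thesis"
  have "poly (quasi (rho j) (ns j)) 0 = 0" using zero_in_X[of j] by (simp add: nodes_def)
  then obtain q where q: "quasi (rho j) (ns j) = [:0, 1:] * q" by (auto simp: poly_eq_0_iff_dvd)
  have "poly (quasi (rho j) (ns j)) x = 0" using assms(1) by (simp add: nodes_def)
  hence "poly q x = 0" using assms(2) by (simp add: q)
  then obtain r where r: "q = [:- x, 1:] * r" by (auto simp: poly_eq_0_iff_dvd)
  have "quasi (rho j) (ns j) = ([:0, 1:] * [:- x, 1:]) * r" unfolding q r by (simp only: mult.assoc)
  moreover have "degree ([:0, 1:] * [:- x, 1:]) = 2" by simp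
  moreover have "AE t in \<sigma>. 0 \<le> poly ([:0, 1:] * [:- x, 1:]) t"
    using AE_E
  proof eventually_elim
    case (elim t)
    hence "(t \<le> 0 \<and> t - x \<le> 0) \<or> (0 \<le> t \<and> 0 \<le> t - x)" using gap neg by auto
    hence "0 \<le> t * (t - x)" by (auto simp: zero_le_mult_iff)
    thus ?case by (simp add: algebra_simps)
  qed
  ultimately show False by (rule quasi_no_nonneg_quadratic_factor)
qed

lemma ns_ge: "j \<le> ns j"
  using blocks.ns_strict_mono by (rule strict_mono_imp_increasing)

text \<open>The quadrature rules integrate any fixed polynomial exactly from some index on, so they
  converge on all functions that polynomials approximate uniformly on the nodes.\<close>

lemma quadrature_converges_real:
  fixes f :: "real \<Rightarrow> real"
  assumes K: "compact K" "\<And>j. X j \<subseteq> K" "{-1..\<alpha>} \<union> {\<beta>..1} \<subseteq> K"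
    and f: "continuous_on K f" "f \<in> borel_measurable borel"
  shows "(\<lambda>j. \<Sum>x\<in>X j. weight j x * f x) \<longlonglongrightarrow> (LINT t|\<sigma>. f t)"
proof (rule tendstoI)
  fix e :: real assume e: "e > 0"
  define m where "m = M 1"
  have m: "m > 0" using M_square_pos[of 1] by (simp add: m_def)
  define d where "d = e / (3 * m)"
  have d: "d > 0" "d * m = e / 3" using e m by (auto simp: d_def)
  obtain g where g: "real_polynomial_function g" "\<And>x. x \<in> K \<Longrightarrow> \<bar>f x - g x\<bar> < d"
    using Stone_Weierstrass_real_polynomial_function[OF K(1) f(1) d(1)] by blast
  then obtain a n where an: "g = (\<lambda>x. \<Sum>i\<le>n. a i * x ^ i)"
    using real_polynomial_function_iff_sum by blast
  define p where "p = (\<Sum>i\<le>n. Polynomial.smult (a i) ([:0, 1:] ^ i))"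
  have p: "poly p x = g x" for x by (simp add: p_def an poly_sum)
  have ae: "AE t in \<sigma>. norm (f t - g t) \<le> d"
    using AE_E
  proof eventually_elim
    case (elim t)
    hence "\<bar>f t - g t\<bar> < d" using K(3) by (intro g(2)) blast
    thus ?case by simp
  qed
  have int: "integrable \<sigma> (\<lambda>t. f t - g t)"
  proof (rule integrable_const_bound[OF ae])
    have "f \<in> borel_measurable \<sigma>" using f(2) by (simp add: measurable_iff_borel)
    moreover have "g \<in> borel_measurable \<sigma>"
      using borel_measurable_integrable[OF integrable_poly[of p]] by (simp add: p[abs_def])
    ultimately show "(\<lambda>t. f t - g t) \<in> borel_measurable \<sigma>" by measurable
  qed
  have ig: "integrable \<sigma> g" using integrable_poly[of p] by (simp add: p[abs_def])
  have M: "(LINT t|\<sigma>. f t) = (LINT t|\<sigma>. f t - g t) + M p"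
    using Bochner_Integration.integral_add[OF int ig] by (simp add: M_def p[abs_def])
  have "\<bar>LINT t|\<sigma>. f t - g t\<bar> \<le> d * m"
    using norm_integral_le[OF int ae] by (simp add: m_def)
  hence I: "\<bar>(LINT t|\<sigma>. f t) - M p\<bar> \<le> e / 3" unfolding M d(2) by simp
  have "\<forall>\<^sub>F j in sequentially. degree p \<le> 2 * ns j"
    using eventually_ge_at_top[of "degree p"] 
  proof eventually_elim
    case (elim j)
    thus ?case using ns_ge[of j] by linarith
  qed
  thus "\<forall>\<^sub>F j in sequentially. dist (\<Sum>x\<in>X j. weight j x * f x) (LINT t|\<sigma>. f t) < e"
  proof eventually_elim
    case (elim j)
    have "M p = (\<Sum>x\<in>X j. weight j x * g x)"
      using quadrature[of j p] elim by (auto simp: deg_less_iff p)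
    hence "\<bar>(\<Sum>x\<in>X j. weight j x * f x) - M p\<bar> = \<bar>\<Sum>x\<in>X j. weight j x * (f x - g x)\<bar>"
      by (simp add: right_diff_distrib sum_subtractf)
    also have "\<dots> \<le> (\<Sum>x\<in>X j. weight j x * d)"
    proof (rule sum_abs[THEN order.trans], rule sum_mono)
      fix x assume x: "x \<in> X j"
      hence "\<bar>f x - g x\<bar> \<le> d" using g(2)[of x] K(2)[of j] by (auto simp: less_imp_le)
      thus "\<bar>weight j x * (f x - g x)\<bar> \<le> weight j x * d"
        using weight_pos[OF x] by (simp add: abs_mult mult_left_mono)
    qed
    also have "\<dots> = e / 3" unfolding sum_distrib_right[symmetric] sum_weight using d(2) by (simp add: m_def mult.commute)
    finally show ?case using I e unfolding dist_real_def by linarith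
  qed
qed

lemma quadrature_converges:
  fixes f :: "real \<Rightarrow> complex"
  assumes K: "compact K" "\<And>j. X j \<subseteq> K" "{-1..\<alpha>} \<union> {\<beta>..1} \<subseteq> K"
    and f: "continuous_on K f" "f \<in> borel_measurable borel" and int: "integrable \<sigma> f"
  shows "(\<lambda>j. \<Sum>x\<in>X j. complex_of_real (weight j x) * f x) \<longlonglongrightarrow> (LINT t|\<sigma>. f t)"
proof -
  have "(\<lambda>j. \<Sum>x\<in>X j. weight j x * Re (f x)) \<longlonglongrightarrow> (LINT t|\<sigma>. Re (f t))"
    using f(1) by (intro quadrature_converges_real[OF K] continuous_intros measurable_compose[OF f(2)]
        borel_measurable_continuous_onI) auto
  moreover have "(\<lambda>j. \<Sum>x\<in>X j. weight j x * Im (f x)) \<longlonglongrightarrow> (LINT t|\<sigma>. Im (f t))"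
    using f(1) by (intro quadrature_converges_real[OF K] continuous_intros measurable_compose[OF f(2)]
        borel_measurable_continuous_onI) auto
  moreover have "(LINT t|\<sigma>. Re (f t)) = Re (LINT t|\<sigma>. f t)" "(LINT t|\<sigma>. Im (f t)) = Im (LINT t|\<sigma>. f t)"
    using int by auto
  ultimately show ?thesis by (simp add: tendsto_complex_iff)
qed

text \<open>Distance to the segments controls the kernel \<open>t / (t - z)\<close>; its value at the node \<open>t = 0\<close> is
  \<open>0\<close> also for \<open>z = 0\<close>.\<close>

lemma kernel_lipschitz:
  assumes d: "d > 0" and t: "t = 0 \<or> \<bar>t\<bar> \<le> K \<and> d \<le> cmod (complex_of_real t - z) \<and> d \<le> cmod (complex_of_real t - z')"
    and "K \<ge> 0"
  shows "cmod (complex_of_real t / (complex_of_real t - z) - complex_of_real t / (complex_of_real t - z')) \<le> K / d\<^sup>2 * cmod (z - z')"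
proof (cases "t = 0")
  case False
  with t have t: "\<bar>t\<bar> \<le> K" "d \<le> cmod (complex_of_real t - z)" "d \<le> cmod (complex_of_real t - z')" by auto
  hence ne: "complex_of_real t - z \<noteq> 0" "complex_of_real t - z' \<noteq> 0" using d by auto
  have "complex_of_real t / (complex_of_real t - z) - complex_of_real t / (complex_of_real t - z') =
      complex_of_real t * (z - z') / ((complex_of_real t - z) * (complex_of_real t - z'))"
    using ne by (simp add: divide_simps) (simp add: algebra_simps)
  hence "cmod (complex_of_real t / (complex_of_real t - z) - complex_of_real t / (complex_of_real t - z')) =
      \<bar>t\<bar> * cmod (z - z') / (cmod (complex_of_real t - z) * cmod (complex_of_real t - z'))"
    by (simp add: norm_mult norm_divide)
  also have "\<dots> \<le> K * cmod (z - z') / (d * d)"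
    using t d assms(3) by (intro frac_le mult_right_mono mult_mono mult_nonneg_nonneg mult_pos_pos) auto
  finally show ?thesis by (simp add: power2_eq_square)
qed (use assms in simp)

text \<open>The bound keeps all nodes in \<open>[- K, K]\<close>. Near infinity the approximants and \<open>\<FF>\<close> have the same
  first coefficients, with geometrically small remainders. Near a finite point off the segments the
  kernels \<open>t / (t - z)\<close> are equi-Lipschitz in \<open>z\<close>, so the pointwise convergence of the quadrature rules is
  locally uniform.\<close>

lemma convergence_of_rho_bounded:
  assumes C: "\<And>j. \<bar>rho j\<bar> \<le> C"
  defines "K \<equiv> max 3 (C + 2)"
  shows "locally_uniform_limit
      (- (Some ` complex_of_real ` ({- K..\<alpha>} \<union> {\<beta>..K}))) approximant
      (\<lambda>z. case z of None \<Rightarrow> Some 0 | Some w \<Rightarrow> Some (cauchy [:0, 1:] w))"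
  unfolding locally_uniform_limit_def
proof
  let ?F = "\<lambda>z. case z of None \<Rightarrow> Some 0 | Some w \<Rightarrow> Some (cauchy [:0, 1:] w)"
  let ?S = "- (Some ` complex_of_real ` ({- K..\<alpha>} \<union> {\<beta>..K}))"
  have K3: "K \<ge> 3" by (simp add: K_def)
  have Xb: "\<bar>x\<bar> \<le> K" if "x \<in> X j" for x j
    using nodes_bounded_by_parameter[OF that] C[of j] by (auto simp: K_def)
  have XK: "x \<in> {- K..\<alpha>} \<union> {\<beta>..K}" if "x \<in> X j" "x \<noteq> 0" for x j
    using no_node_in_gap[OF that] Xb[OF that(1)] by auto
  have EK: "{-1..\<alpha>} \<union> {\<beta>..1} \<subseteq> {- K..\<alpha>} \<union> {\<beta>..K}" using K3 by auto
  have app: "approximant j (Some w) = Some (approx j w)" if "Some w \<in> ?S" for j w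
    using that XK by (auto simp: approximant_def)
  have m0: "M 1 > 0" using M_square_pos[of 1] by simp
  fix z assume z: "z \<in> ?S"
  show "\<exists>r>0. uniform_limit {w \<in> ?S. dist (stereo w) (stereo z) < r}
      (\<lambda>n w. stereo (approximant n w)) (\<lambda>w. stereo (?F w)) sequentially"
  proof (cases z)
    case None
    \<comment> \<open>beyond twice the bound of the nodes each node satisfies \<open>\<bar>x / w\<bar> \<le> 1 / 2\<close>\<close>
    define k where "k = 2 * K"
    have bound: "cmod (approx j w - cauchy [:0, 1:] w) \<le> 2 * M 1 * (1 / 2) ^ j" if w: "cmod w > k" for j w
    proof -
      have w1: "cmod w > 2 * K" "cmod w > 2" using w K3 by (auto simp: k_def)
      have pw: "a ^ (2 * ns j) \<le> (1 / 2) ^ j" if "0 \<le> a" "a \<le> 1 / 2" for a :: real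
      proof -
        have "a ^ (2 * ns j) \<le> (1 / 2) ^ (2 * ns j)" using that by (intro power_mono)
        also have "\<dots> \<le> (1 / 2) ^ j" using ns_ge[of j] by (intro power_decreasing) auto
        finally show ?thesis .
      qed
      let ?s = "\<Sum>i<2 * ns j. complex_of_real (M ([:0, 1:] ^ (i + 1))) / w ^ (i + 1)"
      have "w \<notin> complex_of_real ` X j"
      proof
        assume "w \<in> complex_of_real ` X j"
        then obtain x where "w = complex_of_real x" "x \<in> X j" by blast
        with Xb[of x j] w1(1) K3 show False by simp
      qed
      from approx_expansion[OF this] have "cmod (approx j w + ?s) \<le> (\<Sum>x\<in>X j. weight j x * (1 / 2) ^ j)"
      proof (simp only:, intro norm_sum[THEN order.trans] sum_mono)
        fix x assume x: "x \<in> X j"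
        have "cmod (complex_of_real x - w) \<ge> cmod w - \<bar>x\<bar>"
          using norm_triangle_ineq2[of w "complex_of_real x"] by (simp add: norm_minus_commute)
        hence den: "cmod (complex_of_real x - w) \<ge> K" using Xb[OF x] w1 by linarith
        have "\<bar>x\<bar> / cmod w \<le> 1 / 2" using Xb[OF x] w1 by (simp add: divide_simps)
        hence "(\<bar>x\<bar> / cmod w) ^ (2 * ns j) \<le> (1 / 2) ^ j" by (intro pw) auto
        hence "\<bar>x\<bar> * ((\<bar>x\<bar> / cmod w) ^ (2 * ns j) / cmod (complex_of_real x - w)) \<le> K * ((1 / 2) ^ j / K)"
          using Xb[OF x] den K3 by (intro mult_mono frac_le) auto
        hence le: "\<bar>x\<bar> * ((\<bar>x\<bar> / cmod w) ^ (2 * ns j) / cmod (complex_of_real x - w)) \<le> (1 / 2) ^ j"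
          using K3 by simp
        have norm: "cmod (complex_of_real x * ((complex_of_real x / w) ^ (2 * ns j) / (complex_of_real x - w))) =
            \<bar>x\<bar> * ((\<bar>x\<bar> / cmod w) ^ (2 * ns j) / cmod (complex_of_real x - w))"
          by (simp add: norm_mult norm_divide norm_power)
        show "cmod (complex_of_real (weight j x) *
            (complex_of_real x * ((complex_of_real x / w) ^ (2 * ns j) / (complex_of_real x - w)))) \<le> weight j x * (1 / 2) ^ j"
          unfolding norm_mult[of "complex_of_real (weight j x)"] norm norm_of_real abs_of_pos[OF weight_pos[OF x]]
          by (rule mult_left_mono[OF le less_imp_le[OF weight_pos[OF x]]])
      qed
      hence b1: "cmod (approx j w + ?s) \<le> M 1 * (1 / 2) ^ j"
        unfolding sum_distrib_right[symmetric] sum_weight .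
      have "cauchy [:0, 1:] w + ?s = cauchy ([:0, 1:] * [:0, 1:] ^ (2 * ns j)) w / w ^ (2 * ns j)"
        using cauchy_partial_expansion[of w "[:0, 1:]" "2 * ns j"] w1(2) by simp
      moreover have "cmod (cauchy ([:0, 1:] * [:0, 1:] ^ (2 * ns j)) w) \<le> 1 / (cmod w - 1) * M 1"
        using w1(2) by (intro cauchy_power_bound) auto
      moreover have "1 / (cmod w - 1) * M 1 \<le> 1 * M 1"
        using w1(2) m0 by (intro mult_right_mono) (auto simp: divide_simps)
      ultimately have "cmod (cauchy [:0, 1:] w + ?s) \<le> M 1 * (1 / cmod w) ^ (2 * ns j)"
        by (simp add: norm_divide norm_power power_one_over divide_right_mono)
      also have "\<dots> \<le> M 1 * (1 / 2) ^ j"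
        using w1(2) m0 by (intro mult_left_mono pw) (auto simp: divide_simps)
      finally have b2: "cmod (cauchy [:0, 1:] w + ?s) \<le> M 1 * (1 / 2) ^ j" .
      show ?thesis using norm_triangle_ineq4[of "approx j w + ?s" "cauchy [:0, 1:] w + ?s"] b1 b2 by simp
    qed
    define r where "r = 2 / (1 + k\<^sup>2)"
    have r: "r > 0" by (simp add: r_def add_pos_nonneg)
    have "uniform_limit {w \<in> ?S. dist (stereo w) (stereo z) < r}
        (\<lambda>n w. stereo (approximant n w)) (\<lambda>w. stereo (?F w)) sequentially"
    proof (rule uniform_limitI)
      fix e :: real assume e: "e > 0"
      have "(\<lambda>j. 4 * M 1 * (1 / 2) ^ j) \<longlonglongrightarrow> 0"
        by (intro tendsto_mult_right_zero LIMSEQ_power_zero) auto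
      hence "\<forall>\<^sub>F j in sequentially. 4 * M 1 * (1 / 2) ^ j < e" using e by (rule order_tendstoD)
      thus "\<forall>\<^sub>F n in sequentially. \<forall>w\<in>{w \<in> ?S. dist (stereo w) (stereo z) < r}. dist (stereo (approximant n w)) (stereo (?F w)) < e"
      proof eventually_elim
        case (elim j)
        show ?case
        proof
          fix w assume w: "w \<in> {w \<in> ?S. dist (stereo w) (stereo z) < r}"
          show "dist (stereo (approximant j w)) (stereo (?F w)) < e"
          proof (cases w)
            case None
            thus ?thesis using e by (simp add: approximant_def)
          next
            case (Some v)
            hence "dist (stereo (Some v)) (stereo None) < 2 / (1 + k\<^sup>2)" using w \<open>z = None\<close> by (simp add: r_def)
            hence v: "cmod v > k" by (rule stereo_near_infinity) (use K3 in \<open>simp add: k_def\<close>)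
            have "dist (stereo (approximant j w)) (stereo (?F w)) \<le> 2 * dist (approx j v) (cauchy [:0, 1:] v)"
              using app[of v j] w Some dist_stereo_Some[of "approx j v" "cauchy [:0, 1:] v"] by simp
            also have "\<dots> \<le> 4 * M 1 * (1 / 2) ^ j" using bound[OF v, of j] by (simp add: dist_norm)
            finally show ?thesis using elim by simp
          qed
        qed
      qed
    qed
    with r show ?thesis by blast
  next
    case (Some z0)
    let ?E = "complex_of_real ` ({- K..\<alpha>} \<union> {\<beta>..K})"
    have cl: "closed ?E"
      by (intro compact_imp_closed compact_continuous_image continuous_intros compact_Un) auto
    have z0: "z0 \<notin> ?E" using z Some by auto
    obtain d' where d': "d' > 0" "ball z0 d' \<subseteq> - ?E"
      by (rule openE[of "- ?E" z0]) (use cl z0 in auto)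
    define d where "d = d' / 2"
    have d: "d > 0" using d' by (simp add: d_def)
    have sep: "d \<le> cmod (complex_of_real t - w)" if "t \<in> {- K..\<alpha>} \<union> {\<beta>..K}" "dist w z0 \<le> d" for t w
    proof (rule ccontr)
      assume "\<not> ?thesis"
      hence "dist z0 (complex_of_real t) < d'"
        using that(2) dist_triangle[of z0 "complex_of_real t" w] by (simp add: d_def dist_norm norm_minus_commute)
      hence "complex_of_real t \<in> - ?E" using d'(2) by auto
      with that(1) show False by blast
    qed
    let ?k = "\<lambda>w t. complex_of_real t / (complex_of_real t - w)"
    have meas: "?k w \<in> borel_measurable borel" for w
      by (intro borel_measurable_divide borel_measurable_continuous_onI continuous_intros)
    have int: "integrable \<sigma> (?k w)" if w: "dist w z0 \<le> d" for w
    proof (rule integrable_const_bound)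
      show "AE t in \<sigma>. cmod (?k w t) \<le> K / d"
        using AE_E
      proof eventually_elim
        case (elim t)
        hence "d \<le> cmod (complex_of_real t - w)" using EK w by (intro sep) auto
        moreover have "\<bar>t\<bar> \<le> K" using elim K3 gap by auto
        ultimately show ?case unfolding norm_divide using d by (intro frac_le) auto
      qed
      show "?k w \<in> borel_measurable \<sigma>" using meas by (simp add: measurable_iff_borel)
    qed
    define L where "L = K / d\<^sup>2 * M 1"
    have L: "L > 0" using K3 d m0 by (simp add: L_def)
    have lip1: "dist (approx n w) (approx n w') \<le> L * dist w w'" if w: "w \<in> cball z0 d" "w' \<in> cball z0 d" for n w w'
    proof -
      have "approx n w - approx n w' = (\<Sum>x\<in>X n. complex_of_real (weight n x) * (?k w x - ?k w' x))"
        by (simp add: approx_def sum_subtractf right_diff_distrib)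
      also have "cmod \<dots> \<le> (\<Sum>x\<in>X n. weight n x * (K / d\<^sup>2 * cmod (w - w')))"
      proof (rule norm_sum[THEN order.trans], rule sum_mono)
        fix x assume x: "x \<in> X n"
        have "cmod (?k w x - ?k w' x) \<le> K / d\<^sup>2 * cmod (w - w')"
          using XK[OF x] Xb[OF x] sep w d K3 by (intro kernel_lipschitz) (auto simp: dist_commute)
        thus "cmod (complex_of_real (weight n x) * (?k w x - ?k w' x)) \<le> weight n x * (K / d\<^sup>2 * cmod (w - w'))"
          using weight_pos[OF x] by (simp only: norm_mult norm_of_real abs_of_pos mult_left_mono less_imp_le)
      qed
      also have "\<dots> = L * cmod (w - w')" unfolding sum_distrib_right[symmetric] sum_weight by (simp add: L_def)
      finally show ?thesis by (simp add: dist_norm)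
    qed
    have lip2: "dist (cauchy [:0, 1:] w) (cauchy [:0, 1:] w') \<le> L * dist w w'" if w: "w \<in> cball z0 d" "w' \<in> cball z0 d" for w w'
    proof -
      have i: "integrable \<sigma> (?k w)" "integrable \<sigma> (?k w')" using w by (auto intro!: int simp: dist_commute)
      have "cauchy [:0, 1:] w - cauchy [:0, 1:] w' = (LINT t|\<sigma>. ?k w t - ?k w' t)"
        unfolding cauchy_def using i by simp
      also have "cmod \<dots> \<le> K / d\<^sup>2 * cmod (w - w') * M 1"
      proof (rule norm_integral_le)
        show "AE t in \<sigma>. cmod (?k w t - ?k w' t) \<le> K / d\<^sup>2 * cmod (w - w')"
          using AE_E
        proof eventually_elim
          case (elim t)
          hence t: "t \<in> {- K..\<alpha>} \<union> {\<beta>..K}" using EK by blast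
          moreover have "\<bar>t\<bar> \<le> K" using elim K3 gap by auto
          ultimately show ?case using sep[OF t] w d K3 by (intro kernel_lipschitz) (auto simp: dist_commute)
        qed
      qed (use i in auto)
      finally show ?thesis by (simp add: dist_norm L_def mult_ac)
    qed
    have pt: "(\<lambda>n. approx n w) \<longlonglongrightarrow> cauchy [:0, 1:] w" if w: "w \<in> cball z0 d" for w
    proof -
      let ?K = "insert 0 ({- K..\<alpha>} \<union> {\<beta>..K})"
      have wd: "dist w z0 \<le> d" using w by (simp add: dist_commute)
      have wE: "complex_of_real t - w \<noteq> 0" if "t \<in> {- K..\<alpha>} \<union> {\<beta>..K}" for t
        using sep[OF that wd] d by auto
      have c1: "continuous_on ({- K..\<alpha>} \<union> {\<beta>..K}) (?k w)"
        using wE by (intro continuous_intros) auto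
      \<comment> \<open>if \<open>0\<close> is off the segments, it is an isolated point of \<open>?K\<close>; this covers \<open>w = 0\<close>\<close>
      have cont: "continuous_on ?K (?k w)"
      proof (cases "0 \<in> {- K..\<alpha>} \<union> {\<beta>..K}")
        case True
        thus ?thesis using c1 by (simp add: insert_absorb)
      next
        case False
        have "continuous_on ({0} \<union> ({- K..\<alpha>} \<union> {\<beta>..K})) (?k w)"
          using False by (intro continuous_on_closed_Un c1 closed_Un) auto
        thus ?thesis by simp
      qed
      have "(\<lambda>n. \<Sum>x\<in>X n. complex_of_real (weight n x) * ?k w x) \<longlonglongrightarrow> (LINT t|\<sigma>. ?k w t)"
      proof (rule quadrature_converges[OF _ _ _ cont meas int[OF wd]])
        show "compact ?K" by (intro compact_insert compact_Un) auto
        show "X j \<subseteq> ?K" for j using XK by blast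
        show "{-1..\<alpha>} \<union> {\<beta>..1} \<subseteq> ?K" using EK by blast
      qed
      thus ?thesis by (simp add: approx_def cauchy_def)
    qed
    have ul: "uniform_limit (cball z0 d) approx (cauchy [:0, 1:]) sequentially"
      by (rule equi_lipschitz_pointwise_imp_uniform_limit[OF compact_cball lip1 lip2 pt L])
    obtain r where r: "r > 0" "\<And>w. dist (stereo w) (stereo (Some z0)) < r \<Longrightarrow> \<exists>w'. w = Some w' \<and> dist w' z0 < d"
      using stereo_near_finite[OF d] by blast
    have "uniform_limit {w \<in> ?S. dist (stereo w) (stereo z) < r}
        (\<lambda>n w. stereo (approximant n w)) (\<lambda>w. stereo (?F w)) sequentially"
    proof (rule uniform_limitI)
      fix e :: real assume e: "e > 0"
      have "\<forall>\<^sub>F n in sequentially. \<forall>w\<in>cball z0 d. dist (approx n w) (cauchy [:0, 1:] w) < e / 2"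
        using uniform_limitD[OF ul, of "e / 2"] e by simp
      thus "\<forall>\<^sub>F n in sequentially. \<forall>w\<in>{w \<in> ?S. dist (stereo w) (stereo z) < r}. dist (stereo (approximant n w)) (stereo (?F w)) < e"
      proof eventually_elim
        case (elim n)
        show ?case
        proof
          fix w assume w: "w \<in> {w \<in> ?S. dist (stereo w) (stereo z) < r}"
          then obtain v where v: "w = Some v" "dist v z0 < d" using r(2)[of w] Some by auto
          have "dist (stereo (approximant n w)) (stereo (?F w)) \<le> 2 * dist (approx n v) (cauchy [:0, 1:] v)"
            using app[of v n] w v dist_stereo_Some[of "approx n v" "cauchy [:0, 1:] v"] by simp
          also have "dist (approx n v) (cauchy [:0, 1:] v) < e / 2"
            using elim v(2) by (auto simp: dist_commute)
          finally show "dist (stereo (approximant n w)) (stereo (?F w)) < e" by simp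
        qed
      qed
    qed
    with r(1) show ?thesis by blast
  qed
qed

lemma convergence_iff:
  "(\<exists>R. (\<forall>j. pade_approximant (\<lambda>j. M ([:0, 1:] ^ (j + 1))) (ns j) (ns j) (R j)) \<and>
      (\<exists>\<epsilon>\<ge>0. locally_uniform_limit (- (Some ` complex_of_real ` ({-1 - \<epsilon>..\<alpha>} \<union> {\<beta>..1 + \<epsilon>})))
         R (\<lambda>z. case z of None \<Rightarrow> Some 0 | Some w \<Rightarrow> Some (cauchy [:0, 1:] w))))
   \<longleftrightarrow> (\<exists>C. \<forall>j. \<bar>rho j\<bar> \<le> C)"
proof -
  let ?conv = "\<lambda>\<epsilon>. locally_uniform_limit (- (Some ` complex_of_real ` ({-1 - \<epsilon>..\<alpha>} \<union> {\<beta>..1 + \<epsilon>})))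
         approximant (\<lambda>z. case z of None \<Rightarrow> Some 0 | Some w \<Rightarrow> Some (cauchy [:0, 1:] w))"
  have "(\<exists>\<epsilon>\<ge>0. ?conv \<epsilon>) \<longleftrightarrow> (\<exists>C. \<forall>j. \<bar>rho j\<bar> \<le> C)"
  proof
    assume "\<exists>\<epsilon>\<ge>0. ?conv \<epsilon>"
    then obtain \<epsilon> where e: "\<epsilon> \<ge> 0" "?conv \<epsilon>" by blast
    have "Some w \<in> - (Some ` complex_of_real ` ({-1 - \<epsilon>..\<alpha>} \<union> {\<beta>..1 + \<epsilon>}))" if "cmod w > 1 + \<epsilon>" for w
      using that gap e(1) by auto
    thus "\<exists>C. \<forall>j. \<bar>rho j\<bar> \<le> C"
      by (intro rho_bounded_of_convergence[OF e(2)]) auto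
  next
    assume "\<exists>C. \<forall>j. \<bar>rho j\<bar> \<le> C"
    then obtain C where C: "\<And>j. \<bar>rho j\<bar> \<le> C" by blast
    define \<epsilon> where "\<epsilon> = max 3 (C + 2) - 1"
    have e: "\<epsilon> \<ge> 0" "- 1 - \<epsilon> = - max 3 (C + 2)" "1 + \<epsilon> = max 3 (C + 2)" by (auto simp: \<epsilon>_def)
    have "?conv \<epsilon>" unfolding e(2,3) by (rule convergence_of_rho_bounded[OF C])
    with e(1) show "\<exists>\<epsilon>\<ge>0. ?conv \<epsilon>" by blast
  qed
  thus ?thesis unfolding approximant_unique by simp
qed

end

section \<open>The equivalences\<close>

theorem theorem6p3:
  fixes \<alpha> \<beta> :: real and \<sigma> :: "real measure" and E :: "real set"
    and \<FF> :: "complex \<Rightarrow> complex" and s :: "nat \<Rightarrow> real" and s_m1 :: real and \<nn> :: "nat \<Rightarrow> nat"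
  assumes "-1 \<le> \<alpha>" and "\<alpha> \<le> 0" and "0 \<le> \<beta>" and "\<beta> \<le> 1"
    and E: "E = {-1..\<alpha>} \<union> {\<beta>..1}"
    and "finite_measure \<sigma>" and "sets \<sigma> = sets borel"
    and "emeasure \<sigma> (- E) = 0" and "infinite (measure_support \<sigma>)"
    and \<FF>: "\<FF> = (\<lambda>z. LINT t|\<sigma>. complex_of_real t / (complex_of_real t - z))"
    and "\<FF> \<in> D_minus_minus_infty"
    and s: "s = (\<lambda>j. LINT t|\<sigma>. t ^ (j + 1))"
    and s_m1: "s_m1 = (LINT t|\<sigma>. 1)"
    and \<nn>: "\<nn> = normal_index s"
  shows "((\<exists>U L. block_UL \<nn> (monic_gen_jacobi \<FF>) U L (s (\<nn> 1 - 1) / s_m1) \<and> bounded_in_ell2 U)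
           \<longleftrightarrow> (\<exists>L U. block_LU \<nn> (monic_jacobi \<sigma>) L U \<and> bounded_in_ell2 U))
       \<and> ((\<exists>L U. block_LU \<nn> (monic_jacobi \<sigma>) L U \<and> bounded_in_ell2 U)
           \<longleftrightarrow> (\<exists>R. (\<forall>j. pade_approximant s (\<nn> j) (\<nn> j) (R j)) \<and>
                (\<exists>\<epsilon>\<ge>0. locally_uniform_limit
                   (- (Some ` complex_of_real ` ({-1 - \<epsilon>..\<alpha>} \<union> {\<beta>..1 + \<epsilon>})))
                   R (\<lambda>z. case z of None \<Rightarrow> Some 0 | Some w \<Rightarrow> Some (\<FF> w)))))"
proof -
  have E_subset: "E \<subseteq> {-1..1}" using assms(1-4) by (auto simp: E)
  have E_sets: "- E \<in> sets \<sigma>" using \<open>sets \<sigma> = sets borel\<close> by (simp add: E)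
  interpret finite_measure \<sigma> by fact
  interpret measure_with_gap \<sigma> \<alpha> \<beta>
  proof
    have "emeasure \<sigma> (- {-1..1}) \<le> emeasure \<sigma> (- E)"
      using E_subset E_sets by (intro emeasure_mono) auto
    thus "emeasure \<sigma> (- {-1..1}) = 0" using \<open>emeasure \<sigma> (- E) = 0\<close> by simp
    show "emeasure \<sigma> (- ({-1..\<alpha>} \<union> {\<beta>..1})) = 0" using \<open>emeasure \<sigma> (- E) = 0\<close> by (simp add: E)
  qed fact+
  have F_eq: "\<FF> = cauchy [:0, 1:]" by (simp add: \<FF> cauchy_def fun_eq_iff)
  have s_eq: "s = (\<lambda>j. M ([:0, 1:] ^ (j + 1)))"
    unfolding s M_def by (intro ext Bochner_Integration.integral_cong) (simp_all add: poly_power)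
  have s_m1_eq: "s_m1 = M 1" by (simp add: s_m1 M_def)
  have nn_eq: "\<nn> = ns" by (simp add: \<nn> s_eq ns_def)
  show ?thesis
    unfolding nn_eq s_m1_eq unfolding s_eq F_eq
      UL_bounded_iff LU_bounded_iff convergence_iff U_bounded_iff_rho
    by blast
qed

end
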